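(* Let $k\ge1$ be an integer. (a) For $\alpha\notin\mathbb Q$ and $(\alpha,\vec\nu)$ allowable, $B_k(\alpha,\vec\nu)$ is a semi-Denjoy minimal set (under the shift) with unique invariant probability measure $\lambda_k(\alpha,\vec\nu)$. (b) For $p/q\in\mathbb Q$ in lowest terms and $(p/q,\vec\nu)$ allowable, $B_k(p/q,\vec\nu)$ is a finite collection of periodic orbits, each with rotation number $\hat\rho_k$ equal to $p/q$ and with period $qk/\gcd(p,k)$, and $\lambda_k(p/q,\vec\nu)$ is a convex combination of the measures supported on these periodic orbits. (c) A set $\hat Z\subset\Omega_k$ is a recurrent symbolic kfsm set with $\hat\rho_k(\hat Z)=\omega$ if and only if $\hat Z=B_k(\omega,\vec\nu)$ for some $\vec\nu$ with $(\omega,\vec\nu)$ allowable. Thus the collection of invariant probability measures supported on symbolic recurrent kfsm sets in $\Omega_k$ is exactly the collection of $\lambda_k(\omega,\vec\nu)$ for all allowable $(\omega,\vec\nu)$.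
   Context: Symbol spaces (one-sided sequences, lexicographic order, $\sigma$ the left shift): $\Omega_\infty\subset\mathbb Z^{\mathbb N}$ is the subshift with allowable transitions $2j\to2j$, $2j\to2j+1$, $2j+1\to2j+2$, $2j+1\to2j+3$; $\Omega_k\subset\{0,\dots,2k-1\}^{\mathbb N}$ is the subshift with the same transitions with symbols reduced mod $2k$. $\hat T_\infty$ adds 2 to each symbol of a sequence in $\Omega_\infty$; $\hat p_k:\Omega_\infty\to\Omega_k$ reduces symbols mod $2k$; $\hat\pi_k:\Omega_k\to\{0,1\}^{\mathbb N}$ reduces symbols mod 2. A shift-invariant $\hat Z'\subset\Omega_\infty$ is kfsm if $\hat T_\infty^k(\hat Z')=\hat Z'$ and $\underline s<\underline t$ in $\hat Z'$ implies $\sigma(\underline s)\le\sigma(\underline t)$. A shift-invariant $\hat Z\subset\Omega_k$ is symbolic kfsm if there is a shift-invariant kfsm $\hat Z'\subset\Omega_\infty$ with $\hat p_k(\hat Z')=\hat Z$. Symbolic kfsm sets considered are compact and nonempty; a set is recurrent if each of its points $x$ satisfies $\sigma^{n_i}(x)\to x$ for some $n_i\to\infty$. Rotation number: for $\underline s\in\{0,1\}^{\mathbb N}$, $\hat\rho(\underline s)=\lim_n\frac1{n+1}\sum_{i=0}^ns_i$; for $\hat Z\subset\Omega_k$, $\hat\rho_k(\hat Z)=\hat\rho(\hat\pi_k(\hat Z))$ (written as a number when it is a single value). HM construction: $(\omega,\vec\nu)$ is allowable if $\omega\in[0,1]$, $\vec\nu=(\nu_1,\dots,\nu_k)$, $\nu_i\ge0$,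 $\sum\nu_i=k(1-\omega)$. Put $\ell_{2j}=\sum_{i=1}^{j}\nu_i+j\omega$, $\ell_{2j+1}=\sum_{i=1}^{j+1}\nu_i+j\omega$ ($0\le j\le k-1$), $\ell_{2k}=k$, $X_i=[\ell_i,\ell_{i+1}]$ for $0\le i\le 2k-1$, in $S_k=[0,k]/(0\sim k)$, and $R_\omega(x)=x+\omega\bmod k$. $G$ is the set of $x\in S_k$ whose forward $R_\omega$-orbit avoids all $\ell_i$; for $x\in G$, $\zeta(x)_n=i$ if $R_\omega^n(x)\in\mathrm{Int}\,X_i$. $B_k(\omega,\vec\nu)=\overline{\zeta(G)}\subset\{0,\dots,2k-1\}^{\mathbb N}$ and $\lambda_k(\omega,\vec\nu)=\zeta_*(m)/k$, $m$ Lebesgue measure on $S_k$. Semi-Denjoy: a continuous degree one circle map $h$ with a nondecreasing lift and irrational rotation number has exactly one minimal set; a minimal set is called semi-Denjoy if its dynamics is topologically conjugate to the minimal set of such an $h$. *)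

theory Defs
  imports
    "HOL-Probability.Probability"
    "HOL-Library.Fun_Lexorder"
    "HOL-Library.Real_Mod"
begin

section \<open>Topological dynamics\<close>

definition invariant_set :: "('a \<Rightarrow> 'a) \<Rightarrow> 'a set \<Rightarrow> bool" where
  "invariant_set f Y \<longleftrightarrow> f ` Y = Y"

definition minimal_set :: "('a::topological_space \<Rightarrow> 'a) \<Rightarrow> 'a set \<Rightarrow> bool" where
  "minimal_set f M \<longleftrightarrow> compact M \<and> M \<noteq> {} \<and> invariant_set f M \<and>
     (\<forall>N. N \<subseteq> M \<longrightarrow> compact N \<longrightarrow> N \<noteq> {} \<longrightarrow> invariant_set f N \<longrightarrow> N = M)"

definition recurrent_set :: "('a::topological_space \<Rightarrow> 'a) \<Rightarrow> 'a set \<Rightarrow> bool" where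
  "recurrent_set f Y \<longleftrightarrow>
     (\<forall>x\<in>Y. \<exists>m :: nat \<Rightarrow> nat. filterlim m at_top sequentially \<and> (\<lambda>i. (f ^^ m i) x) \<longlonglongrightarrow> x)"

definition periodic_orbit :: "('a \<Rightarrow> 'a) \<Rightarrow> nat \<Rightarrow> 'a set \<Rightarrow> bool" where
  "periodic_orbit f n P \<longleftrightarrow> 0 < n \<and>
     (\<exists>x. (f ^^ n) x = x \<and> (\<forall>m. 0 < m \<and> m < n \<longrightarrow> (f ^^ m) x \<noteq> x) \<and> P = range (\<lambda>i. (f ^^ i) x))"

definition top_conjugate ::
  "('a::topological_space \<Rightarrow> 'a) \<Rightarrow> 'a set \<Rightarrow> ('b::topological_space \<Rightarrow> 'b) \<Rightarrow> 'b set \<Rightarrow> bool" where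
  "top_conjugate f X g Y \<longleftrightarrow>
     (\<exists>\<phi> \<psi>. homeomorphism X Y \<phi> \<psi> \<and> (\<forall>x\<in>X. \<phi> (f x) = g (\<phi> x)))"

text \<open>Invariant Borel probability measures carried by \<open>Z\<close>.\<close>

definition inv_prob_measures :: "('a::topological_space \<Rightarrow> 'a) \<Rightarrow> 'a set \<Rightarrow> 'a measure set" where
  "inv_prob_measures f Z =
     {\<mu>. sets \<mu> = sets borel \<and> prob_space \<mu> \<and> distr \<mu> borel f = \<mu> \<and> measure \<mu> Z = 1}"

section \<open>Semi-Denjoy minimal sets\<close>

text \<open>The circle is the unit circle of the complex plane, with covering map
  \<open>x \<mapsto> cis (2 * pi * x)\<close> from the reals.\<close>

definition monotone_degree_one_lift :: "(complex \<Rightarrow> complex) \<Rightarrow> (real \<Rightarrow> real) \<Rightarrow> bool" where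
  "monotone_degree_one_lift h H \<longleftrightarrow>
     continuous_on UNIV H \<and> mono H \<and> (\<forall>x. H (x + 1) = H x + 1) \<and>
     (\<forall>x. h (cis (2 * pi * x)) = cis (2 * pi * H x))"

definition has_rotation_number :: "(real \<Rightarrow> real) \<Rightarrow> real \<Rightarrow> bool" where
  "has_rotation_number H \<rho> \<longleftrightarrow> (\<forall>x. (\<lambda>n. ((H ^^ n) x - x) / real n) \<longlonglongrightarrow> \<rho>)"

definition semi_denjoy_minimal :: "('a::topological_space \<Rightarrow> 'a) \<Rightarrow> 'a set \<Rightarrow> bool" where
  "semi_denjoy_minimal f Z \<longleftrightarrow> minimal_set f Z \<and>
     (\<exists>h H \<rho> M. continuous_on (sphere 0 1) h \<and> h ` sphere 0 1 \<subseteq> sphere 0 1 \<and>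
        monotone_degree_one_lift h H \<and> has_rotation_number H \<rho> \<and> \<rho> \<notin> \<rat> \<and>
        M \<subseteq> sphere 0 1 \<and> minimal_set h M \<and> top_conjugate f Z h M)"

section \<open>Symbol spaces\<close>

text \<open>All symbol sequences have type \<open>nat \<Rightarrow> int\<close>, with the product of the discrete topologies;
  \<open>less_fun\<close> is the (strict) lexicographic order.\<close>

type_synonym symseq = "nat \<Rightarrow> int"

definition shift :: "symseq \<Rightarrow> symseq" where
  "shift s = (\<lambda>n. s (Suc n))"

definition allowed_transition :: "int \<Rightarrow> int \<Rightarrow> bool" where
  "allowed_transition a b \<longleftrightarrow>
     (\<exists>j. (a = 2*j \<and> (b = 2*j \<or> b = 2*j + 1)) \<or> (a = 2*j + 1 \<and> (b = 2*j + 2 \<or> b = 2*j + 3)))"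

definition Omega_inf :: "symseq set" where
  "Omega_inf = {s. \<forall>n. allowed_transition (s n) (s (Suc n))}"

definition Omega :: "nat \<Rightarrow> symseq set" where
  "Omega k = {s. (\<forall>n. s n \<in> {0..<2 * int k}) \<and>
     (\<forall>n. \<exists>a b. allowed_transition a b \<and> s n = a mod (2 * int k) \<and> s (Suc n) = b mod (2 * int k))}"

definition T_hat :: "symseq \<Rightarrow> symseq" where
  "T_hat s = (\<lambda>n. s n + 2)"

definition p_hat :: "nat \<Rightarrow> symseq \<Rightarrow> symseq" where
  "p_hat k s = (\<lambda>n. s n mod (2 * int k))"

definition pi_hat :: "symseq \<Rightarrow> symseq" where
  "pi_hat s = (\<lambda>n. s n mod 2)"

definition kfsm :: "nat \<Rightarrow> symseq set \<Rightarrow> bool" where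
  "kfsm k Z' \<longleftrightarrow> Z' \<subseteq> Omega_inf \<and> invariant_set shift Z' \<and> (T_hat ^^ k) ` Z' = Z' \<and>
     (\<forall>s\<in>Z'. \<forall>t\<in>Z'. less_fun s t \<longrightarrow> less_fun (shift s) (shift t) \<or> shift s = shift t)"

definition symbolic_kfsm :: "nat \<Rightarrow> symseq set \<Rightarrow> bool" where
  "symbolic_kfsm k Z \<longleftrightarrow> Z \<subseteq> Omega k \<and> invariant_set shift Z \<and> compact Z \<and> Z \<noteq> {} \<and>
     (\<exists>Z'. kfsm k Z' \<and> p_hat k ` Z' = Z)"

text \<open>\<open>rho_eq s r\<close>: the rotation number of the 0-1 sequence \<open>s\<close> exists and equals \<open>r\<close>.
  \<open>rho_set_eq Z r\<close>: every point of the nonempty set \<open>Z\<close> has a rotation number, and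
  \<open>r\<close> is their only value.\<close>

definition rho_eq :: "symseq \<Rightarrow> real \<Rightarrow> bool" where
  "rho_eq s r \<longleftrightarrow> (\<lambda>n. (1 / real (n + 1)) * (\<Sum>i=0..n. real_of_int (s i))) \<longlonglongrightarrow> r"

definition rho_set_eq :: "symseq set \<Rightarrow> real \<Rightarrow> bool" where
  "rho_set_eq Z r \<longleftrightarrow> Z \<noteq> {} \<and> (\<forall>s \<in> pi_hat ` Z. rho_eq s r)"

section \<open>The Hedlund--Morse construction\<close>

text \<open>A vector \<open>\<nu>\<close> is a function of which only the values at \<open>1, \<dots>, k\<close> matter.\<close>

definition allowable :: "nat \<Rightarrow> real \<Rightarrow> (nat \<Rightarrow> real) \<Rightarrow> bool" where
  "allowable k \<omega> \<nu> \<longleftrightarrow> \<omega> \<in> {0..1} \<and> (\<forall>i\<in>{1..k}. 0 \<le> \<nu> i) \<and> (\<Sum>i=1..k. \<nu> i) = real k * (1 - \<omega>)"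

definition ell :: "real \<Rightarrow> (nat \<Rightarrow> real) \<Rightarrow> nat \<Rightarrow> real" where
  "ell \<omega> \<nu> m = (let j = m div 2 in
     if even m then (\<Sum>i=1..j. \<nu> i) + real j * \<omega> else (\<Sum>i=1..j + 1. \<nu> i) + real j * \<omega>)"

text \<open>The even formula also covers the prescribed last endpoint:\<close>

lemma ell_last: "allowable k \<omega> \<nu> \<Longrightarrow> ell \<omega> \<nu> (2 * k) = real k"
  by (simp add: ell_def allowable_def algebra_simps)

text \<open>The circle of length \<open>k\<close> is represented by \<open>{0..<k}\<close>. As 0 is an endpoint \<open>ell \<omega> \<nu> 0\<close>, on \<open>HM_good\<close>
  the interior of \<open>HM_X\<close> in the circle agrees with its interior in the reals.\<close>

definition HM_rot :: "nat \<Rightarrow> real \<Rightarrow> real \<Rightarrow> real" where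
  "HM_rot k \<omega> x = (x + \<omega>) rmod real k"

definition HM_X :: "real \<Rightarrow> (nat \<Rightarrow> real) \<Rightarrow> nat \<Rightarrow> real set" where
  "HM_X \<omega> \<nu> i = {ell \<omega> \<nu> i .. ell \<omega> \<nu> (i + 1)}"

definition HM_good :: "nat \<Rightarrow> real \<Rightarrow> (nat \<Rightarrow> real) \<Rightarrow> real set" where
  "HM_good k \<omega> \<nu> =
     {x \<in> {0..<real k}. \<forall>n. \<forall>i \<le> 2 * k. (HM_rot k \<omega> ^^ n) x \<noteq> ell \<omega> \<nu> i rmod real k}"

definition HM_zeta :: "nat \<Rightarrow> real \<Rightarrow> (nat \<Rightarrow> real) \<Rightarrow> real \<Rightarrow> symseq" where
  "HM_zeta k \<omega> \<nu> x = (\<lambda>n. int (THE i. i < 2 * k \<and> (HM_rot k \<omega> ^^ n) x \<in> interior (HM_X \<omega> \<nu> i)))"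

definition HM_B :: "nat \<Rightarrow> real \<Rightarrow> (nat \<Rightarrow> real) \<Rightarrow> symseq set" where
  "HM_B k \<omega> \<nu> = closure (HM_zeta k \<omega> \<nu> ` HM_good k \<omega> \<nu>)"

text \<open>\<open>HM_zeta\<close> is only meaningful on the full-measure set \<open>HM_good\<close>, so Lebesgue measure is
  restricted to that set before it is pushed forward.\<close>

definition HM_lambda :: "nat \<Rightarrow> real \<Rightarrow> (nat \<Rightarrow> real) \<Rightarrow> symseq measure" where
  "HM_lambda k \<omega> \<nu> = scale_measure (ennreal (1 / real k))
     (distr (restrict_space lborel (HM_good k \<omega> \<nu>)) borel (HM_zeta k \<omega> \<nu>))"

end

theory Submission imports Defs begin

text \<open>A sequence in \<open>Omega_inf\<close> is determined by \<open>u n = s n div 2\<close>, which is nondecreasing with increments 0 or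
  1, and \<open>s n = u n + u (n + 1)\<close>. In these coordinates the lexicographic monotonicity of the shift says
  that a kfsm set is totally ordered for the pointwise order, as in Aubry--Mather theory. Such a chain
  has a rotation number \<open>w\<close> with uniformly bounded deviations, so \<open>\<phi> u = limsup (u n - n w)\<close> is an order
  preserving map to the line that conjugates the shift to the translation by \<open>w\<close>, and
  \<open>c j = Inf {\<phi> u | u 0 \<ge> j}\<close> are the lifted end points of a Hedlund--Morse partition: the itinerary of
  \<open>x\<close> lies below \<open>u\<close> if \<open>x < \<phi> u\<close> and above \<open>u\<close> if \<open>x > \<phi> u\<close>.

  If \<open>w\<close> is irrational, density of the orbits of the rotation turns this sandwich into minimality,
  recurrence and the identification of the recurrent kfsm sets, and \<open>\<phi>\<close> pushes every invariant measure
  to Lebesgue measure. If \<open>w\<close> is rational, recurrent points are periodic, and \<open>\<phi>\<close> is replaced by a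
  weighted count of lifts, whose jumps can be prescribed so that the Hedlund--Morse measure becomes
  any given invariant measure. For semi-Denjoy minimality a chain is embedded in the line by a
  weighted sum of its coordinates, on which the shift acts as a monotone Lipschitz map that extends to
  the whole line.\<close>

section \<open>Cylinders and staircases\<close>

text \<open>The order exists only on lifts, since \<open>Omega k\<close> is cyclic. The work is
  therefore done on \<open>Wof k Z\<close>, the set of all staircases over \<open>Z\<close>, on
  which translation by multiples of \<open>k\<close> acts. This periodicity also bounds deviations:
  each member is trapped between two translates of any other, two periods apart, and stays trapped
  under all shifts.

  The height need not be injective, and at a parameter equal to the height of \<open>u\<close> the
  itinerary may exceed \<open>u\<close>. The irrational arguments therefore squeeze a window of
  coordinates between two strictly different heights, which irrationality always supplies. For
  rational \<open>w\<close> the returns of a point may have the same height as the point, and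
  distinct staircases of equal height would share a single point of the line. The weighted count
  instead opens an interval of prescribed length for each of them. The possible collapse of heights
  is also why the embedding used for semi-Denjoy minimality is a different function: it has to be
  injective as well as monotone.\<close>

instance int :: second_countable_topology
proof
  \<comment> \<open>Open rays with integer end points generate the topology. Second countability
    allows Borel measurability of maps into sequences to be tested coordinatewise.\<close>
  show "\<exists>B::int set set. countable B \<and> open = generate_topology B"
    by (intro exI[of _ "range lessThan \<union> range greaterThan"]) (auto simp: open_int_def)
qed

definition agree :: "nat \<Rightarrow> (nat \<Rightarrow> 'a) \<Rightarrow> (nat \<Rightarrow> 'a) \<Rightarrow> bool" where
  "agree N u v \<longleftrightarrow> (\<forall>i<N. u i = v i)"

lemma agree_refl [simp]: "agree N u u"
  by (simp add: agree_def)

lemma agree_sym: "agree N u v \<Longrightarrow> agree N v u"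
  by (simp add: agree_def)

lemma agree_trans: "agree N u v \<Longrightarrow> agree N v w \<Longrightarrow> agree N u w"
  by (simp add: agree_def)

lemma agree_le: "agree N u v \<Longrightarrow> M \<le> N \<Longrightarrow> agree M u v"
  by (simp add: agree_def)

lemma agree_imp_eq: "(\<And>N. agree N u v) \<Longrightarrow> u = v"
  by (auto simp: agree_def)

lemma open_cylinder: "open {y :: symseq. agree N x y}"
proof -
  have "open {y :: symseq. \<forall>i\<in>{..<N}. y (id i) \<in> {x i}}"
    by (rule product_topology_basis') (simp_all add: discrete_topology_class.open_discrete)
  also have "{y :: symseq. \<forall>i\<in>{..<N}. y (id i) \<in> {x i}} = {y. agree N x y}"
    by (auto simp: agree_def)
  finally show ?thesis .
qed

lemma open_contains_cylinder:
  fixes x :: symseq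
  assumes "open U" "x \<in> U"
  shows "\<exists>N. \<forall>y. agree N x y \<longrightarrow> y \<in> U"
proof -
  have "openin (product_topology (\<lambda>i. euclidean) UNIV) U"
    using assms(1) by (simp add: euclidean_product_topology)
  from product_topology_open_contains_basis[OF this assms(2)]
  obtain X where X: "x \<in> Pi\<^sub>E UNIV X" "finite {i. X i \<noteq> UNIV}" "Pi\<^sub>E UNIV X \<subseteq> U"
    by auto
  obtain N where N: "\<And>i. X i \<noteq> UNIV \<Longrightarrow> i < N"
    using X(2) by (metis (mono_tags, lifting) finite_nat_bounded lessThan_iff mem_Collect_eq subset_iff)
  have "y \<in> U" if "agree N x y" for y
  proof -
    have "y i \<in> X i" for i
    proof (cases "X i = UNIV")
      case False
      then have "y i = x i" using N[of i] that by (simp add: agree_def)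
      then show ?thesis using X(1) by (simp add: PiE_iff)
    qed simp
    then show ?thesis using X(3) by (auto simp: PiE_iff)
  qed
  then show ?thesis by blast
qed

lemma closure_agree:
  fixes x :: symseq
  shows "x \<in> closure S \<longleftrightarrow> (\<forall>N. \<exists>y\<in>S. agree N x y)"
proof
  assume x: "x \<in> closure S"
  show "\<forall>N. \<exists>y\<in>S. agree N x y"
  proof
    fix N
    have "open {y. agree N x y}" "x \<in> {y. agree N x y}"
      by (simp_all add: open_cylinder)
    then have "S \<inter> {y. agree N x y} \<noteq> {}"
      using x by (meson closure_iff_nhds_not_empty disjoint_iff_not_equal subset_refl)
    then show "\<exists>y\<in>S. agree N x y" by auto
  qed
next
  assume *: "\<forall>N. \<exists>y\<in>S. agree N x y"
  show "x \<in> closure S"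
    unfolding closure_iff_nhds_not_empty
  proof (intro allI impI)
    fix A V :: "symseq set" assume V: "V \<subseteq> A" "open V" "x \<in> V"
    then obtain N where N: "\<forall>y. agree N x y \<longrightarrow> y \<in> V"
      using open_contains_cylinder by blast
    then show "S \<inter> A \<noteq> {}" using * V(1) by blast
  qed
qed

lemma tendsto_agree:
  fixes x :: symseq
  shows "(u \<longlongrightarrow> x) F \<longleftrightarrow> (\<forall>N. eventually (\<lambda>i. agree N x (u i)) F)"
proof
  assume "(u \<longlongrightarrow> x) F"
  then show "\<forall>N. eventually (\<lambda>i. agree N x (u i)) F"
    using topological_tendstoD[of u x F, OF _ open_cylinder[of _ x]] by simp
next
  assume *: "\<forall>N. eventually (\<lambda>i. agree N x (u i)) F"
  show "(u \<longlongrightarrow> x) F"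
  proof (rule topological_tendstoI)
    fix S assume "open S" "x \<in> S"
    then obtain N where "\<forall>y. agree N x y \<longrightarrow> y \<in> S" using open_contains_cylinder by blast
    then show "eventually (\<lambda>i. u i \<in> S) F"
      using *[rule_format, of N] by (auto elim: eventually_mono)
  qed
qed

lemma compact_symbols: "compact {s :: symseq. \<forall>n. s n \<in> {a..<b}}"
proof -
  have "compactin (product_topology (\<lambda>i. euclidean) UNIV) (Pi\<^sub>E (UNIV::nat set) (\<lambda>_. {a..<b}))"
    by (subst compactin_PiE) (simp add: finite_imp_compact)
  then have "compact (Pi\<^sub>E (UNIV::nat set) (\<lambda>_. {a..<b}))"
    by (simp add: euclidean_product_topology)
  moreover have "Pi\<^sub>E (UNIV::nat set) (\<lambda>_. {a..<b}) = {s. \<forall>n. s n \<in> {a..<b}}"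
    by (auto simp: PiE_iff)
  ultimately show ?thesis by simp
qed

lemma continuous_shift: "continuous_on A shift"
  unfolding shift_def
  by (rule continuous_on_coordinatewise_then_product)
     (rule continuous_on_subset[OF continuous_on_product_coordinates], simp)

lemma continuous_on_local_const:
  fixes f :: "symseq \<Rightarrow> 'b::topological_space"
  assumes "\<And>x y. agree N x y \<Longrightarrow> f x = f y"
  shows "continuous_on A f"
proof -
  have "(f \<longlongrightarrow> f x) (at x within A)" for x
  proof (rule tendsto_eventually)
    have "eventually (\<lambda>y. y \<in> {y. agree N x y}) (nhds x)"
      by (intro eventually_nhds_in_open open_cylinder) simp
    then have "eventually (\<lambda>y. f y = f x) (nhds x)"
      by eventually_elim (use assms in auto)
    then show "eventually (\<lambda>y. f y = f x) (at x within A)"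
      by (simp add: eventually_at_filter eventually_mono)
  qed
  then show ?thesis by (simp add: continuous_on_def)
qed

lemma shift_apply: "shift s n = s (Suc n)"
  by (simp add: shift_def)

lemma funpow_shift: "(shift ^^ m) s n = s (m + n)"
  by (induction m arbitrary: n) (simp_all add: shift_apply)

lemma closed_symseq_agree:
  fixes x :: symseq
  assumes "closed S" "\<And>N. \<exists>y\<in>S. agree N x y"
  shows "x \<in> S"
  using assms closure_agree[of x S] by (simp add: closure_closed)

section \<open>Staircases, their codes and their lifts\<close>

text \<open>A point of \<open>Omega_inf\<close> is coded by a staircase \<open>u\<close> via \<open>s n = u n + u (Suc n)\<close>, that is
  \<open>u n = s n div 2\<close>. The translation by \<open>m\<close> corresponds to \<open>T_hat ^^ m\<close>.\<close>

definition stair :: "symseq \<Rightarrow> bool" where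
  "stair u \<longleftrightarrow> (\<forall>n. u (Suc n) = u n \<or> u (Suc n) = u n + 1)"

definition translate :: "int \<Rightarrow> symseq \<Rightarrow> symseq" where
  "translate m u = (\<lambda>n. u n + m)"

definition code :: "symseq \<Rightarrow> symseq" where
  "code u = (\<lambda>n. u n + u (Suc n))"

definition symb :: "nat \<Rightarrow> symseq \<Rightarrow> symseq" where
  "symb k u = (\<lambda>n. (u n + u (Suc n)) mod (2 * int k))"

text \<open>The symbols modulo 2 are the increments of a staircase over \<open>s\<close>, and
  \<open>s 0 div 2\<close> fixes its start. Among the lifts of a coded \<open>s\<close>, which
  differ by multiples of \<open>k\<close>, this is the one starting in
  \<open>0..k-1\<close>.\<close>

definition lift :: "symseq \<Rightarrow> symseq" where
  "lift s = (\<lambda>n. s 0 div 2 + (\<Sum>i<n. s i mod 2))"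

text \<open>All lifts rather than one per point: comparisons need every translate by a multiple of
  \<open>k\<close>.\<close>

definition Wof :: "nat \<Rightarrow> symseq set \<Rightarrow> symseq set" where
  "Wof k Z = {u. stair u \<and> symb k u \<in> Z}"

lemma translate_apply: "translate m u n = u n + m"
  by (simp add: translate_def)

lemmas seq_apply = shift_apply funpow_shift translate_apply

lemma translate_translate [simp]: "translate a (translate b u) = translate (b + a) u"
  by (auto simp: translate_def)

lemma translate_0 [simp]: "translate 0 u = u"
  by (simp add: translate_def)

lemma shift_trans: "shift (translate m u) = translate m (shift u)"
  by (auto simp: translate_def shift_def)

lemma stair_trans [simp]: "stair (translate m u) \<longleftrightarrow> stair u"
  by (auto simp: stair_def translate_apply algebra_simps)

lemma stair_shift: "stair u \<Longrightarrow> stair (shift u)"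
  by (auto simp: stair_def shift_apply)

lemma stair_funpow_shift: "stair u \<Longrightarrow> stair ((shift ^^ n) u)"
  by (auto simp: stair_def funpow_shift)

lemma symb_shift: "symb k (shift u) = shift (symb k u)"
  by (auto simp: symb_def shift_def)

lemma symb_funpow_shift: "symb k ((shift ^^ n) u) = (shift ^^ n) (symb k u)"
  by (auto simp: symb_def funpow_shift)

lemma symb_trans [simp]: "symb k (translate (int k * m) u) = symb k u"
proof
  fix n
  have "u n + int k * m + (u (Suc n) + int k * m) = u n + u (Suc n) + (2 * int k) * m"
    by (simp add: algebra_simps)
  then show "symb k (translate (int k * m) u) n = symb k u n"
    unfolding symb_def translate_apply by (metis mod_mult_self2)
qed

lemma symb_agree: "agree (Suc N) u v \<Longrightarrow> agree N (symb k u) (symb k v)"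
  by (auto simp: agree_def symb_def)

lemma mod_2_mod_2k: "(x mod (2 * int k)) mod 2 = x mod 2"
  by (simp add: mod_mod_cancel)

text \<open>\<open>u n + u (Suc n)\<close> is \<open>2 * u n\<close> plus the increment, and its
  parity survives reduction modulo the even number \<open>2 * k\<close>.\<close>

lemma stair_incr:
  assumes "stair u"
  shows "symb k u n mod 2 = u (Suc n) - u n"
proof -
  have "symb k u n mod 2 = (u n + u (Suc n)) mod 2" by (simp add: symb_def mod_2_mod_2k)
  also have "\<dots> = u (Suc n) - u n"
    using assms by (auto simp: stair_def dest!: spec[of _ n])
  finally show ?thesis .
qed

lemma stair_eq_incr: "u n = u 0 + (\<Sum>i<n. u (Suc i) - u i)" for u :: symseq
  by (simp add: sum_lessThan_telescope)

lemma div2_mod_2k: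
  assumes "k \<ge> 1"
  shows "(x mod (2 * int k)) div 2 = (x div 2) mod int k"
  using assms by (simp add: mod_mult2_eq' zmod_zmult2_eq)

text \<open>Reduction modulo \<open>2 * k\<close> forgets only the multiple of \<open>k\<close> in
  the starting level; all increments are recovered.\<close>

lemma lift_sym:
  assumes "k \<ge> 1" "stair u"
  shows "lift (symb k u) = translate (int k * - (u 0 div int k)) u"
proof
  fix n
  have "symb k u 0 div 2 = ((u 0 + u 1) div 2) mod int k"
    using div2_mod_2k[OF assms(1)] by (simp add: symb_def)
  also have "(u 0 + u 1) div 2 = u 0"
    using assms(2) by (auto simp: stair_def dest!: spec[of _ 0])
  finally have "symb k u 0 div 2 = u 0 - int k * (u 0 div int k)"
    by (simp add: minus_mult_div_eq_mod)
  moreover have "(\<Sum>i<n. symb k u i mod 2) = u n - u 0"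
    using stair_eq_incr[of u n] by (simp add: stair_incr[OF assms(2)])
  ultimately show "lift (symb k u) n = translate (int k * - (u 0 div int k)) u n"
    by (simp add: lift_def translate_apply)
qed

lemma symb_lift_sym: "k \<ge> 1 \<Longrightarrow> stair u \<Longrightarrow> symb k (lift (symb k u)) = symb k u"
  by (simp add: lift_sym del: mult_minus_right)

lemma stair_lift_sym: "k \<ge> 1 \<Longrightarrow> stair u \<Longrightarrow> stair (lift (symb k u))"
  by (simp add: lift_sym)

lemma symb_eq_iff:
  assumes "k \<ge> 1" "stair u" "stair v"
  shows "symb k u = symb k v \<longleftrightarrow> (\<exists>m. v = translate (int k * m) u)"
proof
  assume "symb k u = symb k v"
  then have "translate (int k * - (u 0 div int k)) u = translate (int k * - (v 0 div int k)) v"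
    using lift_sym assms by metis
  then have "translate (int k * (v 0 div int k)) (translate (int k * - (u 0 div int k)) u) = v"
    by simp
  then have "v = translate (int k * (v 0 div int k - u 0 div int k)) u"
    by (simp add: algebra_simps)
  then show "\<exists>m. v = translate (int k * m) u" by blast
qed auto

lemma lift_agree: "agree (Suc N) s t \<Longrightarrow> agree (Suc N) (lift s) (lift t)"
  by (auto simp: agree_def lift_def intro!: sum.cong)

text \<open>Finite-window form of the uniqueness of lifts, for points known only up to a cylinder.
  The window is nonempty because the first symbol fixes the starting level.\<close>

lemma symb_agreeD:
  assumes "k \<ge> 1" "stair u" "stair v" "agree (Suc N) (symb k u) (symb k v)"
  shows "\<exists>m. agree (Suc N) (translate (int k * m) u) v"
proof -
  have "agree (Suc N) (translate (int k * - (u 0 div int k)) u) (translate (int k * - (v 0 div int k)) v)"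
    using lift_agree[OF assms(4)] assms(1-3) by (simp only: lift_sym)
  then have "agree (Suc N) (translate (int k * (v 0 div int k - u 0 div int k)) u) v"
    by (auto simp: agree_def translate_apply algebra_simps)
  then show ?thesis by blast
qed

lemma symb_range: "k \<ge> 1 \<Longrightarrow> symb k u n \<in> {0..<2 * int k}"
  by (simp add: symb_def)

section \<open>Symbolic kfsm sets as chains of staircases\<close>

definition le_chain :: "symseq set \<Rightarrow> bool" where
  "le_chain W \<longleftrightarrow> (\<forall>u\<in>W. \<forall>v\<in>W. u \<le> v \<or> v \<le> u)"

lemma le_chainD: "le_chain W \<Longrightarrow> u \<in> W \<Longrightarrow> v \<in> W \<Longrightarrow> u \<le> v \<or> v \<le> u"
  by (simp add: le_chain_def)

lemma le_chain_less_at: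
  assumes "le_chain W" "u \<in> W" "v \<in> W" "u i < v i"
  shows "u \<le> v"
  using le_chainD[OF assms(1-3)] assms(4) le_funD[of v u i] by force

lemma le_less_fun:
  fixes f g :: symseq
  assumes "f \<le> g" "f \<noteq> g"
  shows "less_fun f g"
proof -
  define i where "i = (LEAST i. f i \<noteq> g i)"
  have "\<exists>i. f i \<noteq> g i" using assms(2) by auto
  then have "f i \<noteq> g i" unfolding i_def by (rule LeastI_ex)
  moreover have "f j = g j" if "j < i" for j using not_less_Least that unfolding i_def by blast
  moreover have "f i \<le> g i" using assms(1) by (simp add: le_fun_def)
  ultimately show ?thesis by (intro less_funI exI[of _ i]) simp
qed

lemma less_fun_total:
  fixes f g :: symseq
  shows "less_fun f g \<or> f = g \<or> less_fun g f"
proof (cases "f = g")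
  case False
  define i where "i = (LEAST i. f i \<noteq> g i)"
  have "\<exists>i. f i \<noteq> g i" using False by auto
  then have "f i \<noteq> g i" unfolding i_def by (rule LeastI_ex)
  moreover have "f j = g j" if "j < i" for j using not_less_Least that unfolding i_def by blast
  moreover from \<open>f i \<noteq> g i\<close> have "f i < g i \<or> g i < f i" by linarith
  ultimately have "(\<exists>i. f i < g i \<and> (\<forall>j<i. f j = g j)) \<or> (\<exists>i. g i < f i \<and> (\<forall>j<i. g j = f j))"
    by fastforce
  then show ?thesis by (auto simp: less_fun_def)
qed simp

lemma less_fun_0: "less_fun f g \<Longrightarrow> f 0 \<le> (g 0 :: int)" for f g :: symseq
proof (elim less_funE)
  fix i assume "f i < g i" "\<And>j. j < i \<Longrightarrow> f j = g j"
  then show "f 0 \<le> g 0" by (cases i) auto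
qed

text \<open>\<open>a div 2\<close> is a level and \<open>a mod 2\<close> says whether it rises: the
  staircase condition in disguise.\<close>

lemma allowed_transition_iff: "allowed_transition a b \<longleftrightarrow> b div 2 = a div 2 + a mod 2"
proof
  assume "allowed_transition a b"
  then obtain j where "(a = 2*j \<and> (b = 2*j \<or> b = 2*j + 1)) \<or> (a = 2*j + 1 \<and> (b = 2*j + 2 \<or> b = 2*j + 3))"
    unfolding allowed_transition_def by blast
  then show "b div 2 = a div 2 + a mod 2"
    by (elim disjE conjE) simp_all
next
  assume *: "b div 2 = a div 2 + a mod 2"
  define j r t where "j = a div 2" and "r = a mod 2" and "t = b mod 2"
  have "a = 2 * j + r" "b = 2 * (j + r) + t"
    using * by (metis j_def r_def t_def mult_div_mod_eq)+
  moreover have "r = 0 \<or> r = 1" "t = 0 \<or> t = 1"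
    by (auto simp: r_def t_def)
  ultimately have "(a = 2*j \<and> (b = 2*j \<or> b = 2*j + 1)) \<or> (a = 2*j + 1 \<and> (b = 2*j + 2 \<or> b = 2*j + 3))"
    by (elim disjE) simp_all
  then show "allowed_transition a b" unfolding allowed_transition_def by blast
qed

lemma code_div2: "stair u \<Longrightarrow> code u n div 2 = u n"
  by (auto simp: stair_def code_def dest!: spec[of _ n])

lemma code_inj: "stair u \<Longrightarrow> stair v \<Longrightarrow> code u = code v \<Longrightarrow> u = v"
proof (rule ext)
  fix n assume "stair u" "stair v" "code u = code v"
  then show "u n = v n" using code_div2[of u n] code_div2[of v n] by simp
qed

lemma code_mono: "u \<le> v \<Longrightarrow> code u \<le> code v"
  by (simp add: le_fun_def code_def add_mono)

lemma code_Omega_inf: "Omega_inf = code ` Collect stair"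
proof (intro subset_antisym subsetI)
  fix s assume s: "s \<in> Omega_inf"
  define u where "u = (\<lambda>n. s n div 2)"
  have u: "u (Suc n) = u n + s n mod 2" for n
    using s by (auto simp: Omega_inf_def allowed_transition_iff u_def)
  have "stair u" unfolding stair_def using u by (simp add: mod2_eq_if)
  moreover have "code u = s"
  proof
    fix n show "code u n = s n" unfolding code_def u by (simp add: u_def)
  qed
  ultimately show "s \<in> code ` Collect stair" by blast
next
  fix s assume "s \<in> code ` Collect stair"
  then obtain u where u: "stair u" "s = code u" by blast
  have "code u n mod 2 = u (Suc n) - u n" for n
    using u(1) by (auto simp: stair_def code_def dest!: spec[of _ n])
  then show "s \<in> Omega_inf"
    using u by (simp add: Omega_inf_def allowed_transition_iff code_div2)
qed

lemma p_hat_code: "p_hat k (code u) = symb k u"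
  by (simp add: p_hat_def code_def symb_def)

lemma shift_code: "shift (code u) = code (shift u)"
  by (auto simp: code_def shift_apply)

lemma T_hat_code: "T_hat (code u) = code (translate 1 u)"
  by (auto simp: T_hat_def code_def translate_apply)

lemma T_hat_pow_code: "(T_hat ^^ m) (code u) = code (translate (int m) u)"
proof (induction m)
  case (Suc m)
  have "(T_hat ^^ Suc m) (code u) = T_hat (code (translate (int m) u))"
    unfolding funpow.simps o_apply Suc.IH ..
  also have "\<dots> = code (translate 1 (translate (int m) u))"
    by (rule T_hat_code)
  also have "translate 1 (translate (int m) u) = translate (int (Suc m)) u"
    by (rule ext) (simp add: translate_apply)
  finally show ?case .
qed simp

text \<open>Monotonicity iterates, so the lexicographic order persists, weakly, under every power of
  the shift. It only controls leading symbols, but each coordinate becomes the leading one along the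
  orbit; halving passes from codes to levels.\<close>

lemma kfsm_imp_le:
  assumes "kfsm k Z'" "stair u" "stair v" "code u \<in> Z'" "code v \<in> Z'"
    and "less_fun (code u) (code v) \<or> code u = code v"
  shows "u \<le> v"
proof (rule le_funI)
  fix n
  have sh: "(shift ^^ n) s \<in> Z'" if "s \<in> Z'" for n s
    using that assms(1) by (induction n) (auto simp: kfsm_def invariant_set_def)
  have "less_fun ((shift ^^ n) (code u)) ((shift ^^ n) (code v)) \<or> (shift ^^ n) (code u) = (shift ^^ n) (code v)"
  proof (induction n)
    case (Suc n)
    have "\<forall>s\<in>Z'. \<forall>t\<in>Z'. less_fun s t \<longrightarrow> less_fun (shift s) (shift t) \<or> shift s = shift t"
      using assms(1) by (simp add: kfsm_def)
    with sh[OF assms(4), of n] sh[OF assms(5), of n] Suc.IH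
    have "less_fun (shift ((shift ^^ n) (code u))) (shift ((shift ^^ n) (code v)))
        \<or> shift ((shift ^^ n) (code u)) = shift ((shift ^^ n) (code v))"
      by (elim disjE) simp_all
    then show ?case by (simp only: funpow.simps o_apply)
  qed (use assms(6) in simp)
  then have "(shift ^^ n) (code u) 0 \<le> (shift ^^ n) (code v) 0"
    using less_fun_0 by fastforce
  then have "code u n div 2 \<le> code v n div 2"
    by (intro zdiv_mono1) (simp_all add: funpow_shift)
  then show "u n \<le> v n"
    using assms(2,3) by (simp add: code_div2)
qed

lemma Wof_trans: "u \<in> Wof k Z \<Longrightarrow> translate (int k * m) u \<in> Wof k Z"
  by (simp add: Wof_def)

lemma Wof_shift: "shift ` Z \<subseteq> Z \<Longrightarrow> u \<in> Wof k Z \<Longrightarrow> shift u \<in> Wof k Z"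
  by (auto simp: Wof_def symb_shift stair_shift)

lemma Wof_funpow_shift: "shift ` Z \<subseteq> Z \<Longrightarrow> u \<in> Wof k Z \<Longrightarrow> (shift ^^ n) u \<in> Wof k Z"
  by (induction n) (auto simp: Wof_shift)

lemma lift_in_Wof:
  assumes "k \<ge> 1" "Z \<subseteq> symb k ` Collect stair" "s \<in> Z"
  shows "lift s \<in> Wof k Z" "symb k (lift s) = s"
proof -
  obtain u where u: "stair u" "s = symb k u" using assms by blast
  show "symb k (lift s) = s" using u assms(1) by (simp add: symb_lift_sym)
  then show "lift s \<in> Wof k Z" using u assms(1,3) by (simp add: Wof_def stair_lift_sym)
qed

lemma lift_shift:
  assumes "k \<ge> 1" "Z \<subseteq> symb k ` Collect stair" "s \<in> Z" "shift s \<in> Z"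
  shows "\<exists>i. lift (shift s) = translate (int k * i) (shift (lift s))"
proof -
  note l = lift_in_Wof[OF assms(1-3)] lift_in_Wof[OF assms(1,2,4)]
  have "stair (shift (lift s))" "stair (lift (shift s))"
    using l(1,3) by (auto simp: Wof_def stair_shift)
  moreover have "symb k (shift (lift s)) = symb k (lift (shift s))"
    unfolding symb_shift l(2,4) ..
  ultimately show ?thesis using symb_eq_iff[OF assms(1)] by blast
qed

lemma Wof_shift_onto:
  assumes "k \<ge> 1" "Z \<subseteq> symb k ` Collect stair" "Z \<subseteq> shift ` Z" "u \<in> Wof k Z"
  shows "\<exists>v\<in>Wof k Z. shift v = u"
proof -
  have u: "stair u" "symb k u \<in> Z" using assms(4) by (auto simp: Wof_def)
  then obtain s where s: "s \<in> Z" "symb k u = shift s" using assms(3) by blast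
  note l = lift_in_Wof[OF assms(1,2) s(1)]
  have "symb k (shift (lift s)) = symb k u" using s l by (simp add: symb_shift)
  moreover have "stair (shift (lift s))" using l by (simp add: Wof_def stair_shift)
  ultimately obtain m where "u = translate (int k * m) (shift (lift s))"
    using symb_eq_iff assms(1) u(1) by blast
  then show ?thesis using Wof_trans[OF l(1), of m] shift_trans[of "int k * m" "lift s"] by blast
qed

lemma symb_image_Wof: "Z \<subseteq> symb k ` Collect stair \<Longrightarrow> symb k ` Wof k Z = Z"
  by (auto simp: Wof_def)

text \<open>The quantifier over \<open>Z'\<close> can be removed because \<open>Z'\<close> is
  forced: invariance under \<open>T_hat ^^ k\<close> makes it contain the code of every lift of
  \<open>Z\<close>. Conversely these codes form a kfsm set.\<close>

lemma symbolic_kfsm_iff: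
  assumes "k \<ge> 1"
  shows "symbolic_kfsm k Z \<longleftrightarrow> compact Z \<and> Z \<noteq> {} \<and> Z \<subseteq> symb k ` Collect stair \<and>
    shift ` Z = Z \<and> le_chain (Wof k Z)"
proof
  assume *: "symbolic_kfsm k Z"
  then obtain Z' where Z': "kfsm k Z'" "p_hat k ` Z' = Z" by (auto simp: symbolic_kfsm_def)
  have sub: "Z' \<subseteq> code ` Collect stair"
    using Z'(1) by (simp add: kfsm_def code_Omega_inf)
  then have Zsub: "Z \<subseteq> symb k ` Collect stair"
    unfolding Z'(2)[symmetric] by (force simp: p_hat_code)
  have T: "(T_hat ^^ k) ` Z' = Z'" using Z'(1) by (simp add: kfsm_def)
  have tr: "code (translate (int k * m) v) \<in> Z'" if v: "stair v" "code v \<in> Z'" for v m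
  proof (induction m rule: int_induct[where k = 0])
    case (step1 i)
    have "(T_hat ^^ k) (code (translate (int k * i) v)) \<in> Z'" using step1(2) T by blast
    moreover have "translate (int k) (translate (int k * i) v) = translate (int k * (i + 1)) v"
      by (rule ext) (simp add: translate_apply algebra_simps)
    ultimately show ?case by (simp only: T_hat_pow_code)
  next
    case (step2 i)
    \<comment> \<open>Descending by one period uses that \<open>T_hat ^^ k\<close> maps
      \<open>Z'\<close> onto itself, together with injectivity of \<open>code\<close>.\<close>
    obtain s where s: "s \<in> Z'" "(T_hat ^^ k) s = code (translate (int k * i) v)" using step2(2) T by (metis imageE)
    obtain w where w: "stair w" "s = code w" using s sub by auto
    have "code (translate (int k) w) = code (translate (int k * i) v)"
      using s(2) w by (simp add: T_hat_pow_code)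
    then have "translate (int k) w = translate (int k * i) v" using code_inj v(1) w(1) by simp
    then have "translate (- int k) (translate (int k) w) = translate (- int k) (translate (int k * i) v)" by simp
    moreover have "int k * i + - int k = int k * (i - 1)" by (simp add: algebra_simps)
    ultimately have "w = translate (int k * (i - 1)) v" by simp
    then show ?case using s(1) w(2) by blast
  qed (use v in simp)
  have W: "stair u \<and> code u \<in> Z'" if "u \<in> Wof k Z" for u
  proof -
    from that have u: "stair u" "symb k u \<in> Z" by (auto simp: Wof_def)
    then obtain v where v: "stair v" "code v \<in> Z'" "symb k u = symb k v"
      using Z'(2) sub by (force simp: p_hat_code)
    then obtain m where "u = translate (int k * m) v" using symb_eq_iff[OF assms v(1) u(1)] by auto
    then show ?thesis using tr v u by blast
  qed
  have "le_chain (Wof k Z)"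
    unfolding le_chain_def
  proof (intro ballI)
    fix u v assume "u \<in> Wof k Z" "v \<in> Wof k Z"
    then have "stair u" "stair v" "code u \<in> Z'" "code v \<in> Z'" using W by auto
    then show "u \<le> v \<or> v \<le> u"
      using kfsm_imp_le[OF Z'(1)] less_fun_total[of "code u" "code v"] by metis
  qed
  then show "compact Z \<and> Z \<noteq> {} \<and> Z \<subseteq> symb k ` Collect stair \<and> shift ` Z = Z \<and> le_chain (Wof k Z)"
    using * Zsub by (auto simp: symbolic_kfsm_def invariant_set_def)
next
  assume *: "compact Z \<and> Z \<noteq> {} \<and> Z \<subseteq> symb k ` Collect stair \<and> shift ` Z = Z \<and> le_chain (Wof k Z)"
  define W where "W = Wof k Z"
  have st: "stair u" if "u \<in> W" for u using that by (simp add: W_def Wof_def)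
  have shW: "shift ` W = W"
  proof
    show "shift ` W \<subseteq> W" using Wof_shift * by (auto simp: W_def)
    show "W \<subseteq> shift ` W"
    proof
      fix u assume "u \<in> W"
      then have "\<exists>v\<in>W. shift v = u"
        unfolding W_def using Wof_shift_onto[OF assms, of Z u] * by simp
      then show "u \<in> shift ` W" by blast
    qed
  qed
  have "kfsm k (code ` W)"
    unfolding kfsm_def
  proof (intro conjI ballI impI)
    show "code ` W \<subseteq> Omega_inf" using st by (auto simp: code_Omega_inf)
    show "invariant_set shift (code ` W)"
      unfolding invariant_set_def image_image shift_code by (metis shW image_image)
    have "translate (int k) ` W = W"
    proof
      show "translate (int k) ` W \<subseteq> W" using Wof_trans[of _ k Z 1] by (auto simp: W_def)
      show "W \<subseteq> translate (int k) ` W"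
      proof
        fix u assume "u \<in> W"
        then have "translate (int k * -1) u \<in> W" unfolding W_def by (rule Wof_trans)
        then show "u \<in> translate (int k) ` W" by (rule rev_image_eqI) simp
      qed
    qed
    then show "(T_hat ^^ k) ` code ` W = code ` W"
      unfolding image_image T_hat_pow_code by (metis image_image)
    fix s t assume st': "s \<in> code ` W" "t \<in> code ` W" "less_fun s t"
    then obtain u v where uv: "u \<in> W" "v \<in> W" "s = code u" "t = code v" by blast
    \<comment> \<open>Pointwise \<open>v \<le> u\<close> would give equality or the reverse
      lexicographic order, so the chain must decide for \<open>u \<le> v\<close>.\<close>
    have "u \<le> v"
    proof (rule ccontr)
      assume "\<not> u \<le> v"
      then have "v \<le> u" using * uv le_chainD unfolding W_def by blast
      then have "less_fun t s \<or> t = s" using le_less_fun[OF code_mono[of v u]] uv by blast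
      then show False using st'(3) less_fun_asym less_fun_irrefl by blast
    qed
    then have "code (shift u) \<le> code (shift v)" by (intro code_mono) (simp add: le_fun_def shift_apply)
    then show "less_fun (shift s) (shift t) \<or> shift s = shift t"
      using le_less_fun uv by (metis shift_code)
  qed
  moreover have "p_hat k ` code ` W = Z"
    using symb_image_Wof * by (simp add: W_def image_image p_hat_code)
  moreover have "Z \<subseteq> Omega k"
  proof
    fix s assume "s \<in> Z"
    then obtain u where u: "stair u" "s = symb k u" using * by blast
    then have "code u \<in> Omega_inf" by (auto simp: code_Omega_inf)
    then show "s \<in> Omega k"
      unfolding Omega_def Omega_inf_def u(2) p_hat_code[symmetric]
      using assms by (auto simp: p_hat_def)
  qed
  ultimately show "symbolic_kfsm k Z"
    using * unfolding symbolic_kfsm_def invariant_set_def by blast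
qed

section \<open>Rotation numbers\<close>

lemma sum_pi_hat_sym:
  assumes "stair u"
  shows "(\<Sum>i=0..n. real_of_int (pi_hat (symb k u) i)) = real_of_int (u (Suc n) - u 0)"
proof -
  have "(\<Sum>i=0..n. real_of_int (pi_hat (symb k u) i)) = real_of_int (\<Sum>i<Suc n. u (Suc i) - u i)"
    unfolding of_int_sum by (intro sum.cong) (auto simp: pi_hat_def stair_incr[OF assms])
  also have "(\<Sum>i<Suc n. u (Suc i) - u i) = u (Suc n) - u 0"
    by (rule sum_lessThan_telescope)
  finally show ?thesis .
qed

lemma tendsto_of_bounded_displacement:
  fixes f :: "nat \<Rightarrow> real"
  assumes "\<And>n. \<bar>f n - real n * w\<bar> \<le> C"
  shows "(\<lambda>n. f n / real n) \<longlonglongrightarrow> w"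
proof -
  have "(\<lambda>n. f n / real n - w) \<longlonglongrightarrow> 0"
  proof (rule tendsto_0_le[where K = 1])
    show "(\<lambda>n. C / real n) \<longlonglongrightarrow> 0" by (rule lim_const_over_n)
    show "eventually (\<lambda>n. norm (f n / real n - w) \<le> norm (C / real n) * 1) sequentially"
      using eventually_gt_at_top[of 0]
    proof eventually_elim
      case (elim n)
      have "f n / real n - w = (f n - real n * w) / real n" using elim by (simp add: field_simps)
      then show ?case using assms[of n] by (simp add: abs_divide divide_right_mono)
    qed
  qed
  then show ?thesis by (simp add: LIM_zero_iff)
qed

lemma rho_eq_sym:
  assumes "stair u" "\<And>n. \<bar>real_of_int (u n - u 0) - real n * w\<bar> \<le> C"
  shows "rho_eq (pi_hat (symb k u)) w"
  using LIMSEQ_Suc[OF tendsto_of_bounded_displacement[OF assms(2)]]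
  unfolding rho_eq_def sum_pi_hat_sym[OF assms(1)] by simp

lemma rho_eq_range:
  assumes "rho_eq (pi_hat s) w"
  shows "0 \<le> w" "w \<le> 1"
proof -
  have *: "0 \<le> (\<Sum>i=0..n. real_of_int (pi_hat s i))" "(\<Sum>i=0..n. real_of_int (pi_hat s i)) \<le> real (n + 1)" for n
  proof -
    have p: "0 \<le> pi_hat s i" "pi_hat s i \<le> 1" for i
      unfolding pi_hat_def using pos_mod_bound[of 2 "s i"] by (simp_all del: pos_mod_bound)
    show "0 \<le> (\<Sum>i=0..n. real_of_int (pi_hat s i))" by (rule sum_nonneg) (use p in simp)
    have "(\<Sum>i=0..n. real_of_int (pi_hat s i)) \<le> (\<Sum>i=0..n. 1)"
      by (rule sum_mono) (use p in simp)
    then show "(\<Sum>i=0..n. real_of_int (pi_hat s i)) \<le> real (n + 1)" by simp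
  qed
  show "0 \<le> w"
    by (rule LIMSEQ_le_const[OF assms[unfolded rho_eq_def]]) (use * in simp)
  have "(1 / real (n + 1)) * (\<Sum>i=0..n. real_of_int (pi_hat s i)) \<le> 1" for n
    using *(2)[of n] by (simp add: divide_le_eq)
  then show "w \<le> 1"
    by (intro LIMSEQ_le_const2[OF assms[unfolded rho_eq_def]]) blast
qed

text \<open>Comparing \<open>a (m * n)\<close> with both \<open>m * a n\<close> and
  \<open>n * a m\<close> shows that \<open>a n / n\<close> is Cauchy; letting \<open>m\<close> tend
  to infinity in the same comparison gives the error bound.\<close>

lemma almost_additive:
  fixes a :: "nat \<Rightarrow> real"
  assumes "\<And>m n. \<bar>a (m + n) - a m - a n\<bar> \<le> C"
  shows "\<exists>w. \<forall>n. \<bar>a n - real n * w\<bar> \<le> C"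
proof -
  have C: "C \<ge> 0" using assms[of 0 0] by linarith
  have mult: "\<bar>a (m * n) - real m * a n\<bar> \<le> real m * C" if "m > 0" for m n
    using that
  proof (induction m)
    case (Suc m)
    show ?case
    proof (cases "m = 0")
      case True then show ?thesis using C by simp
    next
      case False
      then have "\<bar>a (m * n) - real m * a n\<bar> \<le> real m * C" using Suc by simp
      moreover have "\<bar>a (n + m * n) - a n - a (m * n)\<bar> \<le> C" by (rule assms)
      ultimately show ?thesis by (simp add: algebra_simps)
    qed
  qed simp
  have quot: "\<bar>a n / real n - a m / real m\<bar> \<le> C / real n + C / real m" if "n > 0" "m > 0" for m n
  proof -
    have 1: "\<bar>a (m * n) / (real m * real n) - a n / real n\<bar> \<le> C / real n" if "m > 0" "n > 0" for m n
    proof -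
      have "a (m * n) / (real m * real n) - a n / real n = (a (m * n) - real m * a n) / (real m * real n)"
        using that by (simp add: field_simps)
      then have "\<bar>a (m * n) / (real m * real n) - a n / real n\<bar> \<le> (real m * C) / (real m * real n)"
        using divide_right_mono[OF mult[OF that(1), of n], of "real m * real n"] that by (simp add: abs_mult)
      then show ?thesis using that by simp
    qed
    show ?thesis using 1[of m n] 1[of n m] that by (simp add: mult.commute)
  qed
  have "Cauchy (\<lambda>n. a (Suc n) / real (Suc n))"
  proof (rule CauchyI)
    fix e :: real assume "e > 0"
    obtain M where M: "2 * C / e < real M" using reals_Archimedean2 by blast
    have small: "C / real (Suc n) < e / 2" if "n \<ge> M" for n
    proof -
      have "2 * C / e < real (Suc n)" using M that by linarith
      then show ?thesis using \<open>e > 0\<close> by (simp add: field_simps)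
    qed
    show "\<exists>M. \<forall>m\<ge>M. \<forall>n\<ge>M. norm (a (Suc m) / real (Suc m) - a (Suc n) / real (Suc n)) < e"
    proof (intro exI[of _ M] allI impI)
      fix m n assume "m \<ge> M" "n \<ge> M"
      then show "norm (a (Suc m) / real (Suc m) - a (Suc n) / real (Suc n)) < e"
        using quot[of "Suc m" "Suc n"] small[of m] small[of n] unfolding real_norm_def by linarith
    qed
  qed
  then obtain w where w: "(\<lambda>n. a (Suc n) / real (Suc n)) \<longlonglongrightarrow> w"
    using real_Cauchy_convergent convergent_def by blast
  have "\<bar>a n - real n * w\<bar> \<le> C" for n
  proof (cases "n = 0")
    case True
    then show ?thesis using assms[of 0 0] by simp
  next
    case False
    have lim: "(\<lambda>m. C / real n + C / real (Suc m)) \<longlonglongrightarrow> C / real n + 0"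
      by (intro tendsto_add tendsto_const) (use LIMSEQ_Suc[OF lim_const_over_n[of C]] in simp)
    have "\<bar>a n / real n - w\<bar> \<le> C / real n + 0"
    proof (rule LIMSEQ_le[OF _ lim])
      show "(\<lambda>m. \<bar>a n / real n - a (Suc m) / real (Suc m)\<bar>) \<longlonglongrightarrow> \<bar>a n / real n - w\<bar>"
        by (intro tendsto_intros w)
      show "\<exists>N. \<forall>m\<ge>N. \<bar>a n / real n - a (Suc m) / real (Suc m)\<bar> \<le> C / real n + C / real (Suc m)"
        using quot[of n] False by (metis bot_nat_0.not_eq_extremum zero_less_Suc)
    qed
    then have "\<bar>a n / real n - w\<bar> * real n \<le> C / real n * real n"
      using False by (intro mult_right_mono) simp_all
    moreover have "\<bar>a n / real n - w\<bar> * real n = \<bar>(a n / real n - w) * real n\<bar>"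
      by (simp add: abs_mult)
    moreover have "(a n / real n - w) * real n = a n - real n * w"
      using False by (simp add: left_diff_distrib)
    ultimately show ?thesis using False by simp
  qed
  then show ?thesis by blast
qed

text \<open>\<open>u 0 - v 0\<close> lies between consecutive multiples of \<open>k\<close>, so
  \<open>u\<close> starts strictly between two translates of \<open>v\<close>. In a chain, order at
  one coordinate is order at all of them.\<close>

lemma chain_displacement:
  assumes "k \<ge> 1" "le_chain (Wof k Z)" "u \<in> Wof k Z" "v \<in> Wof k Z"
  shows "\<bar>(u n - u 0) - (v n - v 0)\<bar> \<le> 2 * int k"
proof -
  define m where "m = (u 0 - v 0) div int k"
  obtain r where m: "u 0 - v 0 = int k * m + r" and r: "0 \<le> r" "r < int k"
    using assms(1) that[of "(u 0 - v 0) mod int k"] by (simp add: m_def)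
  have "u \<le> translate (int k * (m + 1)) v"
    by (rule le_chain_less_at[OF assms(2,3) Wof_trans[OF assms(4)], where i = 0])
       (use m r in \<open>simp add: translate_apply algebra_simps\<close>)
  \<comment> \<open>One period below \<open>m\<close>: if \<open>r = 0\<close>, the translate by
    \<open>k * m\<close> starts level with \<open>u\<close>, and the chain decides only from a
    strict inequality.\<close>
  moreover have "translate (int k * (m - 1)) v \<le> u"
    by (rule le_chain_less_at[OF assms(2) Wof_trans[OF assms(4)] assms(3), where i = 0])
       (use m r assms(1) in \<open>simp add: translate_apply algebra_simps\<close>)
  ultimately have "u n \<le> v n + int k * (m + 1)" "v n + int k * (m - 1) \<le> u n"
    by (metis le_funD translate_apply)+
  then show ?thesis using m r by (simp add: algebra_simps)
qed

text \<open>Shifts of a reference staircase \<open>v\<close> stay in the chain, so its displacement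
  is almost additive with error \<open>2 * k\<close>. Every other staircase differs from
  \<open>v\<close> by at most another \<open>2 * k\<close>, whence \<open>4 * k\<close>.\<close>

lemma rotation_number_exists:
  assumes "k \<ge> 1" "Z \<noteq> {}" "Z \<subseteq> symb k ` Collect stair" "shift ` Z \<subseteq> Z" "le_chain (Wof k Z)"
  shows "\<exists>w. rho_set_eq Z w \<and> (\<forall>u\<in>Wof k Z. \<forall>n. \<bar>real_of_int (u n - u 0) - real n * w\<bar> \<le> 4 * real k)"
proof -
  obtain s where "s \<in> Z" using assms(2) by blast
  define v where "v = lift s"
  have v: "v \<in> Wof k Z" using lift_in_Wof(1)[OF assms(1,3) \<open>s \<in> Z\<close>] by (simp add: v_def)
  have "\<exists>w. \<forall>n. \<bar>real_of_int (v n - v 0) - real n * w\<bar> \<le> 2 * real k"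
  proof (rule almost_additive)
    fix m n
    have "\<bar>((shift ^^ m) v n - (shift ^^ m) v 0) - (v n - v 0)\<bar> \<le> 2 * int k"
      using chain_displacement assms(1,5) Wof_funpow_shift[OF assms(4) v] v by blast
    then have "\<bar>(v (m + n) - v 0) - (v m - v 0) - (v n - v 0)\<bar> \<le> 2 * int k"
      by (simp add: funpow_shift)
    then have "\<bar>real_of_int ((v (m + n) - v 0) - (v m - v 0) - (v n - v 0))\<bar> \<le> real_of_int (2 * int k)"
      by (simp only: of_int_abs[symmetric] of_int_le_iff)
    then show "\<bar>real_of_int (v (m + n) - v 0) - real_of_int (v m - v 0) - real_of_int (v n - v 0)\<bar> \<le> 2 * real k"
      by simp
  qed
  then obtain w where w: "\<And>n. \<bar>real_of_int (v n - v 0) - real n * w\<bar> \<le> 2 * real k" by blast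
  have bd: "\<bar>real_of_int (u n - u 0) - real n * w\<bar> \<le> 4 * real k" if "u \<in> Wof k Z" for u n
  proof -
    have "\<bar>(u n - u 0) - (v n - v 0)\<bar> \<le> 2 * int k"
      using chain_displacement assms(1,5) that v by blast
    then have "\<bar>real_of_int ((u n - u 0) - (v n - v 0))\<bar> \<le> real_of_int (2 * int k)"
      by (simp only: of_int_abs[symmetric] of_int_le_iff)
    then show ?thesis using w[of n] by simp
  qed
  moreover have "rho_set_eq Z w"
    unfolding rho_set_eq_def
  proof (intro conjI ballI assms(2))
    fix t assume "t \<in> pi_hat ` Z"
    then obtain s where "s \<in> Z" "t = pi_hat s" by blast
    then show "rho_eq t w"
      using lift_in_Wof[OF assms(1,3), of s] rho_eq_sym[of "lift s" w "4 * real k" k] bd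
      by (auto simp: Wof_def)
  qed
  ultimately show ?thesis by blast
qed

lemma rho_set_eq_unique: "rho_set_eq Z v \<Longrightarrow> rho_set_eq Z w \<Longrightarrow> v = w"
  unfolding rho_set_eq_def rho_eq_def using LIMSEQ_unique by blast

lemma rho_set_eq_bounded:
  assumes "k \<ge> 1" "Z \<noteq> {}" "Z \<subseteq> symb k ` Collect stair" "shift ` Z \<subseteq> Z" "le_chain (Wof k Z)"
    and "rho_set_eq Z w" "u \<in> Wof k Z"
  shows "\<bar>real_of_int (u n - u 0) - real n * w\<bar> \<le> 4 * real k"
  using rotation_number_exists[OF assms(1-5)] rho_set_eq_unique[OF assms(6)] assms(7) by blast

lemma rho_set_eq_range:
  assumes "rho_set_eq Z w"
  shows "0 \<le> w" "w \<le> 1"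
  using assms rho_eq_range unfolding rho_set_eq_def by blast+

text \<open>A return up to translation repeats itself, so a mismatch between \<open>n * w\<close>
  and \<open>m\<close> would accumulate linearly against the bound \<open>C\<close>.\<close>

lemma return_displacement:
  assumes "\<And>n. \<bar>real_of_int (u n - u 0) - real n * w\<bar> \<le> C"
    and "(shift ^^ n) u = translate m u"
  shows "real n * w = of_int m"
proof (rule ccontr)
  assume ne: "real n * w \<noteq> of_int m"
  have "(u :: symseq) (i * n) = u 0 + int i * m" for i
  proof (induction i)
    case (Suc i)
    have "u (n + i * n) = u (i * n) + m"
      using fun_cong[OF assms(2), of "i * n"] by (simp add: seq_apply)
    then show ?case using Suc by (simp add: algebra_simps)
  qed simp
  then have "\<bar>real i * (real_of_int m - real n * w)\<bar> \<le> C" for i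
    using assms(1)[of "i * n"] by (simp add: algebra_simps)
  then have *: "real i * \<bar>real_of_int m - real n * w\<bar> \<le> C" for i
    by (simp add: abs_mult)
  obtain i where "C < real i * \<bar>real_of_int m - real n * w\<bar>"
    using ne reals_Archimedean3[of "\<bar>real_of_int m - real n * w\<bar>"] by auto
  then show False using *[of i] by simp
qed

section \<open>Cut systems and their itineraries\<close>

text \<open>The points differing from \<open>x\<close> before \<open>N\<close> form an open set.
  These sets grow with \<open>N\<close> and exhaust the complement of \<open>x\<close>, so a finite
  subcover separates \<open>S\<close> from a cylinder around \<open>x\<close>.\<close>

lemma symseq_compact_imp_closed:
  fixes S :: "symseq set"
  assumes "compact S"
  shows "closed S"
proof -
  have "x \<in> S" if x: "x \<in> closure S" for x
  proof (rule ccontr)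
    assume "x \<notin> S"
    have op: "open {y. \<not> agree N x y}" if "N \<in> UNIV" for N
    proof -
      have "{y. \<not> agree N x y} = (\<Union>y\<in>{y. \<not> agree N x y}. {z. agree N y z})"
      proof (intro subset_antisym subsetI)
        fix z assume "z \<in> {y. \<not> agree N x y}"
        then show "z \<in> (\<Union>y\<in>{y. \<not> agree N x y}. {z. agree N y z})"
          by (intro UN_I[of z]) simp_all
      next
        fix z assume "z \<in> (\<Union>y\<in>{y. \<not> agree N x y}. {z. agree N y z})"
        then obtain y where "\<not> agree N x y" "agree N y z" by blast
        then show "z \<in> {y. \<not> agree N x y}" by (metis agree_sym agree_trans mem_Collect_eq)
      qed
      moreover have "open (\<Union>y\<in>{y. \<not> agree N x y}. {z. agree N y z})"
        by (intro open_UN ballI open_cylinder)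
      ultimately show ?thesis by simp
    qed
    have cov: "S \<subseteq> (\<Union>N\<in>UNIV. {y. \<not> agree N x y})"
    proof
      fix y assume "y \<in> S"
      then have "x \<noteq> y" using \<open>x \<notin> S\<close> by blast
      then have "\<exists>N. \<not> agree N x y" using agree_imp_eq[of x y] by blast
      then show "y \<in> (\<Union>N\<in>UNIV. {y. \<not> agree N x y})" by blast
    qed
    obtain F where "F \<subseteq> (UNIV :: nat set)" and F: "finite F" "S \<subseteq> (\<Union>N\<in>F. {y. \<not> agree N x y})"
      by (rule compactE_image[OF assms op cov])
    define M where "M = Max F"
    have M: "N \<le> M" if "N \<in> F" for N
      unfolding M_def by (rule Max_ge[OF F(1) that])
    obtain y where "y \<in> S" "agree M x y" using x by (auto simp: closure_agree)
    moreover obtain N where "N \<in> F" "\<not> agree N x y" using F(2) \<open>y \<in> S\<close> by blast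
    ultimately show False using agree_le[of M x y N] M[of N] by simp
  qed
  then show ?thesis by (intro closure_subset_eq[THEN iffD1] subsetI)
qed

definition cut_index :: "(int \<Rightarrow> real) \<Rightarrow> real \<Rightarrow> int" where
  "cut_index c x = (THE j. c j \<le> x \<and> x < c (j + 1))"

definition itin :: "(int \<Rightarrow> real) \<Rightarrow> real \<Rightarrow> real \<Rightarrow> symseq" where
  "itin c w x = (\<lambda>n. cut_index c (x + real n * w))"

text \<open>The lift to the real line of the partition points \<open>ell (2 * j)\<close>; the points \<open>ell (2 * j + 1)\<close>
  are \<open>c (j + 1) - w\<close>.\<close>

locale cut_system =
  fixes k :: nat and w :: real and c :: "int \<Rightarrow> real"
  assumes k_pos: "k \<ge> 1"
    and w_nonneg: "0 \<le> w"
    and c_period: "c (j + int k) = c j + real k"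
    and c_gap: "c j + w \<le> c (j + 1)"
begin

lemma c_mono: "i \<le> j \<Longrightarrow> c i \<le> c j"
proof -
  have *: "c i \<le> c (i + int n)" for n
  proof (induction n)
    case (Suc n)
    have "c (i + int n) \<le> c (i + int n + 1)" using c_gap[of "i + int n"] w_nonneg by linarith
    then show ?case using Suc by (simp add: algebra_simps)
  qed simp
  assume "i \<le> j"
  then show ?thesis using *[of "nat (j - i)"] by simp
qed

lemma c_period_mult: "c (j + int k * m) = c j + real k * of_int m"
proof (induction m rule: int_induct[where k = 0])
  case (step1 i)
  then show ?case using c_period[of "j + int k * i"] by (simp add: algebra_simps)
next
  case (step2 i)
  then show ?case using c_period[of "j + int k * (i - 1)"] by (simp add: algebra_simps)
qed simp

lemma c_bound: "\<bar>c j - of_int j - c 0\<bar> \<le> real k"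
proof -
  define d r where "d = j div int k" and "r = j mod int k"
  have r: "0 \<le> r" "r < int k" using k_pos by (simp_all add: r_def)
  have j: "j = r + int k * d" by (simp add: d_def r_def)
  have "c 0 \<le> c r" "c r \<le> c (0 + int k)" using r by (auto intro: c_mono)
  then have "c 0 \<le> c r" "c r \<le> c 0 + real k" using c_period[of 0] by simp_all
  moreover have "0 \<le> real_of_int r" "real_of_int r \<le> real k" using r by linarith+
  moreover have "c j - of_int j = c r - of_int r"
    unfolding j c_period_mult by simp
  ultimately show ?thesis by simp
qed

lemma cut_index_ex: "\<exists>j. c j \<le> x \<and> x < c (j + 1)"
proof -
  define m where "m = \<lfloor>(x - c 0) / real k\<rfloor>"
  have "of_int m \<le> (x - c 0) / real k" "(x - c 0) / real k < of_int m + 1"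
    unfolding m_def by linarith+
  then have m: "c 0 + real k * of_int m \<le> x" "x < c 0 + real k * of_int (m + 1)"
    using k_pos by (simp_all add: field_simps)
  \<comment> \<open>One period of indices suffices, since \<open>x\<close> lies between the cuts at
    \<open>k * m\<close> and \<open>k * (m + 1)\<close>.\<close>
  define S where "S = {j \<in> {int k * m .. int k * (m + 1)}. c j \<le> x}"
  have "int k * m \<in> S" using m(1) c_period_mult[of 0 m] k_pos by (simp add: S_def)
  moreover have "finite S" unfolding S_def by (rule finite_subset[OF _ finite_atLeastAtMost_int]) blast
  ultimately have M: "Max S \<in> S" "\<And>j. j \<in> S \<Longrightarrow> j \<le> Max S" using Max_in by auto
  have "x < c (Max S + 1)"
  proof (rule ccontr)
    assume "\<not> x < c (Max S + 1)"
    moreover have "Max S + 1 \<le> int k * (m + 1)"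
    proof (rule ccontr)
      assume "\<not> Max S + 1 \<le> int k * (m + 1)"
      then have "Max S = int k * (m + 1)" using M(1) by (simp add: S_def)
      then have "c (0 + int k * (m + 1)) \<le> x" using M(1) by (simp add: S_def)
      then show False using m(2) unfolding c_period_mult by simp
    qed
    ultimately have "Max S + 1 \<in> S" using M(1) by (auto simp: S_def)
    then show False using M(2)[of "Max S + 1"] by simp
  qed
  then show ?thesis using M(1) unfolding S_def by blast
qed

lemma cut_index: "c (cut_index c x) \<le> x" "x < c (cut_index c x + 1)"
proof -
  obtain j where j: "c j \<le> x \<and> x < c (j + 1)" using cut_index_ex by blast
  have "cut_index c x = j" unfolding cut_index_def
  proof (rule the_equality[where P = "\<lambda>j. c j \<le> x \<and> x < c (j + 1)"])
    fix i assume i: "c i \<le> x \<and> x < c (i + 1)"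
    have "i < j + 1" using i j c_mono[of "j + 1" i] by linarith
    moreover have "j < i + 1" using i j c_mono[of "i + 1" j] by linarith
    ultimately show "i = j" by simp
  qed (use j in simp)
  then show "c (cut_index c x) \<le> x" "x < c (cut_index c x + 1)" using j by simp_all
qed

lemma le_cut_index_iff: "j \<le> cut_index c x \<longleftrightarrow> c j \<le> x"
proof
  show "c j \<le> x" if "j \<le> cut_index c x" using c_mono[OF that] cut_index(1)[of x] by linarith
  show "j \<le> cut_index c x" if "c j \<le> x"
    using that c_mono[of "cut_index c x + 1" j] cut_index(2)[of x] by linarith
qed

lemma cut_index_less_iff: "cut_index c x < j \<longleftrightarrow> x < c j"
  using le_cut_index_iff[of j x] by linarith

lemma cut_index_eqI: "c j \<le> x \<Longrightarrow> x < c (j + 1) \<Longrightarrow> cut_index c x = j"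
  using le_cut_index_iff[of j x] cut_index_less_iff[of x "j + 1"] by linarith

lemma cut_index_mono: "x \<le> y \<Longrightarrow> cut_index c x \<le> cut_index c y"
  using cut_index(1)[of x] by (simp add: le_cut_index_iff)

lemma cut_index_period: "cut_index c (x + real k * of_int m) = cut_index c x + int k * m"
proof (rule cut_index_eqI)
  show "c (cut_index c x + int k * m) \<le> x + real k * of_int m"
    using cut_index(1)[of x] by (simp add: c_period_mult)
  have "c (cut_index c x + int k * m + 1) = c (cut_index c x + 1) + real k * of_int m"
    using c_period_mult[of "cut_index c x + 1" m] by (simp add: algebra_simps)
  then show "x + real k * of_int m < c (cut_index c x + int k * m + 1)"
    using cut_index(2)[of x] by simp
qed

text \<open>Consecutive cuts are at least \<open>w\<close> apart, so a step of length
  \<open>w\<close> crosses at most one of them. This is what makes itineraries staircases.\<close>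

lemma cut_index_step: "cut_index c (x + w) = cut_index c x \<or> cut_index c (x + w) = cut_index c x + 1"
proof -
  have "cut_index c x \<le> cut_index c (x + w)" using w_nonneg by (intro cut_index_mono) simp
  moreover have "cut_index c (x + w) < cut_index c x + 1 + 1"
    unfolding cut_index_less_iff using cut_index(2)[of x] c_gap[of "cut_index c x + 1"] by linarith
  ultimately show ?thesis by linarith
qed

lemma cut_index_bound: "\<bar>of_int (cut_index c x) - (x - c 0)\<bar> \<le> real k + 1"
  using c_bound[of "cut_index c x"] c_bound[of "cut_index c x + 1"] cut_index[of x] by simp

lemma shift_itin: "shift (itin c w x) = itin c w (x + w)"
  by (rule ext) (simp add: shift_apply itin_def algebra_simps)

lemma funpow_shift_itin: "(shift ^^ n) (itin c w x) = itin c w (x + real n * w)"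
  by (rule ext) (simp add: funpow_shift itin_def algebra_simps)

lemma stair_itin: "stair (itin c w x)"
proof -
  have "x + real (Suc n) * w = (x + real n * w) + w" for n by (simp add: algebra_simps)
  then show ?thesis unfolding stair_def itin_def using cut_index_step by presburger
qed

lemma itin_period: "itin c w (x + real k * of_int m) = translate (int k * m) (itin c w x)"
proof
  fix n
  have "x + real k * of_int m + real n * w = (x + real n * w) + real k * of_int m" by simp
  then show "itin c w (x + real k * of_int m) n = translate (int k * m) (itin c w x) n"
    by (simp only: itin_def translate_apply cut_index_period)
qed

lemma itin_mono: "x \<le> y \<Longrightarrow> itin c w x \<le> itin c w y"
  by (simp add: le_fun_def itin_def cut_index_mono)

text \<open>The cells \<open>[c j, c (j + 1))\<close> are closed on the left, so every window is
  right-continuous in \<open>x\<close>, even where the orbit hits a cut.\<close>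

lemma itin_right_const: "\<exists>e>0. \<forall>y. x \<le> y \<longrightarrow> y < x + e \<longrightarrow> agree N (itin c w x) (itin c w y)"
proof (induction N)
  case 0
  show ?case by (intro exI[of _ 1]) (simp add: agree_def)
next
  case (Suc N)
  then obtain e where e: "e > 0" "\<And>y. x \<le> y \<Longrightarrow> y < x + e \<Longrightarrow> agree N (itin c w x) (itin c w y)" by blast
  define z where "z = x + real N * w"
  define d where "d = c (cut_index c z + 1) - z"
  have d: "d > 0" using cut_index(2)[of z] by (simp add: d_def)
  have "agree (Suc N) (itin c w x) (itin c w y)" if "x \<le> y" "y < x + min e d" for y
  proof -
    have "cut_index c (y + real N * w) = cut_index c z"
    proof (rule cut_index_eqI)
      show "c (cut_index c z) \<le> y + real N * w" using cut_index(1)[of z] that by (simp add: z_def)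
      show "y + real N * w < c (cut_index c z + 1)" using that by (simp add: d_def z_def)
    qed
    then have "itin c w x N = itin c w y N" by (simp add: itin_def z_def)
    moreover have "agree N (itin c w x) (itin c w y)" using e(2) that by simp
    ultimately show ?thesis by (auto simp: agree_def less_Suc_eq)
  qed
  then show ?case using e d by (intro exI[of _ "min e d"]) simp
qed

lemma itin_displacement: "\<bar>real_of_int (itin c w x n - itin c w x 0) - real n * w\<bar> \<le> 2 * real k + 2"
  using cut_index_bound[of "x + real n * w"] cut_index_bound[of x] by (simp add: itin_def)

definition B :: "symseq set" where
  "B = closure (range (\<lambda>x. symb k (itin c w x)))"

lemma itin_in_B: "symb k (itin c w x) \<in> B"
  unfolding B_def by (rule subsetD[OF closure_subset]) blast

lemma symb_itin_period: "symb k (itin c w (x + real k * of_int m)) = symb k (itin c w x)"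
  unfolding itin_period by (rule symb_trans)

lemma B_compact: "compact B"
proof -
  have "range (\<lambda>x. symb k (itin c w x)) \<subseteq> {s. \<forall>n. s n \<in> {0..<2 * int k}}"
    using symb_range[OF k_pos] by blast
  moreover have "closed {s :: symseq. \<forall>n. s n \<in> {0..<2 * int k}}"
    by (rule symseq_compact_imp_closed[OF compact_symbols])
  ultimately have "B \<subseteq> {s. \<forall>n. s n \<in> {0..<2 * int k}}"
    unfolding B_def by (rule closure_minimal)
  then show ?thesis
    using compact_Int_closed[OF compact_symbols[of 0 "2 * int k"], of B]
    by (metis B_def closed_closure inf.absorb2)
qed

text \<open>A point of the closure need not be an itinerary. However, \<open>lift\<close> maps
  windows to windows, and both the staircase condition and the coding are visible on finite
  windows.\<close>

lemma B_subset_stair: "B \<subseteq> symb k ` Collect stair"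
proof
  fix s assume "s \<in> B"
  then have s: "\<exists>x. agree N s (symb k (itin c w x))" for N
    by (auto simp: B_def closure_agree)
  define u where "u = lift s"
  have u: "\<exists>v. stair v \<and> agree (Suc N) u v \<and> agree N s (symb k v)" for N
  proof -
    obtain x where x: "agree (Suc N) s (symb k (itin c w x))" using s by blast
    define v where "v = lift (symb k (itin c w x))"
    have "stair v" "symb k v = symb k (itin c w x)"
      unfolding v_def using stair_lift_sym symb_lift_sym k_pos stair_itin by auto
    moreover have "agree (Suc N) u v" unfolding u_def v_def by (rule lift_agree[OF x])
    ultimately show ?thesis using agree_le[OF x, of N] by auto
  qed
  have "stair u" unfolding stair_def
  proof
    fix n obtain v where "stair v" "agree (Suc (Suc n)) u v" using u by blast
    then show "u (Suc n) = u n \<or> u (Suc n) = u n + 1" by (simp add: agree_def stair_def)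
  qed
  moreover have "symb k u = s"
  proof (rule agree_imp_eq)
    fix N obtain v where v: "agree (Suc N) u v" "agree N s (symb k v)" using u by blast
    show "agree N (symb k u) s" using symb_agree[OF v(1), of k] v(2) agree_sym agree_trans by blast
  qed
  ultimately show "s \<in> symb k ` Collect stair" by blast
qed

lemma Wof_B_approx:
  assumes "u \<in> Wof k B"
  shows "\<exists>x. agree N u (itin c w x)"
proof -
  have "stair u" "symb k u \<in> B" using assms by (auto simp: Wof_def)
  then obtain x where "agree (Suc N) (symb k (itin c w x)) (symb k u)"
    by (auto simp: B_def closure_agree intro: agree_sym)
  then obtain m where "agree (Suc N) (translate (int k * m) (itin c w x)) u"
    using symb_agreeD[OF k_pos stair_itin \<open>stair u\<close>] by blast
  then show ?thesis unfolding itin_period[symmetric] using agree_le agree_sym le_SucI order_refl by blast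
qed

text \<open>Incomparability is witnessed by two coordinates, hence would already occur for two
  itineraries, and these are ordered like their parameters.\<close>

lemma B_chain: "le_chain (Wof k B)"
  unfolding le_chain_def
proof (intro ballI)
  fix u v assume uv: "u \<in> Wof k B" "v \<in> Wof k B"
  show "u \<le> v \<or> v \<le> u"
  proof (rule ccontr)
    assume "\<not> (u \<le> v \<or> v \<le> u)"
    then obtain i j where ij: "v i < u i" "u j < v j" by (auto simp: le_fun_def not_le)
    define N where "N = Suc (max i j)"
    obtain x y where xy: "agree N u (itin c w x)" "agree N v (itin c w y)"
      using Wof_B_approx uv by blast
    have "itin c w x \<le> itin c w y \<or> itin c w y \<le> itin c w x"
      using itin_mono linear by blast
    then have "itin c w x i \<le> itin c w y i \<and> itin c w x j \<le> itin c w y j \<or>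
        itin c w y i \<le> itin c w x i \<and> itin c w y j \<le> itin c w x j"
      by (auto simp: le_fun_def)
    moreover have "i < N" "j < N" by (auto simp: N_def)
    ultimately show False using ij xy by (auto simp: agree_def)
  qed
qed

lemma B_shift: "shift ` B = B"
proof -
  have *: "shift ` range (\<lambda>x. symb k (itin c w x)) = range (\<lambda>x. symb k (itin c w x))"
  proof -
    have "shift ` range (\<lambda>x. symb k (itin c w x)) = range (\<lambda>x. symb k (itin c w (x + w)))"
      by (simp add: image_image symb_shift[symmetric] shift_itin)
    also have "\<dots> = range (\<lambda>x. symb k (itin c w x))"
    proof (intro subset_antisym image_subsetI)
      fix x show "symb k (itin c w x) \<in> range (\<lambda>x. symb k (itin c w (x + w)))"
        by (rule range_eqI[of _ _ "x - w"]) simp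
    qed blast
    finally show ?thesis .
  qed
  show ?thesis
  proof
    show "shift ` B \<subseteq> B"
      unfolding B_def
      by (rule image_closure_subset[OF continuous_shift closed_closure]) (use * closure_subset in blast)
    \<comment> \<open>Surjectivity on the closure comes from compactness: the image is closed and
      contains every coded itinerary.\<close>
    have "closed (shift ` B)"
      by (intro symseq_compact_imp_closed compact_continuous_image continuous_shift B_compact)
    moreover have "range (\<lambda>x. symb k (itin c w x)) \<subseteq> shift ` B"
      using * closure_subset unfolding B_def by blast
    ultimately show "B \<subseteq> shift ` B" unfolding B_def by (rule closure_minimal[rotated])
  qed
qed

lemma B_kfsm: "symbolic_kfsm k B"
  unfolding symbolic_kfsm_iff[OF k_pos]
  using B_compact B_subset_stair B_shift B_chain itin_in_B by blast

lemma B_displacement: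
  assumes "u \<in> Wof k B"
  shows "\<bar>real_of_int (u n - u 0) - real n * w\<bar> \<le> 2 * real k + 2"
proof -
  obtain x where "agree (Suc n) u (itin c w x)" using Wof_B_approx assms by blast
  then have "u n = itin c w x n" "u 0 = itin c w x 0" by (simp_all add: agree_def)
  then show ?thesis using itin_displacement[of x n] by simp
qed

lemma B_rho: "rho_set_eq B w"
  unfolding rho_set_eq_def
proof (intro conjI ballI)
  show "B \<noteq> {}" using itin_in_B by blast
  fix t assume "t \<in> pi_hat ` B"
  then obtain s where s: "s \<in> B" "t = pi_hat s" by blast
  define u where "u = lift s"
  have u: "t = pi_hat (symb k u)" "u \<in> Wof k B"
    using lift_in_Wof[OF k_pos B_subset_stair s(1)] s(2) by (simp_all add: u_def)
  show "rho_eq t w" unfolding u(1)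
    by (rule rho_eq_sym[OF _ B_displacement[OF u(2)]]) (use u(2) in \<open>simp add: Wof_def\<close>)
qed

end

section \<open>The Hedlund--Morse construction\<close>

definition hm_cut :: "nat \<Rightarrow> real \<Rightarrow> (nat \<Rightarrow> real) \<Rightarrow> int \<Rightarrow> real" where
  "hm_cut k w \<nu> j = ell w \<nu> (2 * nat (j mod int k)) + real k * of_int (j div int k)"

lemma ell_0: "ell w \<nu> 0 = 0"
  by (simp add: ell_def)

lemma ell_even: "ell w \<nu> (2 * r) = (\<Sum>i=1..r. \<nu> i) + real r * w"
  by (simp add: ell_def)

lemma ell_odd: "ell w \<nu> (2 * r + 1) = ell w \<nu> (2 * Suc r) - w"
  by (simp add: ell_def algebra_simps)

lemma hm_cut_0 [simp]: "hm_cut k w \<nu> 0 = 0"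
  by (simp add: hm_cut_def ell_0)

lemma hm_cut_nat:
  assumes "k \<ge> 1" "allowable k w \<nu>" "r \<le> k"
  shows "hm_cut k w \<nu> (int r) = ell w \<nu> (2 * r)"
proof (cases "r = k")
  case True
  then show ?thesis using ell_last[OF assms(2)] assms(1) by (simp add: hm_cut_def ell_0)
next
  case False
  then show ?thesis using assms(3) by (simp add: hm_cut_def)
qed

lemma hm_cut_period: "k \<ge> 1 \<Longrightarrow> hm_cut k w \<nu> (j + int k * m) = hm_cut k w \<nu> j + real k * of_int m"
  by (simp add: hm_cut_def algebra_simps)

lemma cut_system_hm_cut:
  assumes "k \<ge> 1" "allowable k w \<nu>"
  shows "cut_system k w (hm_cut k w \<nu>)"
proof
  show "k \<ge> 1" "0 \<le> w" using assms by (auto simp: allowable_def)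
  fix j
  show "hm_cut k w \<nu> (j + int k) = hm_cut k w \<nu> j + real k"
    using hm_cut_period[OF assms(1), of w \<nu> j 1] by simp
  define r where "r = nat (j mod int k)"
  have r: "r < k" "int r = j mod int k" using assms(1) by (auto simp: r_def nat_less_iff)
  have j: "j = int r + int k * (j div int k)" "j + 1 = int (Suc r) + int k * (j div int k)"
    using r by simp_all
  have 1: "hm_cut k w \<nu> j = ell w \<nu> (2 * r) + real k * of_int (j div int k)"
    using hm_cut_period[OF assms(1), of w \<nu> "int r" "j div int k"]
      hm_cut_nat[OF assms, of r] r(1) unfolding j(1)[symmetric] by simp
  have 2: "hm_cut k w \<nu> (j + 1) = ell w \<nu> (2 * Suc r) + real k * of_int (j div int k)"
    using hm_cut_period[OF assms(1), of w \<nu> "int (Suc r)" "j div int k"] 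
      hm_cut_nat[OF assms, of "Suc r"] r(1) unfolding j(2)[symmetric] by simp
  have "0 \<le> \<nu> (Suc r)" using assms(2) r(1) by (simp add: allowable_def)
  then show "hm_cut k w \<nu> j + w \<le> hm_cut k w \<nu> (j + 1)"
    unfolding 1 2 ell_even by (simp add: algebra_simps)
qed

text \<open>Converts abstract cuts back into a vector: \<open>\<nu> i\<close> is the part of the gap
  between consecutive cuts that exceeds \<open>w\<close>.\<close>

lemma (in cut_system) hm_cut_surj:
  assumes "c 0 = 0"
  shows "\<exists>\<nu>. allowable k w \<nu> \<and> hm_cut k w \<nu> = c"
proof -
  define \<nu> where "\<nu> i = c (int i) - c (int i - 1) - w" for i :: nat
  have s: "(\<Sum>i=1..r. \<nu> i) = c (int r) - real r * w" for r
  proof (induction r)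
    case (Suc r)
    then show ?case by (simp add: \<nu>_def algebra_simps)
  qed (simp add: assms)
  have ck: "c (int k) = real k" using c_period[of 0] assms by simp
  have "0 \<le> \<nu> i" for i
    using c_gap[of "int i - 1"] by (simp add: \<nu>_def)
  \<comment> \<open>The \<open>k\<close> nonnegative excesses over one period add up to
    \<open>k - k * w\<close>.\<close>
  moreover have "w \<le> 1"
  proof -
    have "0 \<le> (\<Sum>i=1..k. \<nu> i)" by (rule sum_nonneg) (use calculation in simp)
    then have "real k * w \<le> real k * 1" unfolding s ck by simp
    then show ?thesis using k_pos by simp
  qed
  ultimately have "allowable k w \<nu>"
    using w_nonneg s[of k] ck by (simp add: allowable_def algebra_simps)
  moreover have "hm_cut k w \<nu> j = c j" for j
  proof -
    have "hm_cut k w \<nu> j = c (j mod int k) + real k * of_int (j div int k)"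
      using k_pos s[of "nat (j mod int k)"] by (simp add: hm_cut_def ell_even)
    also have "\<dots> = c (j mod int k + int k * (j div int k))" by (rule c_period_mult[symmetric])
    finally show ?thesis by simp
  qed
  ultimately show ?thesis by blast
qed

lemma HM_rot_funpow:
  assumes "x \<in> {0..<real k}"
  shows "(HM_rot k w ^^ n) x = (x + real n * w) rmod real k"
proof (induction n)
  case 0
  then show ?case using assms by simp
next
  case (Suc n)
  have "(HM_rot k w ^^ Suc n) x = ((x + real n * w) rmod real k + w) rmod real k"
    by (simp add: Suc HM_rot_def)
  also have "\<dots> = ((x + real n * w) + w) rmod real k"
    by (metis rmod_add rmod_rmod)
  finally show ?case by (simp add: algebra_simps)
qed

lemma rmod_decomp:
  assumes "K > 0"
  shows "\<exists>m::int. x = x rmod K + K * of_int m"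
  using assms by (intro exI[of _ "\<lfloor>x / K\<rfloor>"]) (simp add: rmod_conv_frac frac_def field_simps)

locale hm_system =
  fixes k :: nat and w :: real and \<nu> :: "nat \<Rightarrow> real"
  assumes k_ge_1: "k \<ge> 1" and allow: "allowable k w \<nu>"
begin

sublocale cut_system k w "hm_cut k w \<nu>"
  by (rule cut_system_hm_cut[OF k_ge_1 allow])

abbreviation "cc \<equiv> hm_cut k w \<nu>"

text \<open>Inside the cell between two cuts, the odd end point is the next cut minus
  \<open>w\<close>. The parity of the index of \<open>X\<close> thus records whether the next step
  crosses a cut, which is exactly what the sum of two successive levels encodes.\<close>

lemma zeta_symbol:
  assumes y: "y \<in> {0..<real k}" "\<And>i. i \<le> 2 * k \<Longrightarrow> y \<noteq> ell w \<nu> i rmod real k"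
  shows "int (THE i. i < 2 * k \<and> y \<in> interior (HM_X w \<nu> i)) = cut_index cc y + cut_index cc (y + w)"
    and "cut_index cc y + cut_index cc (y + w) \<in> {0..<2 * int k}"
proof -
  have ne: "y \<noteq> ell w \<nu> i" if "i \<le> 2 * k" for i
  proof
    assume "y = ell w \<nu> i"
    then have "ell w \<nu> i rmod real k = y" using y(1) by simp
    then show False using y(2)[OF that] by simp
  qed
  define j where "j = cut_index cc y"
  have j: "0 \<le> j" "j < int k"
  proof -
    show "0 \<le> j" unfolding j_def le_cut_index_iff using y(1) by simp
    have "cc (int k) = real k" using c_period[of 0] by simp
    then show "j < int k" unfolding j_def cut_index_less_iff using y(1) by simp
  qed
  define r where "r = nat j"
  have r: "j = int r" "r < k" using j by (auto simp: r_def)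
  have cr: "cc j = ell w \<nu> (2 * r)" "cc (j + 1) = ell w \<nu> (2 * Suc r)"
    using hm_cut_nat[OF k_ge_1 allow, of r] hm_cut_nat[OF k_ge_1 allow, of "Suc r"] r
    by (simp_all add: add.commute)
  have lo: "ell w \<nu> (2 * r) < y"
    using cut_index(1)[of y] ne[of "2 * r"] r(2) cr(1) unfolding j_def[symmetric] by simp
  have hi: "y < ell w \<nu> (2 * Suc r)"
    using cut_index(2)[of y] cr(2) unfolding j_def[symmetric] by simp
  have mid: "y \<noteq> ell w \<nu> (2 * r + 1)" using ne[of "2 * r + 1"] r(2) by simp
  define i0 where "i0 = (if y < ell w \<nu> (2 * r + 1) then 2 * r else 2 * r + 1)"
  have i0: "i0 < 2 * k" "ell w \<nu> i0 < y" "y < ell w \<nu> (Suc i0)"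
    using lo hi mid r(2) by (auto simp: i0_def)
  have in_X: "y \<in> interior (HM_X w \<nu> i) \<longleftrightarrow> ell w \<nu> i < y \<and> y < ell w \<nu> (Suc i)" for i
    by (simp add: HM_X_def interior_atLeastAtMost_real)
  have "(THE i. i < 2 * k \<and> y \<in> interior (HM_X w \<nu> i)) = i0"
  proof (rule the_equality)
    show "i0 < 2 * k \<and> y \<in> interior (HM_X w \<nu> i0)" using i0 by (simp add: in_X)
    fix i assume i: "i < 2 * k \<and> y \<in> interior (HM_X w \<nu> i)"
    then have iy: "ell w \<nu> i < y" "y < ell w \<nu> (Suc i)" by (simp_all add: in_X)
    define r' where "r' = i div 2"
    have r': "r' < k" "i = 2 * r' \<or> i = 2 * r' + 1" using i by (auto simp: r'_def)
    have c': "cc (int r') = ell w \<nu> (2 * r')" "cc (int r' + 1) = ell w \<nu> (2 * Suc r')"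
      using hm_cut_nat[OF k_ge_1 allow, of r'] hm_cut_nat[OF k_ge_1 allow, of "Suc r'"] r'
      by (simp_all add: add.commute)
    have o: "ell w \<nu> (2 * r') \<le> ell w \<nu> (2 * r' + 1)" "ell w \<nu> (2 * r' + 1) \<le> ell w \<nu> (2 * Suc r')"
      using c_gap[of "int r'"] w_nonneg unfolding c' ell_odd by simp_all
    have "cc (int r') \<le> y" "y < cc (int r' + 1)"
      unfolding c' using iy o r'(2) by auto
    then have "j = int r'" unfolding j_def by (rule cut_index_eqI)
    then have "r' = r" using r(1) by simp
    then show "i = i0" using r'(2) iy by (auto simp: i0_def)
  qed
  moreover have "cut_index cc y + cut_index cc (y + w) = int i0"
  proof (cases "y < ell w \<nu> (2 * r + 1)")
    case True
    then have "y + w < cc (j + 1)" unfolding cr(2) ell_odd by simp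
    then have "cut_index cc (y + w) < j + 1" by (simp only: cut_index_less_iff)
    then have "cut_index cc (y + w) = j" using cut_index_step[of y] by (auto simp: j_def)
    then show ?thesis using True r(1) by (simp add: i0_def j_def[symmetric])
  next
    case False
    then have "cc (j + 1) \<le> y + w" unfolding cr(2) ell_odd by simp
    then have "j + 1 \<le> cut_index cc (y + w)" by (simp only: le_cut_index_iff)
    then have "cut_index cc (y + w) = j + 1" using cut_index_step[of y] by (auto simp: j_def)
    then show ?thesis using False r(1) by (simp add: i0_def j_def[symmetric])
  qed
  ultimately show "int (THE i. i < 2 * k \<and> y \<in> interior (HM_X w \<nu> i)) = cut_index cc y + cut_index cc (y + w)"
    and "cut_index cc y + cut_index cc (y + w) \<in> {0..<2 * int k}"
    using i0(1) by simp_all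
qed

lemma HM_zeta_eq:
  assumes x: "x \<in> HM_good k w \<nu>"
  shows "HM_zeta k w \<nu> x = symb k (itin cc w x)"
proof
  fix n
  have x0: "x \<in> {0..<real k}" using x by (simp add: HM_good_def)
  define y where "y = (HM_rot k w ^^ n) x"
  have y: "y = (x + real n * w) rmod real k" unfolding y_def by (rule HM_rot_funpow[OF x0])
  have yr: "y \<in> {0..<real k}" using k_ge_1 by (simp add: y rmod_less rmod_nonneg)
  have yne: "y \<noteq> ell w \<nu> i rmod real k" if "i \<le> 2 * k" for i
    using x that by (auto simp: HM_good_def y_def)
  obtain m where m: "x + real n * w = y + real k * of_int m"
    using rmod_decomp[of "real k" "x + real n * w"] k_ge_1 y by auto
  have "itin cc w x n = cut_index cc y + int k * m"
    unfolding itin_def m by (rule cut_index_period)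
  moreover have "itin cc w x (Suc n) = cut_index cc (y + w) + int k * m"
  proof -
    have "x + real (Suc n) * w = y + w + real k * of_int m" using m by (simp add: algebra_simps)
    then show ?thesis unfolding itin_def by (simp only: cut_index_period)
  qed
  ultimately have "itin cc w x n + itin cc w x (Suc n) = (cut_index cc y + cut_index cc (y + w)) + (2 * int k) * m"
    by simp
  then have "symb k (itin cc w x) n = (cut_index cc y + cut_index cc (y + w)) mod (2 * int k)"
    by (simp add: symb_def)
  also have "\<dots> = cut_index cc y + cut_index cc (y + w)"
    using zeta_symbol(2)[OF yr yne] by simp
  also have "\<dots> = HM_zeta k w \<nu> x n"
    using zeta_symbol(1)[OF yr yne] by (simp add: HM_zeta_def y_def)
  finally show "HM_zeta k w \<nu> x n = symb k (itin cc w x) n" by simp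
qed

text \<open>A countable set containing every point of the line whose forward orbit meets a lifted
  end point.\<close>

definition bad :: "real set" where
  "bad = (\<lambda>(n, i, m). ell w \<nu> i - real n * w + real k * of_int m) ` (UNIV :: (nat \<times> nat \<times> int) set)"

lemma countable_bad: "countable bad"
  unfolding bad_def by (rule countable_image) simp

lemma rmod_good:
  assumes "y \<notin> bad"
  shows "y rmod real k \<in> HM_good k w \<nu>"
proof -
  have y: "y rmod real k \<in> {0..<real k}" using k_ge_1 by (simp add: rmod_less rmod_nonneg)
  have "(HM_rot k w ^^ n) (y rmod real k) \<noteq> ell w \<nu> i rmod real k" for n i
  proof
    assume "(HM_rot k w ^^ n) (y rmod real k) = ell w \<nu> i rmod real k"
    then have "(y rmod real k + real n * w) rmod real k = ell w \<nu> i rmod real k"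
      by (simp only: HM_rot_funpow[OF y])
    then have "(y + real n * w) rmod real k = ell w \<nu> i rmod real k"
      by (metis rmod_add rmod_rmod)
    moreover obtain a where "y + real n * w = (y + real n * w) rmod real k + real k * of_int a"
      using rmod_decomp[of "real k"] k_ge_1 by auto
    moreover obtain b where "ell w \<nu> i = ell w \<nu> i rmod real k + real k * of_int b"
      using rmod_decomp[of "real k" "ell w \<nu> i"] k_ge_1 by auto
    ultimately have "y = ell w \<nu> i - real n * w + real k * of_int (a - b)"
      by (simp add: algebra_simps)
    then have "y \<in> bad" unfolding bad_def by (intro rev_image_eqI[of "(n, i, a - b)"]) simp_all
    then show False using assms by simp
  qed
  then show ?thesis using y by (simp add: HM_good_def)
qed

text \<open>Itineraries of bad points are recovered by right-continuity: a short interval to the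
  right of \<open>x\<close> has the same window and, being uncountable, contains a point outside
  \<open>bad\<close>.\<close>

lemma HM_B_eq: "HM_B k w \<nu> = B"
proof
  have "HM_zeta k w \<nu> ` HM_good k w \<nu> \<subseteq> range (\<lambda>x. symb k (itin cc w x))"
    using HM_zeta_eq by blast
  then show "HM_B k w \<nu> \<subseteq> B" unfolding HM_B_def B_def by (rule closure_mono)
  have "range (\<lambda>x. symb k (itin cc w x)) \<subseteq> HM_B k w \<nu>"
  proof
    fix s assume "s \<in> range (\<lambda>x. symb k (itin cc w x))"
    then obtain x where s: "s = symb k (itin cc w x)" by blast
    show "s \<in> HM_B k w \<nu>" unfolding HM_B_def closure_agree
    proof
      fix N
      obtain e where e: "e > 0" "\<forall>y. x \<le> y \<longrightarrow> y < x + e \<longrightarrow> agree (Suc N) (itin cc w x) (itin cc w y)"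
        using itin_right_const by blast
      have "uncountable {x<..<x + e}" using e(1) by (simp add: uncountable_open_interval)
      then have "\<not> {x<..<x + e} \<subseteq> bad" using countable_bad countable_subset by blast
      then obtain y where y: "x < y" "y < x + e" "y \<notin> bad"
        by (meson greaterThanLessThan_iff subsetI)
      obtain m where m: "y = y rmod real k + real k * of_int m"
        using rmod_decomp[of "real k" y] k_ge_1 by auto
      have "symb k (itin cc w y) = symb k (itin cc w (y rmod real k))"
        using symb_itin_period[of "y rmod real k" m] m by simp
      also have "\<dots> = HM_zeta k w \<nu> (y rmod real k)"
        using HM_zeta_eq[OF rmod_good[OF y(3)]] by simp
      finally have eq: "symb k (itin cc w y) = HM_zeta k w \<nu> (y rmod real k)" .
      have "agree N s (symb k (itin cc w y))"
        unfolding s by (rule symb_agree) (use e(2) y in simp)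
      then show "\<exists>z\<in>HM_zeta k w \<nu> ` HM_good k w \<nu>. agree N s z"
        unfolding eq using rmod_good[OF y(3)] by blast
    qed
  qed
  then show "B \<subseteq> HM_B k w \<nu>"
    unfolding B_def by (rule closure_minimal) (simp add: HM_B_def)
qed

end

section \<open>Uniqueness of the invariant measure of an irrational rotation\<close>

lemma dense_rotation_orbit:
  fixes w K :: real
  assumes "K > 0" "w / K \<notin> \<rat>" "a < b"
  shows "\<exists>n\<ge>N. \<exists>m::int. a < real n * w - K * of_int m \<and> real n * w - K * of_int m < b"
proof -
  \<comment> \<open>The centre of the target interval in units of \<open>K\<close>, moved back by
    \<open>N\<close> steps so that the time found exceeds \<open>N\<close>.\<close>
  define \<alpha> where "\<alpha> = (a + b) / (2 * K) - real N * (w / K)"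
  have "(b - a) / (2 * K) > 0" using assms by simp
  then obtain h j where j: "j > 0" "\<bar>of_int j * (w / K) - of_int h - \<alpha>\<bar> < (b - a) / (2 * K)"
    using sequence_of_fractional_parts_is_dense[OF assms(2)] by metis
  define n where "n = N + nat j"
  have n: "real n = real N + of_int j" using j(1) by (simp add: n_def)
  have "K * \<bar>of_int j * (w / K) - of_int h - \<alpha>\<bar> < K * ((b - a) / (2 * K))"
    using j(2) assms(1) by (intro mult_strict_left_mono)
  moreover have "K * \<bar>of_int j * (w / K) - of_int h - \<alpha>\<bar> = \<bar>K * (of_int j * (w / K) - of_int h - \<alpha>)\<bar>"
    using assms(1) by (simp add: abs_mult)
  moreover have "K * (of_int j * (w / K) - of_int h - \<alpha>) = real n * w - K * of_int h - (a + b) / 2"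
    using assms(1) by (simp add: \<alpha>_def n field_simps)
  moreover have "K * ((b - a) / (2 * K)) = (b - a) / 2" using assms(1) by simp
  ultimately have "\<bar>real n * w - K * of_int h - (a + b) / 2\<bar> < (b - a) / 2" by simp
  then have "a < real n * w - K * of_int h \<and> real n * w - K * of_int h < b"
    by (auto simp: abs_less_iff field_simps)
  moreover have "n \<ge> N" by (simp add: n_def)
  ultimately show ?thesis by blast
qed

lemma quasi_periodic_int:
  fixes f :: "real \<Rightarrow> real"
  assumes per: "\<And>x. f (x + K) = f x + P"
  shows "f (x + K * of_int m) = f x + P * of_int m"
proof (induction m rule: int_induct[where k = 0])
  case (step1 i) then show ?case using per[of "x + K * of_int i"] by (simp add: algebra_simps)
next
  case (step2 i) then show ?case using per[of "x + K * of_int (i - 1)"] by (simp add: algebra_simps)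
qed simp

text \<open>Rigidity behind both unique ergodicity and the computation of heights. The difference
  \<open>f x - P / K * x\<close> is constant along the dense orbit under translation by
  \<open>w\<close> and \<open>K\<close>; monotonicity carries this to all points, approached from
  above.\<close>

lemma equivariant_monotone_affine:
  fixes f :: "real \<Rightarrow> real"
  assumes "K > 0" "w / K \<notin> \<rat>" "mono f"
    and per: "\<And>x. f (x + K) = f x + P" and rot: "\<And>x. f (x + w) = f x + r"
  shows "f x = P / K * x + f 0"
proof -
  have P: "P \<ge> 0" using monoD[OF assms(3), of 0 K] per[of 0] assms(1) by simp
  note perm = quasi_periodic_int[of f, OF per]
  have rotn: "f (x + real n * w) = f x + real n * r" for x n
  proof (induction n)
    case (Suc n) then show ?case using rot[of "x + real n * w"] by (simp add: algebra_simps)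
  qed simp
  have bound: "\<bar>f x - f 0 - P * x / K\<bar> \<le> P" for x
  proof -
    define m where "m = \<lfloor>x / K\<rfloor>"
    have "of_int m \<le> x / K" "x / K \<le> of_int m + 1" unfolding m_def by linarith+
    then have m: "0 + K * of_int m \<le> x" "x \<le> 0 + K * of_int (m + 1)" using assms(1) by (simp_all add: field_simps)
    have "f 0 + P * of_int m \<le> f x" "f x \<le> f 0 + P * of_int (m + 1)"
      using monoD[OF assms(3) m(1)] monoD[OF assms(3) m(2)] unfolding perm by simp_all
    moreover have "P * of_int m \<le> P * (x / K)" "P * (x / K) \<le> P * (of_int m + 1)"
      by (rule mult_left_mono, fact, fact P)+
    ultimately show ?thesis by (simp add: algebra_simps)
  qed
  \<comment> \<open>The bounded deviation of \<open>f\<close> from slope \<open>P / K\<close> allows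
    no other drift along multiples of \<open>w\<close>.\<close>
  have r: "r = P * w / K"
  proof (rule ccontr)
    assume "r \<noteq> P * w / K"
    then obtain n where "P < real n * \<bar>r - P * w / K\<bar>"
      using reals_Archimedean3[of "\<bar>r - P * w / K\<bar>"] by auto
    moreover have "real n * \<bar>r - P * w / K\<bar> = \<bar>f (real n * w) - f 0 - P * (real n * w) / K\<bar>"
    proof -
      have "f (real n * w) - f 0 - P * (real n * w) / K = real n * (r - P * w / K)"
        using rotn[of 0 n] by (simp add: algebra_simps)
      then show ?thesis by (simp add: abs_mult)
    qed
    ultimately show False using bound[of "real n * w"] by simp
  qed
  have le: "f y - P / K * y \<le> f x - P / K * x" for x y
  proof (rule field_le_epsilon)
    fix e :: real assume "e > 0"
    \<comment> \<open>Chosen so that \<open>P / K * e' \<le> e\<close>; the \<open>+ 1\<close>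
      covers \<open>P = 0\<close>.\<close>
    define e' where "e' = e * K / (P + 1)"
    have e': "e' > 0" "P / K * e' \<le> e"
      using \<open>e > 0\<close> P assms(1) by (simp_all add: e'_def field_simps)
    obtain n m where nm: "y - x < real n * w - K * of_int m" "real n * w - K * of_int m < y - x + e'"
      using dense_rotation_orbit[OF assms(1,2), of "y - x" "y - x + e'" 0] e'(1) by auto
    have "f y \<le> f (x + real n * w + K * of_int (- m))"
      using nm(1) by (intro monoD[OF assms(3)]) simp
    also have "\<dots> = f x + real n * r + P * of_int (- m)" by (simp only: perm rotn)
    also have "\<dots> = f x + P / K * (real n * w - K * of_int m)"
      using assms(1) by (simp add: r field_simps)
    also have "\<dots> \<le> f x + P / K * (y - x + e')"
      using nm(2) P assms(1) by (intro add_left_mono mult_left_mono) simp_all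
    finally show "f y - P / K * y \<le> f x - P / K * x + e"
      using e'(2) by (simp add: distrib_left right_diff_distrib)
  qed
  show ?thesis using le[of x 0] le[of 0 x] by simp
qed

lemma lborel_translate:
  assumes "A \<in> sets borel"
  shows "emeasure lborel {x. x + t \<in> A} = emeasure lborel (A :: real set)"
proof -
  have "emeasure lborel A = emeasure (distr lborel borel ((+) t)) A"
    by (simp add: lborel_distr_plus)
  also have "\<dots> = emeasure lborel {x. x + t \<in> A}"
    using assms by (subst emeasure_distr) (auto simp: vimage_def add.commute)
  finally show ?thesis by simp
qed

lemma emeasure_periodic:
  fixes A :: "real set"
  assumes A: "A \<in> sets borel" and per: "\<And>x. x + K \<in> A \<longleftrightarrow> x \<in> A" and K: "K > 0"
  shows "emeasure lborel (A \<inter> {a..<a + K}) = emeasure lborel (A \<inter> {0..<K})"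
proof -
  have perm: "x + K * of_int m \<in> A \<longleftrightarrow> x \<in> A" for x and m :: int
  proof (induction m rule: int_induct[where k = 0])
    case (step1 i) then show ?case using per[of "x + K * of_int i"] by (simp add: algebra_simps)
  next
    case (step2 i) then show ?case using per[of "x + K * of_int (i - 1)"] by (simp add: algebra_simps)
  qed simp
  define m r where "m = \<lfloor>a / K\<rfloor>" and "r = a - K * of_int m"
  have "of_int m \<le> a / K" "a / K < of_int m + 1" unfolding m_def by linarith+
  then have r: "0 \<le> r" "r < K" using K by (simp_all add: r_def field_simps)
  have tr: "emeasure lborel (A \<inter> {p + K * of_int m..<q + K * of_int m}) = emeasure lborel (A \<inter> {p..<q})"
    for p q :: real and m :: int
  proof -
    have "A \<inter> {p + K * of_int m..<q + K * of_int m} \<in> sets borel" using A by auto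
    from lborel_translate[OF this, of "K * of_int m", symmetric] show ?thesis
      by (simp add: perm Int_def)
  qed
  have "emeasure lborel (A \<inter> {a..<a + K}) = emeasure lborel (A \<inter> {r..<r + K})"
    using tr[of r m "r + K"] by (simp add: r_def algebra_simps)
  also have "\<dots> = emeasure lborel (A \<inter> {r..<K} \<union> A \<inter> {K..<r + K})"
    using r by (intro arg_cong[of _ _ "emeasure lborel"]) auto
  also have "\<dots> = emeasure lborel (A \<inter> {r..<K}) + emeasure lborel (A \<inter> {K..<r + K})"
    using A by (intro plus_emeasure[symmetric]) auto
  also have "emeasure lborel (A \<inter> {K..<r + K}) = emeasure lborel (A \<inter> {0..<r})"
    using tr[of 0 1 r] by simp
  also have "emeasure lborel (A \<inter> {r..<K}) + emeasure lborel (A \<inter> {0..<r})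
      = emeasure lborel (A \<inter> {r..<K} \<union> A \<inter> {0..<r})"
    using A by (intro plus_emeasure) auto
  also have "\<dots> = emeasure lborel (A \<inter> {0..<K})"
    using r by (intro arg_cong[of _ _ "emeasure lborel"]) auto
  finally show ?thesis .
qed

lemma floor_count:
  fixes x y K :: real
  assumes "x \<in> {0..<K}" "y \<in> {0..<K}"
  shows "\<lfloor>(x - y) / K\<rfloor> = (if y \<le> x then 0 else - 1)"
  using assms by (auto simp: floor_eq_iff field_simps)

text \<open>The distribution function, extended to the line, is monotone and equivariant, so
  rigidity makes it affine. No Fourier analysis is involved.\<close>

lemma rotation_uniquely_ergodic:
  fixes M :: "real measure"
  assumes K: "K > 0" and irr: "w / K \<notin> \<rat>"
    and M: "prob_space M" "sets M = sets borel" "measure M {0..<K} = 1"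
    and inv: "distr M borel (\<lambda>x. (x + w) rmod K) = M"
  shows "M = uniform_measure lborel {0..<K}"
proof -
  interpret prob_space M by (rule M(1))
  note [measurable_cong] = M(2)
  have AE: "AE y in M. y \<in> {0..<K}" using M(3) by (subst AE_in_set_eq_1) (auto simp: M(2))
  have rm: "(x + w) rmod K = x + w - K * of_int \<lfloor>(x + w) / K\<rfloor>" for x
    using K by (simp add: rmod_conv_frac frac_def field_simps)
  \<comment> \<open>An averaged signed count of lifts: on \<open>{0..<K}\<close> it is the
    distribution function minus 1, and the floor extends it to the line with
    \<open>G (x + K) = G x + 1\<close>.\<close>
  define G :: "real \<Rightarrow> real" where "G x = (\<integral>y. of_int \<lfloor>(x - y) / K\<rfloor> \<partial>M)" for x
  have int: "integrable M (\<lambda>y. of_int \<lfloor>(x - y) / K\<rfloor> :: real)" for x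
  proof (rule integrable_const_bound[where B = "\<bar>x\<bar> / K + 2"])
    show "AE y in M. norm (of_int \<lfloor>(x - y) / K\<rfloor> :: real) \<le> \<bar>x\<bar> / K + 2"
      using AE
    proof eventually_elim
      case (elim y)
      have "\<bar>(x - y) / K\<bar> \<le> \<bar>x\<bar> / K + 1"
        using elim K by (auto simp: abs_divide field_simps)
      then show ?case unfolding real_norm_def by linarith
    qed
  qed simp
  have int2: "integrable M (\<lambda>y. of_int \<lfloor>(y + w) / K\<rfloor> :: real)"
  proof (rule integrable_const_bound[where B = "\<bar>w\<bar> / K + 2"])
    show "AE y in M. norm (of_int \<lfloor>(y + w) / K\<rfloor> :: real) \<le> \<bar>w\<bar> / K + 2"
      using AE
    proof eventually_elim
      case (elim y)
      have "\<bar>(y + w) / K\<bar> \<le> \<bar>w\<bar> / K + 1"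
        using elim K by (auto simp: abs_divide field_simps)
      then show ?case unfolding real_norm_def by linarith
    qed
  qed simp
  have "mono G"
  proof (rule monoI)
    fix x y :: real assume "x \<le> y"
    then show "G x \<le> G y" unfolding G_def
      using K by (intro integral_mono int) (simp add: floor_mono divide_right_mono)
  qed
  moreover have "G (x + K) = G x + 1" for x
  proof -
    have "(x + K - y) / K = (x - y) / K + 1" for y using K by (simp add: field_simps)
    then have "G (x + K) = (\<integral>y. of_int \<lfloor>(x - y) / K\<rfloor> + 1 \<partial>M)" by (simp add: G_def)
    also have "\<dots> = G x + 1" unfolding G_def using int by (simp add: prob_space)
    finally show ?thesis .
  qed
  \<comment> \<open>Invariance replaces \<open>y\<close> by its rotated point. The number of turns
    removed by \<open>rmod\<close> leaves the floor as a summand independent of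
    \<open>x\<close>.\<close>
  moreover have "G (x + w) = G x + (\<integral>y. of_int \<lfloor>(y + w) / K\<rfloor> \<partial>M)" for x
  proof -
    have "G (x + w) = (\<integral>y. of_int \<lfloor>(x + w - y) / K\<rfloor> \<partial>distr M borel (\<lambda>x. (x + w) rmod K))"
      unfolding G_def inv ..
    also have "\<dots> = (\<integral>y. of_int \<lfloor>(x + w - (y + w) rmod K) / K\<rfloor> \<partial>M)"
      by (rule integral_distr) (simp_all add: rm)
    also have "\<dots> = (\<integral>y. of_int \<lfloor>(x - y) / K\<rfloor> + of_int \<lfloor>(y + w) / K\<rfloor> \<partial>M)"
    proof (rule Bochner_Integration.integral_cong)
      fix y
      have "(x + w - (y + w) rmod K) / K = (x - y) / K + of_int \<lfloor>(y + w) / K\<rfloor>"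
        using K unfolding rm by (simp add: field_simps)
      then show "(of_int \<lfloor>(x + w - (y + w) rmod K) / K\<rfloor> :: real) = of_int \<lfloor>(x - y) / K\<rfloor> + of_int \<lfloor>(y + w) / K\<rfloor>"
        by simp
    qed simp
    also have "\<dots> = G x + (\<integral>y. of_int \<lfloor>(y + w) / K\<rfloor> \<partial>M)"
      unfolding G_def using int int2 by simp
    finally show ?thesis .
  qed
  ultimately have G: "G x = 1 / K * x + G 0" for x
    using equivariant_monotone_affine[OF K irr, of G 1] by blast
  have cdf_G: "cdf M x = G x + 1" if "x \<in> {0..<K}" for x
  proof -
    have "G x = (\<integral>y. indicator {..x} y - 1 \<partial>M)"
      unfolding G_def
    proof (rule integral_cong_AE)
      show "AE y in M. real_of_int \<lfloor>(x - y) / K\<rfloor> = indicator {..x} y - 1"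
        using AE by eventually_elim (use floor_count[OF that] in \<open>auto simp: indicator_def\<close>)
    qed simp_all
    also have "\<dots> = measure M {..x} - 1"
      by (subst Bochner_Integration.integral_diff) (auto simp: prob_space M(2) less_top[symmetric])
    finally show ?thesis by (simp add: cdf_def)
  qed
  \<comment> \<open>The mass of a possible atom at 0. On \<open>{0..<K}\<close> the distribution
    function is \<open>x / K + c0\<close>, and letting \<open>x\<close> approach \<open>K\<close>
    forces \<open>c0 = 0\<close>.\<close>
  define c0 where "c0 = G 0 + 1"
  have "c0 = cdf M 0" using cdf_G[of 0] K by (simp add: c0_def)
  then have "c0 \<ge> 0" by (simp add: cdf_def)
  moreover have "c0 \<le> 0 + e" if "e > 0" for e
  proof -
    define x where "x = max 0 (K * (1 - e))"
    have x: "x \<in> {0..<K}" using K that by (simp add: x_def)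
    have "cdf M x \<le> 1" by (simp add: cdf_def)
    then have "x / K + c0 \<le> 1" using cdf_G[OF x] G[of x] by (simp add: c0_def)
    moreover have "1 - e \<le> x / K" using K by (simp add: x_def field_simps le_max_iff_disj)
    ultimately show ?thesis by simp
  qed
  ultimately have "c0 = 0" using field_le_epsilon[of c0 0] by fastforce
  have cdf_M: "cdf M x = (if x < 0 then 0 else if x < K then x / K else 1)" for x
  proof -
    consider "x < 0" | "x \<in> {0..<K}" | "x \<ge> K" by force
    then show ?thesis
    proof cases
      case 1
      have "cdf M x = prob {}" unfolding cdf_def
      proof (rule finite_measure_eq_AE)
        show "AE y in M. (y \<in> {..x}) = (y \<in> {})" using AE by eventually_elim (use 1 in auto)
      qed (simp_all add: M(2))
      then show ?thesis using 1 by simp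
    next
      case 2
      then show ?thesis using cdf_G[OF 2] G[of x] \<open>c0 = 0\<close> by (simp add: c0_def)
    next
      case 3
      have "cdf M x = prob {0..<K}" unfolding cdf_def
      proof (rule finite_measure_eq_AE)
        show "AE y in M. (y \<in> {..x}) = (y \<in> {0..<K})" using AE by eventually_elim (use 3 in auto)
      qed (simp_all add: M(2))
      then show ?thesis using 3 K M(3) by simp
    qed
  qed
  define U where "U = uniform_measure lborel {0..<K}"
  have em: "emeasure lborel {0..<K} = ennreal K" using K by simp
  have "prob_space U" unfolding U_def by (rule prob_space_uniform_measure) (use K em in auto)
  then have U: "real_distribution U" by (simp add: real_distribution_def real_distribution_axioms_def U_def)
  have cdf_U: "cdf U x = (if x < 0 then 0 else if x < K then x / K else 1)" for x
  proof -
    have "cdf U x = measure lborel ({0..<K} \<inter> {..x}) / K"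
      unfolding cdf_def U_def using K em by (subst measure_uniform_measure) (auto simp: measure_def)
    also have "{0..<K} \<inter> {..x} = (if x < 0 then {} else if x < K then {0..x} else {0..<K})"
      by auto
    finally show ?thesis using K by (auto simp: measure_def)
  qed
  have "real_distribution M" using M by (simp add: real_distribution_def real_distribution_axioms_def)
  then show ?thesis using cdf_unique[OF _ U] cdf_M cdf_U unfolding U_def by (metis ext)
qed

section \<open>The pushed forward Lebesgue measure\<close>

lemma borel_measurable_sym_itin [measurable]:
  assumes "cut_system k w c"
  shows "(\<lambda>x. symb k (itin c w x)) \<in> borel_measurable borel"
proof (rule measurable_coordinatewise_then_product)
  interpret cut_system k w c by (rule assms)
  fix n
  have [measurable]: "(\<lambda>x. real_of_int (cut_index c x)) \<in> borel_measurable borel"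
    by (rule borel_measurable_mono) (simp add: mono_def cut_index_mono)
  \<comment> \<open>Measurability is known for the real-valued monotone indices; the floor of their
    integral sum returns to the discrete integers, where reduction modulo \<open>2 * k\<close> is
    trivially measurable.\<close>
  have "(\<lambda>x. \<lfloor>real_of_int (cut_index c (x + real n * w)) + real_of_int (cut_index c (x + real (Suc n) * w))\<rfloor>)
      \<in> measurable borel (count_space UNIV)"
    by measurable
  from measurable_compose[OF this, of "\<lambda>i. i mod (2 * int k)" borel]
  show "(\<lambda>x. symb k (itin c w x) n) \<in> borel_measurable borel"
    by (simp add: symb_def itin_def floor_add del: of_int_add flip: of_int_add)
qed

lemma singleton_symseq_borel: "{s :: symseq} \<in> sets borel"
  by (intro borel_closed symseq_compact_imp_closed) simp

context cut_system
begin

text \<open>Real-line form of \<open>HM_lambda\<close>. Because coded itineraries are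
  \<open>k\<close>-periodic in \<open>x\<close>, any interval of length \<open>k\<close> gives the
  same measure.\<close>

definition L :: "symseq measure" where
  "L = distr (uniform_measure lborel {0..<real k}) borel (\<lambda>x. symb k (itin c w x))"

lemma symb_itin_measurable [measurable]: "(\<lambda>x. symb k (itin c w x)) \<in> borel_measurable borel"
  by (rule borel_measurable_sym_itin) (rule cut_system_axioms)

lemma symb_itin_vimage_borel:
  "E \<in> sets borel \<Longrightarrow> {x. symb k (itin c w x) \<in> E} \<in> sets borel"
  using measurable_sets_borel[OF symb_itin_measurable] by (simp add: vimage_def)

lemma emeasure_L:
  assumes "E \<in> sets borel"
  shows "emeasure L E = emeasure lborel ({x. symb k (itin c w x) \<in> E} \<inter> {0..<real k}) / ennreal (real k)"
  unfolding L_def using assms symb_itin_vimage_borel[OF assms]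
  by (subst emeasure_distr) (auto simp: vimage_def Int_commute)

lemma emeasure_L_shifted:
  assumes "E \<in> sets borel"
  shows "emeasure L E = emeasure lborel ({x. symb k (itin c w x) \<in> E} \<inter> {a..<a + real k}) / ennreal (real k)"
  unfolding emeasure_L[OF assms] using symb_itin_vimage_borel[OF assms] k_pos symb_itin_period[of _ 1]
  by (subst emeasure_periodic) simp_all

lemma prob_space_L: "prob_space L"
proof -
  have "prob_space (uniform_measure lborel {0..<real k})"
    by (rule prob_space_uniform_measure) (use k_pos in auto)
  then show ?thesis unfolding L_def by (rule prob_space.prob_space_distr) simp
qed

lemma sets_L [simp]: "sets L = sets borel"
  by (simp add: L_def)

lemma measurable_shift [measurable]: "shift \<in> borel_measurable borel"
  by (intro borel_measurable_continuous_onI continuous_shift)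

text \<open>On itineraries the shift is translation by \<open>w\<close>, which only moves the
  fundamental domain.\<close>

lemma distr_shift_L: "distr L borel shift = L"
proof (rule measure_eqI)
  fix E assume "E \<in> sets (distr L borel shift)"
  then have E: "E \<in> sets borel" by simp
  have sE: "shift -` E \<in> sets borel" using measurable_sets_borel[OF measurable_shift E] .
  note SE = symb_itin_vimage_borel[OF E]
  have "emeasure (distr L borel shift) E = emeasure L (shift -` E)"
    using E by (subst emeasure_distr) (auto simp: space_borel L_def)
  also have "\<dots> = emeasure lborel ({x. symb k (itin c w x) \<in> shift -` E} \<inter> {0..<real k}) / ennreal (real k)"
    by (rule emeasure_L[OF sE])
  also have "{x. symb k (itin c w x) \<in> shift -` E} \<inter> {0..<real k}
      = {x. x + w \<in> {x. symb k (itin c w x) \<in> E} \<inter> {w..<w + real k}}"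
    by (auto simp: symb_shift[symmetric] shift_itin)
  also have "emeasure lborel \<dots> = emeasure lborel ({x. symb k (itin c w x) \<in> E} \<inter> {w..<w + real k})"
    using SE by (intro lborel_translate) auto
  also have "\<dots> / ennreal (real k) = emeasure L E" by (rule emeasure_L_shifted[OF E, symmetric])
  finally show "emeasure (distr L borel shift) E = emeasure L E" .
qed simp

lemma B_borel: "B \<in> sets borel"
  by (intro borel_closed symseq_compact_imp_closed B_compact)

lemma L_invariant: "L \<in> inv_prob_measures shift B"
proof -
  have "emeasure L B = emeasure lborel (UNIV \<inter> {0..<real k}) / ennreal (real k)"
    using itin_in_B by (subst emeasure_L[OF B_borel]) (simp add: UNIV_def[symmetric])
  also have "\<dots> = 1" using k_pos by (simp add: divide_ennreal)
  finally have "measure L B = 1" by (simp add: measure_def)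
  then show ?thesis using prob_space_L distr_shift_L by (simp add: inv_prob_measures_def)
qed

lemma AE_L_B: "AE s in L. s \<in> B"
  using prob_space.AE_in_set_eq_1[OF prob_space_L, of B] L_invariant B_borel
  by (simp add: inv_prob_measures_def)

lemma L_singleton_ge:
  assumes "0 \<le> d" "d \<le> real k" "\<And>x. a \<le> x \<Longrightarrow> x < a + d \<Longrightarrow> symb k (itin c w x) = s"
  shows "d / real k \<le> measure L {s}"
proof -
  note SE = symb_itin_vimage_borel[OF singleton_symseq_borel[of s]]
  have "ennreal d = emeasure lborel {a..<a + d}" using assms(1) by simp
  also have "\<dots> \<le> emeasure lborel ({x. symb k (itin c w x) \<in> {s}} \<inter> {a..<a + real k})"
    by (rule emeasure_mono) (use assms SE in auto)
  finally have "ennreal d / ennreal (real k) \<le> emeasure L {s}"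
    unfolding emeasure_L_shifted[OF singleton_symseq_borel, of s a]
    by (rule divide_right_mono_ennreal)
  moreover have "emeasure L {s} = ennreal (measure L {s})"
    using prob_space_L by (intro finite_measure.emeasure_eq_measure prob_space.finite_measure)
  ultimately show ?thesis using assms(1) k_pos by (simp add: divide_ennreal)
qed

end

context hm_system
begin

lemma HM_lambda_eq: "HM_lambda k w \<nu> = L"
proof (rule measure_eqI)
  show "sets (HM_lambda k w \<nu>) = sets L" by (simp add: HM_lambda_def)
  fix E assume "E \<in> sets (HM_lambda k w \<nu>)"
  then have E: "E \<in> sets borel" by (simp add: HM_lambda_def)
  define S where "S = (\<lambda>x. symb k (itin cc w x))"
  define good where "good = HM_good k w \<nu>"
  have Sm: "S \<in> borel_measurable borel" unfolding S_def by simp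
  have sub: "{0..<real k} - good \<subseteq> bad"
  proof
    fix x assume x: "x \<in> {0..<real k} - good"
    then have "x rmod real k = x" by simp
    then show "x \<in> bad" using rmod_good[of x] x by (auto simp: good_def)
  qed
  have "countable ({0..<real k} - good)" using countable_bad sub by (rule countable_subset[rotated])
  then have null: "{0..<real k} - good \<in> null_sets lborel" by (rule countable_imp_null_set_lborel)
  have "good \<subseteq> {0..<real k}" by (auto simp: good_def HM_good_def)
  then have good_eq: "good = {0..<real k} - ({0..<real k} - good)" by auto
  have good_sets: "good \<in> sets borel"
    by (subst good_eq) (use null in \<open>auto simp: null_sets_def\<close>)
  have zeta: "HM_zeta k w \<nu> \<in> measurable (restrict_space lborel good) borel"
  proof (subst measurable_cong[where g = S])
    show "HM_zeta k w \<nu> x = S x" if "x \<in> space (restrict_space lborel good)" for x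
      using that HM_zeta_eq by (auto simp: space_restrict_space good_def S_def)
    show "S \<in> measurable (restrict_space lborel good) borel"
      using Sm by (intro measurable_restrict_space1) simp
  qed
  have SE: "S -` E \<in> sets borel" using measurable_sets_borel[OF Sm E] .
  have "emeasure (HM_lambda k w \<nu>) E = ennreal (1 / real k) *
      emeasure (restrict_space lborel good) (HM_zeta k w \<nu> -` E \<inter> space (restrict_space lborel good))"
    using emeasure_distr[OF zeta, of E] E by (simp add: HM_lambda_def good_def)
  also have "HM_zeta k w \<nu> -` E \<inter> space (restrict_space lborel good) = S -` E \<inter> good"
    using HM_zeta_eq by (auto simp: space_restrict_space good_def S_def)
  also have "emeasure (restrict_space lborel good) (S -` E \<inter> good) = emeasure lborel (S -` E \<inter> good)"
    using good_sets by (intro emeasure_restrict_space) auto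
  also have "\<dots> = emeasure lborel ((S -` E \<inter> {0..<real k}) - ({0..<real k} - good))"
    using \<open>good \<subseteq> {0..<real k}\<close> by (intro arg_cong[of _ _ "emeasure lborel"]) auto
  also have "\<dots> = emeasure lborel (S -` E \<inter> {0..<real k})"
    using SE null by (intro emeasure_Diff_null_set) auto
  also have "ennreal (1 / real k) * \<dots> = emeasure L E"
    unfolding emeasure_L[OF E] S_def vimage_def
    using k_ge_1 by (simp add: divide_ennreal_def inverse_ennreal mult.commute inverse_eq_divide)
  finally show "emeasure (HM_lambda k w \<nu>) E = emeasure L E" .
qed

end

section \<open>Height functions\<close>

text \<open>Unlike \<open>u 0\<close>, a limsup ignores finite prefixes, so the shift changes it by
  exactly \<open>w\<close>. Bounded displacement makes it finite; for other sequences an infinite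
  value would be sent to 0.\<close>

definition height :: "real \<Rightarrow> symseq \<Rightarrow> real" where
  "height w u = real_of_ereal (limsup (\<lambda>n. ereal (of_int (u n) - real n * w)))"

lemma ereal_height:
  assumes "\<And>n. \<bar>real_of_int (u n - u 0) - real n * w\<bar> \<le> C"
  shows "limsup (\<lambda>n. ereal (of_int (u n) - real n * w)) = ereal (height w u)"
proof -
  let ?l = "limsup (\<lambda>n. ereal (of_int (u n) - real n * w))"
  have b: "of_int (u n) - real n * w \<le> of_int (u 0) + C" "of_int (u 0) - C \<le> of_int (u n) - real n * w" for n
    using assms[of n] by auto
  have "?l \<le> ereal (of_int (u 0) + C)"
    by (rule Limsup_bounded, rule always_eventually) (use b in simp)
  moreover have "ereal (of_int (u 0) - C) \<le> ?l"
  proof -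
    have "limsup (\<lambda>n. ereal (of_int (u 0) - C)) \<le> ?l"
      by (rule Limsup_mono, rule always_eventually) (use b in simp)
    then show ?thesis by (simp add: Limsup_const)
  qed
  ultimately have "\<bar>?l\<bar> \<noteq> \<infinity>" by (cases ?l) auto
  then show ?thesis unfolding height_def by (simp add: ereal_real')
qed

lemma height_add:
  assumes "\<And>n. \<bar>real_of_int (u n - u 0) - real n * w\<bar> \<le> C"
    and "limsup (\<lambda>n. ereal (of_int (v n) - real n * w)) = limsup (\<lambda>n. ereal (of_int (u n) - real n * w) + ereal r)"
  shows "height w v = height w u + r"
  using assms(2) Limsup_add_ereal_right[of sequentially "ereal r" "\<lambda>n. ereal (of_int (u n) - real n * w)"]
    ereal_height[OF assms(1)] unfolding height_def[of w v] by simp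

lemma height_shift:
  assumes "\<And>n. \<bar>real_of_int (u n - u 0) - real n * w\<bar> \<le> C"
  shows "height w (shift u) = height w u + w"
proof (rule height_add[OF assms])
  have "ereal (of_int (shift u n) - real n * w) = ereal (of_int (u (n + 1)) - real (n + 1) * w) + ereal w" for n
    by (simp add: shift_apply algebra_simps)
  then show "limsup (\<lambda>n. ereal (of_int (shift u n) - real n * w))
      = limsup (\<lambda>n. ereal (of_int (u n) - real n * w) + ereal w)"
    using limsup_shift[of "\<lambda>n. ereal (of_int (u n) - real n * w) + ereal w"] by simp
qed

lemma height_trans:
  assumes "\<And>n. \<bar>real_of_int (u n - u 0) - real n * w\<bar> \<le> C"
  shows "height w (translate m u) = height w u + of_int m"
  by (rule height_add[OF assms]) (simp add: translate_apply algebra_simps)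

lemma height_mono:
  assumes "\<And>n. \<bar>real_of_int (u n - u 0) - real n * w\<bar> \<le> C"
    and "\<And>n. \<bar>real_of_int (v n - v 0) - real n * w\<bar> \<le> C" and "u \<le> v"
  shows "height w u \<le> height w v"
proof -
  have "ereal (height w u) \<le> ereal (height w v)"
    unfolding ereal_height[OF assms(1), symmetric] ereal_height[OF assms(2), symmetric]
    by (rule Limsup_mono, rule always_eventually) (use assms(3) in \<open>simp add: le_fun_def\<close>)
  then show ?thesis by simp
qed

lemma continuous_lift_coord: "continuous_on A (\<lambda>s. lift s n)"
  by (rule continuous_on_local_const[of "Suc n"]) (simp add: lift_def agree_def cong: sum.cong_simp)

lemma measurable_height_lift: "(\<lambda>s. height w (lift s)) \<in> borel_measurable borel"
proof -
  have "(\<lambda>s. lift s n) \<in> borel_measurable borel" for n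
    by (intro borel_measurable_continuous_onI continuous_lift_coord)
  moreover have "(of_int :: int \<Rightarrow> real) \<in> borel_measurable borel"
    by (intro borel_measurable_continuous_onI continuous_on_of_int continuous_on_id)
  ultimately have [measurable]: "(\<lambda>s. real_of_int (lift s n)) \<in> borel_measurable borel" for n
    using measurable_compose by blast
  show ?thesis unfolding height_def by measurable
qed

text \<open>Kept abstract because two unrelated functions satisfy it: the limsup height, and the
  weighted count of lifts in the rational case. Injectivity of \<open>\<phi>\<close> is not among
  its consequences.\<close>

locale height_system =
  fixes k :: nat and w :: real and W :: "symseq set" and \<phi> :: "symseq \<Rightarrow> real"
  assumes k_pos: "k \<ge> 1" and w_nonneg: "0 \<le> w" and W_ne: "W \<noteq> {}"
    and W_stair: "u \<in> W \<Longrightarrow> stair u"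
    and W_trans: "u \<in> W \<Longrightarrow> translate (int k * m) u \<in> W"
    and W_shift: "u \<in> W \<Longrightarrow> shift u \<in> W"
    and W_shift_onto: "u \<in> W \<Longrightarrow> \<exists>v\<in>W. shift v = u"
    and W_chain: "le_chain W"
    and \<phi>_shift: "u \<in> W \<Longrightarrow> \<phi> (shift u) = \<phi> u + w"
    and \<phi>_trans: "u \<in> W \<Longrightarrow> \<phi> (translate (int k * m) u) = \<phi> u + real k * of_int m"
    and \<phi>_mono: "u \<in> W \<Longrightarrow> v \<in> W \<Longrightarrow> u \<le> v \<Longrightarrow> \<phi> u \<le> \<phi> v"
begin

lemma W_funpow_shift: "u \<in> W \<Longrightarrow> (shift ^^ n) u \<in> W"
  by (induction n) (simp_all add: W_shift)

lemma \<phi>_funpow_shift: "u \<in> W \<Longrightarrow> \<phi> ((shift ^^ n) u) = \<phi> u + real n * w"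
proof (induction n)
  case (Suc n)
  then show ?case using \<phi>_shift[OF W_funpow_shift[of u n]] by (simp add: algebra_simps)
qed simp

lemma W_above: "\<exists>v\<in>W. j \<le> v 0"
proof -
  obtain u where u: "u \<in> W" using W_ne by blast
  define m where "m = \<bar>j\<bar> + \<bar>u 0\<bar>"
  have "m \<le> int k * m" using k_pos mult_right_mono[of 1 "int k" m] by (simp add: m_def)
  moreover have "j \<le> u 0 + m" by (simp add: m_def)
  ultimately have "j \<le> translate (int k * m) u 0" unfolding translate_apply by linarith
  then show ?thesis using W_trans[OF u] by blast
qed

lemma W_below: "\<exists>v\<in>W. v 0 < j"
proof -
  obtain u where u: "u \<in> W" using W_ne by blast
  define m where "m = \<bar>j\<bar> + \<bar>u 0\<bar> + 1"
  have "m \<le> int k * m" using k_pos mult_right_mono[of 1 "int k" m] by (simp add: m_def)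
  moreover have "u 0 - m < j" by (simp add: m_def)
  ultimately have "u 0 + int k * (- m) < j" unfolding mult_minus_right by linarith
  then have "translate (int k * (- m)) u 0 < j" unfolding translate_apply .
  then show ?thesis using W_trans[OF u] by blast
qed

lemma \<phi>_less_imp_le: "u \<in> W \<Longrightarrow> v \<in> W \<Longrightarrow> \<phi> u < \<phi> v \<Longrightarrow> u \<le> v"
  using le_chainD[OF W_chain, of u v] \<phi>_mono[of v u] by linarith

definition cut :: "int \<Rightarrow> real" where
  "cut j = Inf (\<phi> ` {v \<in> W. j \<le> v 0})"

lemma cut_bdd: "bdd_below (\<phi> ` {v \<in> W. j \<le> v 0})"
proof -
  obtain t where t: "t \<in> W" "t 0 < j" using W_below by blast
  have "\<phi> t \<le> \<phi> v" if "v \<in> W" "j \<le> v 0" for v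
    using \<phi>_mono[OF t(1) that(1)] le_chain_less_at[OF W_chain t(1) that(1), where i = 0] t(2) that(2) by simp
  then show ?thesis by (intro bdd_belowI[of _ "\<phi> t"]) blast
qed

lemma cut_le: "v \<in> W \<Longrightarrow> j \<le> v 0 \<Longrightarrow> cut j \<le> \<phi> v"
  unfolding cut_def by (rule cInf_lower[OF _ cut_bdd]) blast

lemma cut_ne: "\<phi> ` {v \<in> W. j \<le> v 0} \<noteq> {}"
  using W_above by blast

lemma cut_greatest: "(\<And>v. v \<in> W \<Longrightarrow> j \<le> v 0 \<Longrightarrow> a \<le> \<phi> v) \<Longrightarrow> a \<le> cut j"
  unfolding cut_def by (rule cInf_greatest[OF cut_ne]) blast

lemma cut_less: "v \<in> W \<Longrightarrow> cut j < \<phi> v \<Longrightarrow> j \<le> v 0"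
proof -
  assume v: "v \<in> W" "cut j < \<phi> v"
  then obtain u where u: "u \<in> W" "j \<le> u 0" "\<phi> u < \<phi> v"
    unfolding cut_def cInf_less_iff[OF cut_ne cut_bdd] by blast
  then have "u \<le> v" using \<phi>_less_imp_le v(1) by blast
  then have "u 0 \<le> v 0" by (rule le_funD)
  then show ?thesis using u(2) by simp
qed

sublocale cuts: cut_system k w cut
proof
  fix j
  show "cut (j + int k) = cut j + real k"
  proof (rule antisym)
    have "cut (j + int k) - real k \<le> cut j"
    proof (rule cut_greatest)
      fix v assume v: "v \<in> W" "j \<le> v 0"
      then have "cut (j + int k) \<le> \<phi> (translate (int k * 1) v)"
        by (intro cut_le W_trans) (simp_all add: translate_apply)
      then show "cut (j + int k) - real k \<le> \<phi> v" using \<phi>_trans[OF v(1), of 1] by simp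
    qed
    then show "cut (j + int k) \<le> cut j + real k" by simp
    show "cut j + real k \<le> cut (j + int k)"
    proof (rule cut_greatest)
      fix v assume v: "v \<in> W" "j + int k \<le> v 0"
      then have "cut j \<le> \<phi> (translate (int k * -1) v)"
        by (intro cut_le W_trans) (simp_all add: translate_apply)
      then show "cut j + real k \<le> \<phi> v" using \<phi>_trans[OF v(1), of "-1"] by simp
    qed
  qed
  show "cut j + w \<le> cut (j + 1)"
  proof (rule cut_greatest)
    fix v assume v: "v \<in> W" "j + 1 \<le> v 0"
    \<comment> \<open>The gap between cuts comes from a preimage of \<open>v\<close>: it starts at
      most one level lower, and its height is lower by \<open>w\<close>.\<close>
    obtain u where u: "u \<in> W" "shift u = v" using W_shift_onto v by blast
    have "u (Suc 0) \<le> u 0 + 1" using spec[OF W_stair[OF u(1), unfolded stair_def], of 0] by linarith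
    then have "v 0 \<le> u 0 + 1" unfolding u(2)[symmetric] shift_apply .
    then have "cut j \<le> \<phi> u" using v(2) by (intro cut_le u) simp
    then show "cut j + w \<le> \<phi> v" using \<phi>_shift[OF u(1)] u(2) by simp
  qed
qed (rule k_pos w_nonneg)+

text \<open>The strict inequality matters: staircases on both sides of a level \<open>j\<close> may
  share a height, and then \<open>cut j\<close> does not separate them at
  \<open>x = \<phi> u\<close>.\<close>

lemma sandwich_lower:
  assumes "u \<in> W" "x < \<phi> u"
  shows "itin cut w x \<le> u"
proof (rule le_funI)
  fix n
  have "cut (itin cut w x n) \<le> x + real n * w" unfolding itin_def by (rule cuts.cut_index)
  also have "\<dots> < \<phi> ((shift ^^ n) u)" using assms \<phi>_funpow_shift by simp
  finally have "itin cut w x n \<le> (shift ^^ n) u 0" by (rule cut_less[OF W_funpow_shift[OF assms(1)]])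
  then show "itin cut w x n \<le> u n" by (simp add: funpow_shift)
qed

lemma sandwich_upper:
  assumes "u \<in> W" "\<phi> u < x"
  shows "u \<le> itin cut w x"
proof (rule le_funI)
  fix n
  have "cut (u n) \<le> \<phi> ((shift ^^ n) u)"
    by (rule cut_le[OF W_funpow_shift[OF assms(1)]]) (simp add: funpow_shift)
  also have "\<dots> \<le> x + real n * w" using assms \<phi>_funpow_shift by simp
  finally show "u n \<le> itin cut w x n" unfolding itin_def by (simp add: cuts.le_cut_index_iff)
qed

end

text \<open>The free constant \<open>d\<close> allows the height of an itinerary to be normalised to
  its parameter.\<close>

lemma height_system_Wof:
  assumes "k \<ge> 1" "Z \<noteq> {}" "Z \<subseteq> symb k ` Collect stair" "shift ` Z = Z" "le_chain (Wof k Z)" "rho_set_eq Z w"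
  shows "height_system k w (Wof k Z) (\<lambda>u. height w u - d)"
proof -
  have bd: "\<bar>real_of_int (u n - u 0) - real n * w\<bar> \<le> 4 * real k" if "u \<in> Wof k Z" for u n
    using rho_set_eq_bounded[OF assms(1-3) _ assms(5,6) that] assms(4) by blast
  show ?thesis
  proof
    show "k \<ge> 1" by fact
    show "0 \<le> w" using rho_set_eq_range assms(6) by blast
    show "Wof k Z \<noteq> {}" using lift_in_Wof[OF assms(1,3)] assms(2) by blast
    show "le_chain (Wof k Z)" by fact
    fix u assume u: "u \<in> Wof k Z"
    show "stair u" using u by (simp add: Wof_def)
    show "translate (int k * m) u \<in> Wof k Z" for m using u by (rule Wof_trans)
    show "shift u \<in> Wof k Z" using Wof_shift assms(4) u by blast
    show "\<exists>v\<in>Wof k Z. shift v = u" using Wof_shift_onto[OF assms(1,3) _ u] assms(4) by blast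
    show "height w (shift u) - d = height w u - d + w" using height_shift[OF bd[OF u]] by simp
    show "height w (translate (int k * m) u) - d = height w u - d + real k * of_int m" for m
      using height_trans[OF bd[OF u]] by simp
    fix v assume v: "v \<in> Wof k Z" "u \<le> v"
    show "height w u - d \<le> height w v - d" using height_mono[OF bd[OF u] bd[OF v(1)] v(2)] by simp
  qed
qed

section \<open>Recurrence and approximation for irrational rotation numbers\<close>

lemma recurrent_setI:
  fixes Y :: "symseq set"
  assumes "\<And>x N. x \<in> Y \<Longrightarrow> \<exists>n\<ge>N. agree N x ((shift ^^ n) x)"
  shows "recurrent_set shift Y"
  unfolding recurrent_set_def
proof
  fix x assume "x \<in> Y"
  then obtain m where m: "\<And>N. m N \<ge> N" "\<And>N. agree N x ((shift ^^ m N) x)" using assms by metis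
  have "filterlim m at_top sequentially"
    by (rule filterlim_at_top_mono[OF filterlim_ident]) (use m(1) in simp)
  moreover have "(\<lambda>i. (shift ^^ m i) x) \<longlonglongrightarrow> x"
    unfolding tendsto_agree
    using agree_le[OF m(2)] by (auto simp: eventually_sequentially)
  ultimately show "\<exists>m. filterlim m at_top sequentially \<and> (\<lambda>i. (shift ^^ m i) x) \<longlonglongrightarrow> x" by blast
qed

lemma recurrent_setD:
  fixes Y :: "symseq set"
  assumes "recurrent_set shift Y" "x \<in> Y"
  shows "\<exists>n\<ge>n0. agree N x ((shift ^^ n) x)"
proof -
  obtain m where m: "filterlim m at_top sequentially" "(\<lambda>i. (shift ^^ m i) x) \<longlonglongrightarrow> x"
    using assms unfolding recurrent_set_def by blast
  have "eventually (\<lambda>i. agree N x ((shift ^^ m i) x)) sequentially"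
    using m(2) unfolding tendsto_agree by blast
  moreover have "eventually (\<lambda>i. n0 \<le> m i) sequentially"
    using m(1) unfolding filterlim_at_top by blast
  ultimately have "eventually (\<lambda>i. agree N x ((shift ^^ m i) x) \<and> n0 \<le> m i) sequentially"
    by (rule eventually_conj)
  then show ?thesis using eventually_happens'[OF sequentially_bot] by blast
qed

text \<open>The cuts \<open>c\<close> are independent data, so that the sandwich serves both cuts
  derived from a given kfsm set and the cuts that define \<open>B\<close>.\<close>

locale irrational_height = height_system + cs: cut_system k w c for c +
  assumes irr: "w / real k \<notin> \<rat>"
    and lower: "u \<in> W \<Longrightarrow> x < \<phi> u \<Longrightarrow> itin c w x \<le> u"
    and upper: "u \<in> W \<Longrightarrow> \<phi> u < x \<Longrightarrow> u \<le> itin c w x"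
begin

text \<open>Some translated iterate of \<open>u\<close> has height strictly between \<open>x\<close>
  and \<open>x + e / 2\<close>. It is then squeezed between two itineraries that agree on the
  window.\<close>

lemma dense:
  assumes "u \<in> W"
  shows "\<exists>n\<ge>n0. \<exists>m. agree N (itin c w x) (translate (int k * m) ((shift ^^ n) u))"
proof -
  obtain e where e: "e > 0" "\<And>y. x \<le> y \<Longrightarrow> y < x + e \<Longrightarrow> agree N (itin c w x) (itin c w y)"
    using cs.itin_right_const[of x N] by blast
  obtain n m where nm: "n \<ge> n0" "x - \<phi> u < real n * w - real k * of_int m"
      "real n * w - real k * of_int m < x - \<phi> u + e / 2"
    using dense_rotation_orbit[OF _ irr, of "x - \<phi> u" "x - \<phi> u + e / 2" n0] k_pos e(1) by auto
  define v where "v = translate (int k * (- m)) ((shift ^^ n) u)"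
  have v: "v \<in> W" unfolding v_def by (intro W_trans W_funpow_shift assms)
  have "\<phi> v = \<phi> u + real n * w - real k * of_int m"
    unfolding v_def using \<phi>_trans[OF W_funpow_shift[OF assms], of "-m" n] \<phi>_funpow_shift[OF assms, of n] by simp
  then have "x < \<phi> v" "\<phi> v < x + e / 2" using nm by simp_all
  then have "itin c w x \<le> v" "v \<le> itin c w (x + e / 2)"
    using lower upper v by blast+
  moreover have "agree N (itin c w x) (itin c w (x + e / 2))" using e by simp
  ultimately have "agree N (itin c w x) v"
    unfolding agree_def le_fun_def by (metis antisym)
  then show ?thesis using nm(1) unfolding v_def by blast
qed

lemma B_subset_closed:
  assumes "closed Y" "shift ` Y \<subseteq> Y" "u \<in> W" "symb k u \<in> Y"
  shows "cs.B \<subseteq> Y"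
  unfolding cs.B_def
proof (rule closure_minimal[OF _ assms(1)], safe)
  fix x
  show "symb k (itin c w x) \<in> Y"
  proof (rule closed_symseq_agree[OF assms(1)])
    fix N
    obtain n m where a: "agree (Suc N) (itin c w x) (translate (int k * m) ((shift ^^ n) u))"
      using dense[OF assms(3)] by blast
    have "agree N (symb k (itin c w x)) ((shift ^^ n) (symb k u))"
      using symb_agree[OF a, of k] by (simp add: symb_funpow_shift)
    moreover have "(shift ^^ n) (symb k u) \<in> Y"
      by (induction n) (use assms in auto)
    ultimately show "\<exists>y\<in>Y. agree N (symb k (itin c w x)) y" by blast
  qed
qed

text \<open>A near return \<open>v\<close> of \<open>u\<close> has a different height, since
  \<open>n * w\<close> with \<open>n \<ge> 1\<close> is never a multiple of \<open>k\<close>. The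
  itinerary of the midpoint of the two heights lies between \<open>u\<close> and \<open>v\<close>,
  hence agrees with both on the common window.\<close>

lemma recurrent_in_B:
  assumes "u \<in> W" "\<And>N. \<exists>n\<ge>1. agree N (symb k u) ((shift ^^ n) (symb k u))"
  shows "symb k u \<in> cs.B"
  unfolding cs.B_def closure_agree
proof
  fix N
  obtain n where n: "n \<ge> 1" "agree (Suc (Suc N)) (symb k u) ((shift ^^ n) (symb k u))" using assms(2) by blast
  have "agree (Suc (Suc N)) (symb k ((shift ^^ n) u)) (symb k u)"
    unfolding symb_funpow_shift by (rule agree_sym[OF n(2)])
  then obtain m where "agree (Suc (Suc N)) (translate (int k * m) ((shift ^^ n) u)) u"
    using symb_agreeD[OF k_pos W_stair[OF W_funpow_shift[OF assms(1)]] W_stair[OF assms(1)]] by blast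
  then have m: "agree (Suc N) (translate (int k * m) ((shift ^^ n) u)) u" by (rule agree_le) simp
  define v where "v = translate (int k * m) ((shift ^^ n) u)"
  have v: "v \<in> W" unfolding v_def by (intro W_trans W_funpow_shift assms)
  have "\<phi> v = \<phi> u + (real n * w + real k * of_int m)"
    unfolding v_def using \<phi>_trans[OF W_funpow_shift[OF assms(1)], of m n] \<phi>_funpow_shift[OF assms(1), of n] by simp
  moreover have "real n * w + real k * of_int m \<noteq> 0"
  proof
    assume "real n * w + real k * of_int m = 0"
    then have "w / real k = of_int (- m) / of_int (int n)"
      using n(1) k_pos by (simp add: field_simps)
    also have "\<dots> \<in> \<rat>" by (intro Rats_divide Rats_of_int)
    finally show False using irr by simp
  qed
  ultimately have "\<phi> v \<noteq> \<phi> u" by simp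
  define x where "x = (\<phi> u + \<phi> v) / 2"
  have "(u \<le> itin c w x \<and> itin c w x \<le> v) \<or> (v \<le> itin c w x \<and> itin c w x \<le> u)"
  proof (cases "\<phi> u < \<phi> v")
    case True
    then have "\<phi> u < x" "x < \<phi> v" by (simp_all add: x_def)
    then show ?thesis using upper[OF assms(1)] lower[OF v] by blast
  next
    case False
    then have "\<phi> v < x" "x < \<phi> u" using \<open>\<phi> v \<noteq> \<phi> u\<close> by (simp_all add: x_def)
    then show ?thesis using upper[OF v] lower[OF assms(1)] by blast
  qed
  then have "agree (Suc N) u (itin c w x)"
    using m unfolding v_def[symmetric] agree_def le_fun_def by (metis antisym)
  then have "agree N (symb k u) (symb k (itin c w x))" by (rule symb_agree)
  then show "\<exists>y\<in>range (\<lambda>x. symb k (itin c w x)). agree N (symb k u) y" by blast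
qed

end

section \<open>Moving the origin of a cut system\<close>

lemma cut_index_diff: "cut_index (\<lambda>j. c j - d) x = cut_index c (x + d)"
  unfolding cut_index_def by (simp add: algebra_simps)

lemma itin_diff: "itin (\<lambda>j. c j - d) w x = itin c w (x + d)"
  by (simp add: itin_def cut_index_diff algebra_simps)

lemma (in cut_system) normalized_cut:
  "cut_system k w (\<lambda>j. c j - d)" "cut_system.B k w (\<lambda>j. c j - d) = B"
proof -
  show n: "cut_system k w (\<lambda>j. c j - d)"
    using k_pos w_nonneg c_period c_gap by unfold_locales (auto simp: algebra_simps)
  have "range (\<lambda>x. symb k (itin c w (x + d))) = range (\<lambda>x. symb k (itin c w x))"
  proof (intro subset_antisym image_subsetI)
    fix x show "symb k (itin c w x) \<in> range (\<lambda>x. symb k (itin c w (x + d)))"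
      by (rule range_eqI[of _ _ "x - d"]) simp
  qed blast
  then show "cut_system.B k w (\<lambda>j. c j - d) = B"
    unfolding cut_system.B_def[OF n] B_def itin_diff by simp
qed

lemma (in cut_system) normalized_L:
  "cut_system.L k w (\<lambda>j. c j - d) = L"
proof (rule measure_eqI)
  interpret n: cut_system k w "\<lambda>j. c j - d" by (rule normalized_cut)
  show "sets n.L = sets L" by simp
  fix E assume "E \<in> sets n.L"
  then have E: "E \<in> sets borel" by simp
  note SE = symb_itin_vimage_borel[OF E]
  have "emeasure n.L E = emeasure lborel ({x. symb k (itin c w (x + d)) \<in> E} \<inter> {0..<real k}) / ennreal (real k)"
    unfolding n.emeasure_L[OF E] itin_diff ..
  also have "{x. symb k (itin c w (x + d)) \<in> E} \<inter> {0..<real k}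
      = {x. x + d \<in> {x. symb k (itin c w x) \<in> E} \<inter> {d..<d + real k}}"
    by auto
  also have "emeasure lborel \<dots> = emeasure lborel ({x. symb k (itin c w x) \<in> E} \<inter> {d..<d + real k})"
    using SE by (intro lborel_translate) auto
  also have "\<dots> / ennreal (real k) = emeasure L E" by (rule emeasure_L_shifted[OF E, symmetric])
  finally show "emeasure n.L E = emeasure L E" .
qed

text \<open>The construction puts a cut at 0; translating by \<open>c 0\<close> achieves this and
  changes neither the closure nor the measure.\<close>

lemma (in cut_system) exists_hm_vector:
  "\<exists>\<nu>. allowable k w \<nu> \<and> HM_B k w \<nu> = B \<and> HM_lambda k w \<nu> = L"
proof -
  define c' where "c' j = c j - c 0" for j
  have c': "cut_system k w c'" "cut_system.B k w c' = B" "cut_system.L k w c' = L"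
    using normalized_cut[of "c 0"] normalized_L[of "c 0"] unfolding c'_def by auto
  obtain \<nu> where \<nu>: "allowable k w \<nu>" "hm_cut k w \<nu> = c'"
    using cut_system.hm_cut_surj[OF c'(1)] by (auto simp: c'_def)
  have h: "hm_system k w \<nu>" using k_pos \<nu>(1) by (simp add: hm_system_def)
  have "HM_B k w \<nu> = B" "HM_lambda k w \<nu> = L"
    using hm_system.HM_B_eq[OF h] hm_system.HM_lambda_eq[OF h] \<nu>(2) c'(2,3) by simp_all
  then show ?thesis using \<nu>(1) by blast
qed

section \<open>Minimality and unique ergodicity for irrational rotation numbers\<close>

context cut_system
begin

text \<open>As a function of \<open>x\<close>, the height of the itinerary is monotone and commutes
  with translation by \<open>k\<close> and \<open>w\<close>, so rigidity makes it affine with slope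
  1. After subtracting \<open>d\<close> the height is the parameter itself, and the sandwich is a
  comparison of heights.\<close>

lemma irrational_height_B:
  assumes "w / real k \<notin> \<rat>"
  shows "\<exists>d. irrational_height k w (Wof k B) (\<lambda>u. height w u - d) c"
proof -
  define d where "d = height w (itin c w 0)"
  have B_ne: "B \<noteq> {}" using itin_in_B by blast
  note hs = height_system_Wof[OF k_pos B_ne B_subset_stair B_shift B_chain B_rho]
  interpret h: height_system k w "Wof k B" "\<lambda>u. height w u - d" by (rule hs)
  have it: "itin c w x \<in> Wof k B" for x using itin_in_B stair_itin by (simp add: Wof_def)
  have hx: "height w (itin c w x) - d = x" for x
  proof -
    define f where "f x = height w (itin c w x) - d" for x
    have "f x = real k / real k * x + f 0"
    proof (rule equivariant_monotone_affine[of "real k" w f "real k" w])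
      show "0 < real k" using k_pos by simp
      show "mono f" unfolding f_def by (intro monoI h.\<phi>_mono it itin_mono)
      show "f (x + real k) = f x + real k" for x
        using h.\<phi>_trans[OF it, of 1] itin_period[of x 1] by (simp add: f_def)
      show "f (x + w) = f x + w" for x
        using h.\<phi>_shift[OF it, of x] unfolding shift_itin f_def by simp
    qed (rule assms)
    then show ?thesis using k_pos by (simp add: f_def d_def)
  qed
  have "irrational_height k w (Wof k B) (\<lambda>u. height w u - d) c"
  proof
    show "w / real k \<notin> \<rat>" by (rule assms)
    fix u x assume u: "u \<in> Wof k B"
    show "itin c w x \<le> u" if "x < height w u - d"
      using h.\<phi>_less_imp_le[OF it u] that hx by simp
    show "u \<le> itin c w x" if "height w u - d < x"
      using h.\<phi>_less_imp_le[OF u it] that hx by simp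
  qed
  then show ?thesis by blast
qed

lemma B_minimal_set:
  assumes "w / real k \<notin> \<rat>"
  shows "minimal_set shift B"
proof -
  obtain d where "irrational_height k w (Wof k B) (\<lambda>u. height w u - d) c"
    using irrational_height_B[OF assms] by blast
  then interpret h: irrational_height k w "Wof k B" "\<lambda>u. height w u - d" c .
  have "N = B" if N: "N \<subseteq> B" "compact N" "N \<noteq> {}" "invariant_set shift N" for N
  proof -
    obtain s where s: "s \<in> N" using N(3) by blast
    then have "lift s \<in> Wof k B" "symb k (lift s) = s" using lift_in_Wof[OF k_pos B_subset_stair] N(1) by auto
    then have "B \<subseteq> N"
      using h.B_subset_closed[of N "lift s"] s N symseq_compact_imp_closed by (auto simp: invariant_set_def)
    then show ?thesis using N(1) by blast
  qed
  moreover have "B \<noteq> {}" using itin_in_B by blast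
  ultimately show ?thesis
    unfolding minimal_set_def by (simp add: B_compact B_shift invariant_set_def)
qed

text \<open>A point agrees on a window with an itinerary, and that itinerary is in turn approximated
  by late iterates of the same point.\<close>

lemma B_recurrent_irrational:
  assumes "w / real k \<notin> \<rat>"
  shows "recurrent_set shift B"
proof (rule recurrent_setI)
  obtain d where "irrational_height k w (Wof k B) (\<lambda>u. height w u - d) c"
    using irrational_height_B[OF assms] by blast
  then interpret h: irrational_height k w "Wof k B" "\<lambda>u. height w u - d" c .
  fix s N assume "s \<in> B"
  then have u: "lift s \<in> Wof k B" "symb k (lift s) = s" using lift_in_Wof[OF k_pos B_subset_stair] by auto
  obtain x where x: "agree (Suc N) (lift s) (itin c w x)" using Wof_B_approx[OF u(1)] by blast
  obtain n m where nm: "n \<ge> N" "agree (Suc N) (itin c w x) (translate (int k * m) ((shift ^^ n) (lift s)))"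
    using h.dense[OF u(1)] by blast
  have "agree N (symb k (lift s)) (symb k (translate (int k * m) ((shift ^^ n) (lift s))))"
    by (rule symb_agree[OF agree_trans[OF x nm(2)]])
  then have "agree N s ((shift ^^ n) s)" by (simp add: symb_funpow_shift u(2))
  then show "\<exists>n\<ge>N. agree N s ((shift ^^ n) s)" using nm(1) by blast
qed

end

lemma irrational_kfsm_eq_HM_B:
  assumes "k \<ge> 1" "symbolic_kfsm k Z" "recurrent_set shift Z" "rho_set_eq Z w" "w / real k \<notin> \<rat>"
  shows "\<exists>\<nu>. allowable k w \<nu> \<and> Z = HM_B k w \<nu>"
proof -
  have Z: "compact Z" "Z \<noteq> {}" "Z \<subseteq> symb k ` Collect stair" "shift ` Z = Z" "le_chain (Wof k Z)"
    using assms(2) unfolding symbolic_kfsm_iff[OF assms(1)] by auto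
  interpret h0: height_system k w "Wof k Z" "\<lambda>u. height w u - 0"
    by (rule height_system_Wof[OF assms(1) Z(2-5) assms(4)])
  interpret h: irrational_height k w "Wof k Z" "\<lambda>u. height w u - 0" h0.cut
    by unfold_locales (use assms(5) h0.sandwich_lower h0.sandwich_upper in auto)
  have "h0.cuts.B = Z"
  proof
    obtain s where "s \<in> Z" using Z(2) by blast
    then show "h0.cuts.B \<subseteq> Z"
      using h.B_subset_closed[of Z "lift s"] lift_in_Wof[OF assms(1) Z(3)] Z(4)
        symseq_compact_imp_closed[OF Z(1)] by auto
    show "Z \<subseteq> h0.cuts.B"
    proof
      fix s assume s: "s \<in> Z"
      have "symb k (lift s) \<in> h0.cuts.B"
        by (rule h.recurrent_in_B)
           (use lift_in_Wof[OF assms(1) Z(3) s] recurrent_setD[OF assms(3) s] in auto)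
      then show "s \<in> h0.cuts.B" using lift_in_Wof[OF assms(1) Z(3) s] by simp
    qed
  qed
  moreover obtain \<nu> where "allowable k w \<nu>" "HM_B k w \<nu> = h0.cuts.B"
    using h0.cuts.exists_hm_vector by blast
  ultimately show ?thesis by auto
qed

context irrational_height
begin

text \<open>If the orbit of the height never hits a cut, there is room on both sides: a parameter
  slightly below and one slightly above fix each coordinate.\<close>

lemma eq_itin_height:
  assumes "u \<in> W" "\<And>n j. \<phi> u + real n * w \<noteq> c j"
  shows "u = itin c w (\<phi> u)"
proof
  fix n
  define j where "j = cut_index c (\<phi> u + real n * w)"
  have j: "c j < \<phi> u + real n * w" "\<phi> u + real n * w < c (j + 1)"
    using cs.cut_index[of "\<phi> u + real n * w"] assms(2)[of n j] unfolding j_def by simp_all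
  have "j \<le> u n"
  proof -
    have "itin c w (c j - real n * w) \<le> u" using j(1) by (intro lower[OF assms(1)]) simp
    then have "cut_index c (c j - real n * w + real n * w) \<le> u n"
      using le_funD[of "itin c w (c j - real n * w)" u n] by (simp add: itin_def)
    moreover have "j \<le> cut_index c (c j - real n * w + real n * w)" by (simp add: cs.le_cut_index_iff)
    ultimately show ?thesis by simp
  qed
  moreover have "u n < j + 1"
  proof -
    define y where "y = (\<phi> u + (c (j + 1) - real n * w)) / 2"
    have y: "\<phi> u < y" "y + real n * w < c (j + 1)" using j(2) by (simp_all add: y_def field_simps)
    have "u n \<le> cut_index c (y + real n * w)"
      using le_funD[OF upper[OF assms(1) y(1)], of n] by (simp add: itin_def)
    also have "\<dots> < j + 1" unfolding cs.cut_index_less_iff by (rule y(2))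
    finally show ?thesis .
  qed
  ultimately show "u n = itin c w (\<phi> u) n" by (simp add: itin_def j_def)
qed

end

context cut_system
begin

text \<open>Height modulo \<open>k\<close> is a factor map onto the rotation, so it pushes \<mu> to
  the uniform measure. Almost everywhere the point is recovered from its height as a coded
  itinerary, which pushes the uniform measure back to \<open>L\<close>.\<close>

lemma invariant_measure_eq_L:
  assumes irr: "w / real k \<notin> \<rat>" and \<mu>: "\<mu> \<in> inv_prob_measures shift B"
  shows "\<mu> = L"
proof -
  obtain d where "irrational_height k w (Wof k B) (\<lambda>u. height w u - d) c"
    using irrational_height_B[OF irr] by blast
  then interpret h: irrational_height k w "Wof k B" "\<lambda>u. height w u - d" c .
  have m: "sets \<mu> = sets borel" "prob_space \<mu>" "distr \<mu> borel shift = \<mu>" "measure \<mu> B = 1"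
    using \<mu> by (auto simp: inv_prob_measures_def)
  interpret \<mu>: prob_space \<mu> by (rule m(2))
  note [measurable_cong] = m(1)
  have AEB: "AE s in \<mu>. s \<in> B"
    using m(4) B_borel by (subst \<mu>.AE_in_set_eq_1) (simp_all add: m(1))
  define \<Phi> where "\<Phi> s = (height w (lift s) - d) rmod real k" for s
  have rm: "x rmod real k = x - real k * of_int \<lfloor>x / real k\<rfloor>" for x
    using k_pos by (simp add: rmod_conv_frac frac_def field_simps)
  have rm_per: "(x + real k * of_int i) rmod real k = x rmod real k" for x i
  proof -
    have "(x + real k * of_int i) / real k = x / real k + of_int i" using k_pos by (simp add: field_simps)
    then show ?thesis unfolding rm by (simp add: algebra_simps)
  qed
  note [measurable] = measurable_height_lift[of w]
  have \<Phi>_meas [measurable]: "\<Phi> \<in> borel_measurable borel"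
    unfolding \<Phi>_def rm by measurable
  have rot_meas [measurable]: "(\<lambda>x. (x + w) rmod real k) \<in> borel_measurable borel"
    unfolding rm by measurable
  have lift: "lift s \<in> Wof k B" "symb k (lift s) = s" if "s \<in> B" for s
    using lift_in_Wof[OF k_pos B_subset_stair that] by auto
  have \<Phi>_shift: "\<Phi> (shift s) = (\<Phi> s + w) rmod real k" if sB: "s \<in> B" for s
  proof -
    have ss: "shift s \<in> B" using B_shift that by blast
    obtain i where i: "lift (shift s) = translate (int k * i) (shift (lift s))"
      using lift_shift[OF k_pos B_subset_stair sB ss] by blast
    have "height w (lift (shift s)) - d = (height w (lift s) - d) + w + real k * of_int i"
      unfolding i using h.\<phi>_trans[OF h.W_shift[OF lift(1)[OF that]], of i] h.\<phi>_shift[OF lift(1)[OF that]] by simp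
    then have "\<Phi> (shift s) = ((height w (lift s) - d) + w) rmod real k"
      unfolding \<Phi>_def by (simp only: rm_per)
    also have "\<dots> = ((height w (lift s) - d) rmod real k + w) rmod real k"
      by (metis rmod_add rmod_rmod)
    finally show ?thesis by (simp add: \<Phi>_def)
  qed
  define M where "M = distr \<mu> borel \<Phi>"
  have M_unif: "M = uniform_measure lborel {0..<real k}"
  proof (rule rotation_uniquely_ergodic[of "real k" w])
    show "real k > 0" using k_pos by simp
    show "prob_space M" unfolding M_def by (rule \<mu>.prob_space_distr) simp
    have "\<Phi> s \<in> {0..<real k}" for s using k_pos by (simp add: \<Phi>_def rmod_less rmod_nonneg)
    then have "\<Phi> -` {0..<real k} = UNIV" by blast
    then show "measure M {0..<real k} = 1"
      unfolding M_def by (subst measure_distr) (simp_all add: \<mu>.prob_space)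
    have "distr M borel (\<lambda>x. (x + w) rmod real k) = distr \<mu> borel (\<lambda>s. (\<Phi> s + w) rmod real k)"
      unfolding M_def by (subst distr_distr) (simp_all add: comp_def)
    also have "\<dots> = distr \<mu> borel (\<lambda>s. \<Phi> (shift s))"
      by (rule distr_cong_AE) (use AEB \<Phi>_shift in \<open>auto elim!: eventually_mono\<close>)
    also have "\<dots> = distr (distr \<mu> borel shift) borel \<Phi>"
      by (subst distr_distr) (simp_all add: comp_def)
    finally show "distr M borel (\<lambda>x. (x + w) rmod real k) = M" by (simp add: m(3) M_def)
  qed (use irr in \<open>simp_all add: M_def\<close>)
  \<comment> \<open>The heights at which recovery may fail: countable, hence null for the uniform
    measure, and \<open>k\<close>-periodic, hence testable after reduction modulo
    \<open>k\<close>.\<close>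
  define D where "D = (\<lambda>(n, j). c j - real n * w) ` (UNIV :: (nat \<times> int) set)"
  have D_count: "countable D" unfolding D_def by (rule countable_image) simp
  have D_per: "x - real k * of_int i \<in> D" if x: "x \<in> D" for x i
  proof -
    obtain n j where "x = c j - real n * w" using x by (auto simp: D_def)
    then have "x - real k * of_int i = c (j + int k * - i) - real n * w"
      unfolding c_period_mult by simp
    then show ?thesis unfolding D_def by (intro rev_image_eqI[of "(n, j + int k * - i)"]) simp_all
  qed
  have D_null: "D \<in> null_sets lborel" using D_count by (rule countable_imp_null_set_lborel)
  then have D_borel [measurable]: "D \<in> sets borel" by (simp add: null_sets_def)
  have "emeasure M D = 0"
  proof -
    have "emeasure lborel ({0..<real k} \<inter> D) \<le> emeasure lborel D"
      by (rule emeasure_mono) simp_all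
    then have "emeasure lborel ({0..<real k} \<inter> D) = 0" using D_null by (simp add: null_sets_def)
    then show ?thesis unfolding M_unif by simp
  qed
  then have "emeasure \<mu> (\<Phi> -` D) = 0"
    unfolding M_def by (simp add: emeasure_distr sets_eq_imp_space_eq[OF m(1)])
  moreover have "\<Phi> -` D \<in> sets \<mu>" using measurable_sets_borel[OF \<Phi>_meas D_borel] by (simp add: m(1))
  ultimately have "\<Phi> -` D \<in> null_sets \<mu>" by (rule null_setsI)
  then have AED: "AE s in \<mu>. s \<notin> \<Phi> -` D" by (rule AE_not_in)
  have AE_eq: "AE s in \<mu>. s = symb k (itin c w (\<Phi> s))"
    using AEB AED
  proof eventually_elim
    case (elim s)
    define x where "x = height w (lift s) - d"
    have \<Phi>x: "\<Phi> s = x + real k * of_int (- \<lfloor>x / real k\<rfloor>)" unfolding \<Phi>_def rm x_def by simp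
    have "x + real n * w \<noteq> c j" for n j
    proof
      assume "x + real n * w = c j"
      then have "x \<in> D" unfolding D_def by (intro rev_image_eqI[of "(n, j)"]) simp_all
      then show False using D_per[of x "\<lfloor>x / real k\<rfloor>"] \<Phi>x elim(2) by simp
    qed
    then have "lift s = itin c w x" using h.eq_itin_height[OF lift(1)[OF elim(1)]] by (simp add: x_def)
    then have "s = symb k (itin c w x)" using lift(2)[OF elim(1)] by simp
    also have "\<dots> = symb k (itin c w (\<Phi> s))" unfolding \<Phi>x symb_itin_period ..
    finally show ?case .
  qed
  have "\<mu> = distr \<mu> borel (\<lambda>s. s)" by (rule distr_id2[symmetric]) (simp add: m(1))
  also have "\<dots> = distr \<mu> borel (\<lambda>s. symb k (itin c w (\<Phi> s)))"
    by (rule distr_cong_AE) (use AE_eq in simp_all)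
  also have "\<dots> = distr M borel (\<lambda>x. symb k (itin c w x))"
    unfolding M_def by (subst distr_distr) (simp_all add: comp_def)
  also have "\<dots> = L" unfolding L_def M_unif ..
  finally show ?thesis .
qed

end

section \<open>Rational rotation numbers\<close>

lemma finite_periodic_symseqs:
  assumes "n0 \<ge> 1"
  shows "finite {s :: symseq. (\<forall>n. s n \<in> {a..<b}) \<and> (shift ^^ n0) s = s}"
proof -
  have per: "s (i + j * n0) = s i" if "(shift ^^ n0) s = s" for s :: symseq and i j
  proof (induction j)
    case (Suc j)
    have "s (n0 + (i + j * n0)) = s (i + j * n0)"
      using fun_cong[OF that, of "i + j * n0"] by (simp add: funpow_shift)
    then show ?case using Suc by (simp add: algebra_simps)
  qed simp
  have "{s :: symseq. (\<forall>n. s n \<in> {a..<b}) \<and> (shift ^^ n0) s = s}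
      \<subseteq> (\<lambda>f n. f (n mod n0)) ` (PiE {..<n0} (\<lambda>_. {a..<b}))"
  proof
    fix s assume "s \<in> {s :: symseq. (\<forall>n. s n \<in> {a..<b}) \<and> (shift ^^ n0) s = s}"
    then have s: "\<And>n. s n \<in> {a..<b}" "(shift ^^ n0) s = s" by auto
    have "s = (\<lambda>n. restrict s {..<n0} (n mod n0))"
    proof
      fix n show "s n = restrict s {..<n0} (n mod n0)"
        using per[OF s(2), of "n mod n0" "n div n0"] assms by simp
    qed
    moreover have "restrict s {..<n0} \<in> PiE {..<n0} (\<lambda>_. {a..<b})"
      using s(1) by (intro restrict_PiE_iff[THEN iffD2]) blast
    ultimately show "s \<in> (\<lambda>f n. f (n mod n0)) ` (PiE {..<n0} (\<lambda>_. {a..<b}))" by blast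
  qed
  moreover have "finite (PiE {..<n0} (\<lambda>_. {a..<b}))" by (intro finite_PiE) auto
  ultimately show ?thesis using finite_subset by blast
qed

lemma periodic_agree_eq:
  fixes s t :: symseq
  assumes "n0 \<ge> 1" "(shift ^^ n0) s = s" "(shift ^^ n0) t = t" "agree n0 s t"
  shows "s = t"
proof
  fix n show "s n = t n"
  proof (induction n rule: less_induct)
    case (less n)
    show ?case
    proof (cases "n < n0")
      case True
      then show ?thesis using assms(4) by (simp add: agree_def)
    next
      case False
      then have n: "n = n0 + (n - n0)" "n - n0 < n" using assms(1) by auto
      have "s n = s (n - n0)" "t n = t (n - n0)"
        using fun_cong[OF assms(2), of "n - n0"] fun_cong[OF assms(3), of "n - n0"] n(1)
        by (simp_all add: funpow_shift)
      then show ?thesis using less[OF n(2)] by simp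
    qed
  qed
qed

lemma finite_symseq_closed: "finite (S :: symseq set) \<Longrightarrow> closed S"
  by (intro symseq_compact_imp_closed finite_imp_compact)

lemma finite_symseq_borel: "finite (S :: symseq set) \<Longrightarrow> S \<in> sets borel"
  by (intro borel_closed finite_symseq_closed)

lemma funpow_shift_mult:
  assumes "(shift ^^ n0) s = s"
  shows "(shift ^^ (n0 * i)) s = s"
  using assms by (induction i) (simp_all add: funpow_add)

section \<open>Cut systems with rational rotation number\<close>

locale rational_cut_system = cut_system +
  fixes n0 :: nat and m0 :: int
  assumes n0_pos: "n0 \<ge> 1" and n0_w: "real n0 * w = real k * of_int m0"
begin

lemma itin_periodic: "(shift ^^ n0) (itin c w x) = translate (int k * m0) (itin c w x)"
  unfolding funpow_shift_itin n0_w itin_period ..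

lemma symb_itin_periodic: "(shift ^^ n0) (symb k (itin c w x)) = symb k (itin c w x)"
  unfolding symb_funpow_shift[symmetric] itin_periodic by simp

text \<open>All coded itineraries have the common period \<open>n0\<close> over a finite alphabet,
  so there are finitely many and the closure adds nothing.\<close>

lemma B_range: "B = range (\<lambda>x. symb k (itin c w x))" and finite_B: "finite B"
proof -
  have "range (\<lambda>x. symb k (itin c w x)) \<subseteq> {s. (\<forall>n. s n \<in> {0..<2 * int k}) \<and> (shift ^^ n0) s = s}"
    using symb_range[OF k_pos] symb_itin_periodic by blast
  then have fin: "finite (range (\<lambda>x. symb k (itin c w x)))"
    using finite_periodic_symseqs[OF n0_pos] finite_subset by blast
  then show "B = range (\<lambda>x. symb k (itin c w x))"
    unfolding B_def by (intro closure_closed finite_symseq_closed)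
  then show "finite B" using fin by simp
qed

lemma B_periodic: "s \<in> B \<Longrightarrow> (shift ^^ n0) s = s"
  unfolding B_range using symb_itin_periodic by blast

lemma B_recurrent: "recurrent_set shift B"
proof (rule recurrent_setI)
  fix s N assume "s \<in> B"
  then have "(shift ^^ (n0 * N)) s = s" by (intro funpow_shift_mult B_periodic)
  moreover have "n0 * N \<ge> N" using n0_pos by simp
  ultimately show "\<exists>n\<ge>N. agree N s ((shift ^^ n) s)" by (metis agree_refl)
qed

text \<open>The first \<open>n0\<close> symbols determine a periodic sequence, so right-constancy of
  one window gives a whole interval of parameters with the same sequence.\<close>

lemma measure_L_pos:
  assumes "s \<in> B"
  shows "0 < measure L {s}"
proof -
  obtain x where x: "s = symb k (itin c w x)" using assms B_range by blast
  obtain e where e: "e > 0" "\<And>y. x \<le> y \<Longrightarrow> y < x + e \<Longrightarrow> agree (Suc n0) (itin c w x) (itin c w y)"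
    using itin_right_const[of x "Suc n0"] by blast
  define d where "d = min e (real k)"
  have d: "0 < d" "d \<le> real k" "d \<le> e" using e(1) k_pos by (auto simp: d_def)
  have "d / real k \<le> measure L {s}"
  proof (rule L_singleton_ge)
    fix y assume "x \<le> y" "y < x + d"
    then have "agree n0 s (symb k (itin c w y))" unfolding x using e(2) d(3) by (intro symb_agree) simp
    then show "symb k (itin c w y) = s"
      using periodic_agree_eq[OF n0_pos, of s "symb k (itin c w y)"] symb_itin_periodic x by simp
  qed (use d in auto)
  moreover have "0 < d / real k" using d k_pos by simp
  ultimately show ?thesis by linarith
qed

definition orbit :: "symseq \<Rightarrow> symseq set" where
  "orbit s = range (\<lambda>i. (shift ^^ i) s)"

lemma orbit_subset_B: "s \<in> B \<Longrightarrow> orbit s \<subseteq> B"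
proof -
  assume s: "s \<in> B"
  have "(shift ^^ i) s \<in> B" for i by (induction i) (use s B_shift in auto)
  then show ?thesis by (auto simp: orbit_def)
qed

lemma orbit_eq:
  assumes "s \<in> B" "t \<in> orbit s"
  shows "orbit t = orbit s"
proof -
  obtain i where t: "t = (shift ^^ i) s" using assms(2) by (auto simp: orbit_def)
  have per: "(shift ^^ n0) s = s" using assms(1) by (rule B_periodic)
  show ?thesis
  proof (intro subset_antisym subsetI)
    fix r assume "r \<in> orbit t"
    then obtain j where "r = (shift ^^ j) t" by (auto simp: orbit_def)
    then have "r = (shift ^^ (j + i)) s" by (simp add: t funpow_add)
    then show "r \<in> orbit s" by (auto simp: orbit_def)
  next
    fix r assume "r \<in> orbit s"
    then obtain j where r: "r = (shift ^^ j) s" by (auto simp: orbit_def)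
    have "n0 * i \<ge> i" using n0_pos by simp
    then have eq: "j + (n0 * i - i) + i = j + n0 * i" by linarith
    have "(shift ^^ (j + (n0 * i - i))) t = (shift ^^ (j + n0 * i)) s"
      unfolding t eq[symmetric] by (subst funpow_add[of "j + (n0 * i - i)" i]) simp
    also have "\<dots> = r" by (simp add: funpow_add funpow_shift_mult[OF per] r)
    finally show "r \<in> orbit t" unfolding orbit_def by (metis rangeI)
  qed
qed

lemma self_in_orbit: "s \<in> orbit s"
  unfolding orbit_def by (rule range_eqI[of _ _ 0]) simp

lemma shift_in_orbit_iff:
  assumes "s \<in> B" "t \<in> B"
  shows "shift t \<in> orbit s \<longleftrightarrow> t \<in> orbit s"
proof -
  have "shift t \<in> orbit t" unfolding orbit_def by (rule range_eqI[of _ _ 1]) simp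
  then have "orbit (shift t) = orbit t" using orbit_eq[OF assms(2)] by blast
  then show ?thesis using orbit_eq[OF assms(1)] self_in_orbit by metis
qed

text \<open>The measure on a single orbit is obtained by conditioning \<open>L\<close> on it;
  \<open>measure_L_pos\<close> makes this legitimate.\<close>

lemma uniform_orbit_measure:
  assumes "s \<in> B"
  shows "uniform_measure L (orbit s) \<in> inv_prob_measures shift (orbit s)"
proof -
  interpret Lp: prob_space L by (rule prob_space_L)
  define P where "P = orbit s"
  have P: "P \<subseteq> B" "finite P" using orbit_subset_B[OF assms] finite_B finite_subset by (auto simp: P_def)
  then have Pm: "P \<in> sets borel" by (intro finite_symseq_borel)
  have "measure L {s} \<le> measure L P"
    using self_in_orbit Pm by (intro Lp.finite_measure_mono) (auto simp: P_def)
  then have pos: "measure L P > 0" using measure_L_pos[OF assms] by linarith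
  then have em: "emeasure L P \<noteq> 0" "emeasure L P \<noteq> \<infinity>"
    by (simp_all add: Lp.emeasure_eq_measure)
  define U where "U = uniform_measure L P"
  have sets_U: "sets U = sets borel" by (simp add: U_def)
  have sp_U: "space U = UNIV" using sets_eq_imp_space_eq[OF sets_U] by simp
  have sh_U: "shift \<in> measurable U borel"
    unfolding measurable_cong_sets[OF sets_U refl] by (rule measurable_shift)
  have "distr U borel shift = U"
  proof (rule measure_eqI)
    fix A assume "A \<in> sets (distr U borel shift)"
    then have A: "A \<in> sets borel" by simp
    have sA: "shift -` A \<in> sets borel" using measurable_sets_borel[OF measurable_shift A] .
    have sPA: "shift -` (P \<inter> A) \<in> sets borel"
      using measurable_sets_borel[OF measurable_shift, of "P \<inter> A"] A Pm by blast
    have "emeasure (distr U borel shift) A = emeasure U (shift -` A)"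
      using A sh_U by (subst emeasure_distr) (simp_all add: sp_U)
    also have "\<dots> = emeasure L (P \<inter> shift -` A) / emeasure L P"
      unfolding U_def using Pm sA by (intro emeasure_uniform_measure) simp_all
    \<comment> \<open>Outside \<open>B\<close> a point may enter the orbit from elsewhere, so the
      two sets agree only up to an \<open>L\<close>-null set.\<close>
    also have "emeasure L (P \<inter> shift -` A) = emeasure L (shift -` (P \<inter> A))"
    proof (rule emeasure_eq_AE)
      show "AE t in L. (t \<in> P \<inter> shift -` A) = (t \<in> shift -` (P \<inter> A))"
        using AE_L_B by eventually_elim (use shift_in_orbit_iff[OF assms] in \<open>auto simp: P_def\<close>)
    qed (use Pm sA sPA in auto)
    also have "\<dots> = emeasure (distr L borel shift) (P \<inter> A)"
      using Pm A by (subst emeasure_distr) (auto simp: L_def)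
    also have "\<dots> = emeasure L (P \<inter> A)" by (simp add: distr_shift_L)
    also have "\<dots> / emeasure L P = emeasure U A"
      unfolding U_def using Pm A by (intro emeasure_uniform_measure[symmetric]) simp_all
    finally show "emeasure (distr U borel shift) A = emeasure U A" .
  qed (simp add: U_def)
  moreover have "measure U P = 1"
    unfolding U_def using em Pm pos by (subst measure_uniform_measure) simp_all
  ultimately show ?thesis
    using prob_space_uniform_measure[OF em] by (simp add: inv_prob_measures_def U_def P_def)
qed

text \<open>Orbits partition \<open>B\<close>, which carries \<open>L\<close>, so the coefficients
  of the convex combination are the masses of the orbits.\<close>

lemma L_orbit_decomposition:
  assumes "A \<in> sets borel"
  shows "measure L A = (\<Sum>P\<in>orbit ` B. measure L P * measure (uniform_measure L P) A)"
proof -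
  interpret Lp: prob_space L by (rule prob_space_L)
  have Pm: "P \<in> sets borel" if "P \<in> orbit ` B" for P
    using that orbit_subset_B finite_B finite_subset finite_symseq_borel by blast
  have dis: "disjoint_family_on (\<lambda>P. P \<inter> A) (orbit ` B)"
    unfolding disjoint_family_on_def
  proof (intro ballI impI)
    fix P Q assume PQ: "P \<in> orbit ` B" "Q \<in> orbit ` B" "P \<noteq> Q"
    have "r \<notin> Q" if "r \<in> P" for r
      using that PQ orbit_eq by blast
    then show "(P \<inter> A) \<inter> (Q \<inter> A) = {}" by blast
  qed
  have "measure L A = measure L (\<Union>P\<in>orbit ` B. P \<inter> A)"
  proof (rule Lp.finite_measure_eq_AE)
    show "AE t in L. (t \<in> A) = (t \<in> (\<Union>P\<in>orbit ` B. P \<inter> A))"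
      using AE_L_B by eventually_elim (use self_in_orbit in auto)
    show "(\<Union>P\<in>orbit ` B. P \<inter> A) \<in> sets L"
      using Pm assms finite_B by (intro sets.finite_UN) auto
  qed (use assms in simp)
  also have "\<dots> = (\<Sum>P\<in>orbit ` B. measure L (P \<inter> A))"
    using Pm assms finite_B dis by (intro Lp.finite_measure_finite_Union) auto
  also have "\<dots> = (\<Sum>P\<in>orbit ` B. measure L P * measure (uniform_measure L P) A)"
  proof (rule sum.cong)
    fix P assume P: "P \<in> orbit ` B"
    show "measure L (P \<inter> A) = measure L P * measure (uniform_measure L P) A"
    proof (cases "measure L P = 0")
      case True
      have "measure L (P \<inter> A) \<le> measure L P" using Pm[OF P] assms by (intro Lp.finite_measure_mono) auto
      then show ?thesis using True by (simp add: measure_le_0_iff)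
    next
      case False
      then have em: "emeasure L P \<noteq> 0" "emeasure L P \<noteq> \<infinity>"
        by (simp_all add: Lp.emeasure_eq_measure)
      show ?thesis using False em assms by (subst measure_uniform_measure) simp_all
    qed
  qed simp
  finally show ?thesis .
qed

text \<open>An earlier return lifts to a translation by a multiple of \<open>k\<close>, and the
  displacement bound converts this into an arithmetic relation excluded by the hypothesis.\<close>

lemma orbit_periodic:
  assumes "s \<in> B" "\<And>m i. 0 < m \<Longrightarrow> m < n0 \<Longrightarrow> real m * w \<noteq> real k * of_int i"
  shows "periodic_orbit shift n0 (orbit s)"
  unfolding periodic_orbit_def
proof (intro conjI exI[of _ s] allI impI)
  show "0 < n0" using n0_pos by simp
  show "(shift ^^ n0) s = s" using assms(1) by (rule B_periodic)
  show "orbit s = range (\<lambda>i. (shift ^^ i) s)" by (simp add: orbit_def)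
  fix m assume m: "0 < m \<and> m < n0"
  obtain x where x: "s = symb k (itin c w x)" using assms(1) B_range by blast
  show "(shift ^^ m) s \<noteq> s"
  proof
    assume "(shift ^^ m) s = s"
    then have "symb k (itin c w x) = symb k ((shift ^^ m) (itin c w x))"
      by (simp add: x symb_funpow_shift)
    then obtain i where "(shift ^^ m) (itin c w x) = translate (int k * i) (itin c w x)"
      using symb_eq_iff[OF k_pos stair_itin stair_funpow_shift[OF stair_itin]] by blast
    from return_displacement[OF itin_displacement this]
    have "real m * w = real k * of_int i" by simp
    then show False using assms(2) m by blast
  qed
qed

end

text \<open>With \<open>g u = translate (- k m0) (shift^n0 u)\<close>, a return \<open>v = translate (k m) (shift^n u)\<close> close to \<open>u\<close>
  is either an iterate of \<open>g\<close> or separated from \<open>u\<close> in height, so that \<open>g u\<close> (or \<open>g v\<close>) lies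
  on the wrong side of \<open>u\<close> unless \<open>g u = u\<close>.\<close>

lemma (in height_system) recurrent_imp_periodic:
  assumes n0: "n0 \<ge> 1" "real n0 * w = real k * of_int m0"
    and least: "\<And>m i. 0 < m \<Longrightarrow> m < n0 \<Longrightarrow> real m * w \<noteq> real k * of_int i"
    and u: "u \<in> W" and rec: "\<And>N. \<exists>n\<ge>1. agree N (symb k u) ((shift ^^ n) (symb k u))"
  shows "(shift ^^ n0) u = translate (int k * m0) u"
proof (rule ccontr)
  assume ne: "(shift ^^ n0) u \<noteq> translate (int k * m0) u"
  define g where "g v = translate (int k * (- m0)) ((shift ^^ n0) v)" for v
  have g: "g v n = v (n0 + n) - int k * m0" for v n by (simp add: g_def seq_apply)
  have gW: "g v \<in> W" if "v \<in> W" for v unfolding g_def by (intro W_trans W_funpow_shift that)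
  have g\<phi>: "\<phi> (g v) = \<phi> v" if "v \<in> W" for v
    unfolding g_def using \<phi>_trans[OF W_funpow_shift[OF that], of "- m0" n0] \<phi>_funpow_shift[OF that, of n0] n0(2)
    by simp
  have "g u \<noteq> u"
  proof
    assume "g u = u"
    have "(shift ^^ n0) u = translate (int k * m0) u"
    proof
      fix n show "(shift ^^ n0) u n = translate (int k * m0) u n"
        using g[of u n] \<open>g u = u\<close> by (simp add: seq_apply)
    qed
    then show False using ne by simp
  qed
  then obtain i where i: "g u i \<noteq> u i" by auto
  have g_mono: "g a \<le> g b" if "a \<le> b" for a b
    using that by (auto simp: le_fun_def g)
  \<comment> \<open>The window reaches \<open>n0 + i\<close>, the coordinate that \<open>g\<close>
    reads at \<open>i\<close>; hence both \<open>v\<close> and \<open>g v\<close> match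
    \<open>u\<close> and \<open>g u\<close> at \<open>i\<close>.\<close>
  obtain n where n: "n \<ge> 1" "agree (Suc (n0 + i)) (symb k u) ((shift ^^ n) (symb k u))" using rec by blast
  have "agree (Suc (n0 + i)) (symb k ((shift ^^ n) u)) (symb k u)"
    unfolding symb_funpow_shift by (rule agree_sym[OF n(2)])
  then obtain m where m: "agree (Suc (n0 + i)) (translate (int k * m) ((shift ^^ n) u)) u"
    using symb_agreeD[OF k_pos W_stair[OF W_funpow_shift[OF u]] W_stair[OF u]] by blast
  define v where "v = translate (int k * m) ((shift ^^ n) u)"
  have v: "v \<in> W" unfolding v_def by (intro W_trans W_funpow_shift u)
  have vi: "v i = u i" and gvi: "g v i = g u i" using m by (simp_all add: v_def[symmetric] agree_def g)
  have \<phi>v: "\<phi> v = \<phi> u + (real n * w + real k * of_int m)"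
    unfolding v_def using \<phi>_trans[OF W_funpow_shift[OF u], of m n] \<phi>_funpow_shift[OF u, of n] by simp
  consider "\<phi> v < \<phi> u" | "\<phi> u < \<phi> v" | "\<phi> v = \<phi> u" by linarith
  then show False
  proof cases
    case 1
    \<comment> \<open>As \<open>g\<close> preserves heights, both comparisons are strict in height.
      At \<open>i\<close> they bound \<open>g u i\<close> by \<open>u i\<close> from below and from
      above.\<close>
    have "v \<le> g u" "g v \<le> u" using 1 g\<phi>[OF u] g\<phi>[OF v] by (intro \<phi>_less_imp_le u v gW; simp)+
    then have "v i \<le> g u i" "g v i \<le> u i" by (simp_all add: le_fun_def)
    then show False using i vi gvi by simp
  next
    case 2
    have "g u \<le> v" "u \<le> g v" using 2 g\<phi>[OF u] g\<phi>[OF v] by (intro \<phi>_less_imp_le u v gW; simp)+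
    then have "g u i \<le> v i" "u i \<le> g v i" by (simp_all add: le_fun_def)
    then show False using i vi gvi by simp
  next
    case 3
    \<comment> \<open>Equal heights make \<open>n * w\<close> a multiple of \<open>k\<close>, so
      \<open>n\<close> is a multiple of \<open>n0\<close> by leastness and \<open>v\<close> is an
      iterate of \<open>u\<close> under the monotone \<open>g\<close>. Such iterates move in one
      direction and cannot return to \<open>u i\<close> after leaving it.\<close>
    then have nw: "real n * w = real k * of_int (- m)" using \<phi>v by simp
    define a r where "a = n div n0" and "r = n mod n0"
    have ar: "n = n0 * a + r" by (simp add: a_def r_def)
    have r0: "r = 0"
    proof (rule ccontr)
      assume "r \<noteq> 0"
      have "real r * w = real n * w - real a * (real n0 * w)" by (simp add: ar algebra_simps)
      also have "\<dots> = real k * of_int (- m - int a * m0)" unfolding nw n0(2) by (simp add: algebra_simps)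
      finally have "real r * w = real k * of_int (- m - int a * m0)" .
      moreover have "0 < r" "r < n0" using \<open>r \<noteq> 0\<close> n0(1) by (simp_all add: r_def)
      ultimately show False using least[of r "- m - int a * m0"] by blast
    qed
    then have na: "n = n0 * a" using ar by simp
    then have "a \<ge> 1" using n(1) by (cases a) auto
    have "real a * (real n0 * w) = real k * of_int (- m)" using nw na by (simp add: mult_ac)
    then have "real k * of_int (int a * m0) = real k * of_int (- m)" unfolding n0(2) by (simp add: mult_ac)
    then have ma: "m = - (int a * m0)" using k_pos by (simp del: of_int_mult of_int_minus)
    have iter: "(g ^^ b) u j = u (n0 * b + j) - int k * (int b * m0)" for b j
    proof (induction b arbitrary: j)
      case (Suc b)
      show ?case using Suc by (simp add: g algebra_simps)
    qed simp
    have gv: "(g ^^ a) u = v"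
    proof
      fix j show "(g ^^ a) u j = v j" unfolding iter v_def ma na by (simp add: seq_apply algebra_simps)
    qed
    have up: "u \<le> g u \<Longrightarrow> g u \<le> (g ^^ Suc b) u" for b
    proof (induction b)
      case (Suc b)
      have "u \<le> (g ^^ Suc b) u" using Suc by (meson order_trans)
      then show ?case using g_mono[of u "(g ^^ Suc b) u"] by simp
    qed simp
    have dn: "g u \<le> u \<Longrightarrow> (g ^^ Suc b) u \<le> g u" for b
    proof (induction b)
      case (Suc b)
      have "(g ^^ Suc b) u \<le> u" using Suc by (meson order_trans)
      then show ?case using g_mono[of "(g ^^ Suc b) u" u] by simp
    qed simp
    obtain b where b: "a = Suc b" using \<open>a \<ge> 1\<close> by (cases a) auto
    have "u \<le> g u \<or> g u \<le> u" by (rule le_chainD[OF W_chain u gW[OF u]])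
    then show False
    proof
      assume le: "u \<le> g u"
      then have "g u \<le> v" using up[of b] gv b by simp
      then show False using le i vi by (auto simp: le_fun_def dest!: spec[of _ i])
    next
      assume le: "g u \<le> u"
      then have "v \<le> g u" using dn[of b] gv b by simp
      then show False using le i vi by (auto simp: le_fun_def dest!: spec[of _ i])
    qed
  qed
qed

section \<open>Weighted counts on finite periodic chains\<close>

lemma int_threshold:
  fixes P :: "int \<Rightarrow> bool"
  assumes up: "\<And>i j. P i \<Longrightarrow> i \<le> j \<Longrightarrow> P j" and "P a" "\<not> P b"
  shows "\<exists>M. \<forall>m. P m \<longleftrightarrow> M \<le> m"
proof -
  define n where "n = (LEAST n. P (b + int n))"
  have "b < a" using up[of a b] assms(2,3) by force
  then have ex: "\<exists>n. P (b + int n)" using assms(2) by (intro exI[of _ "nat (a - b)"]) simp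
  then have Pn: "P (b + int n)" unfolding n_def by (rule LeastI_ex)
  have "P m \<longleftrightarrow> b + int n \<le> m" for m
  proof
    assume "P m"
    then have "b < m" using up[of m b] assms(3) by force
    then have "P (b + int (nat (m - b)))" using \<open>P m\<close> by simp
    then have "n \<le> nat (m - b)" unfolding n_def by (rule Least_le)
    then show "b + int n \<le> m" using \<open>b < m\<close> by simp
  qed (use up Pn in blast)
  then show ?thesis by blast
qed

text \<open>For a finite chain of periodic sequences the weighted count of the lifts below \<open>t\<close> is a
  strictly increasing height function.\<close>

locale periodic_chain =
  fixes k :: nat and Z :: "symseq set" and n0 :: nat and m0 :: int and w :: real and wt :: "symseq \<Rightarrow> real"
  assumes k_pos: "k \<ge> 1" and fin: "finite Z" and ne: "Z \<noteq> {}" and sub: "Z \<subseteq> symb k ` Collect stair"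
    and inv: "shift ` Z = Z" and chain: "le_chain (Wof k Z)"
    and n0_pos: "n0 \<ge> 1" and w_nonneg: "0 \<le> w" and n0_w: "real n0 * w = real k * of_int m0"
    and per: "u \<in> Wof k Z \<Longrightarrow> (shift ^^ n0) u = translate (int k * m0) u"
    and wt_pos: "s \<in> Z \<Longrightarrow> 0 < wt s" and wt_inv: "s \<in> Z \<Longrightarrow> wt (shift s) = wt s"
    and wt_sum: "(\<Sum>s\<in>Z. wt s) = real k"
begin

lemma lift_Z: "s \<in> Z \<Longrightarrow> lift s \<in> Wof k Z" "s \<in> Z \<Longrightarrow> symb k (lift s) = s"
  using lift_in_Wof[OF k_pos sub] by auto

lemma shift_W: "u \<in> Wof k Z \<Longrightarrow> shift u \<in> Wof k Z"
  using Wof_shift inv by blast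

text \<open>Periodicity recovers the coordinate dropped by the shift, so the shift is an order
  isomorphism on the lifts.\<close>

lemma shift_le_iff:
  assumes "u \<in> Wof k Z" "v \<in> Wof k Z"
  shows "shift u \<le> shift v \<longleftrightarrow> u \<le> v"
proof
  show "u \<le> v \<Longrightarrow> shift u \<le> shift v" by (simp add: le_fun_def shift_apply)
  assume le: "shift u \<le> shift v"
  show "u \<le> v"
  proof (rule le_funI)
    fix n
    have "n0 + n = Suc (n0 - 1 + n)" using n0_pos by simp
    then have "u (n0 + n) \<le> v (n0 + n)" using le_funD[OF le, of "n0 - 1 + n"] by (simp add: shift_apply)
    then show "u n \<le> v n"
      using fun_cong[OF per[OF assms(1)], of n] fun_cong[OF per[OF assms(2)], of n] by (simp add: seq_apply)
  qed
qed

text \<open>The index of the first lift of \<open>s\<close> at or above \<open>t\<close>: up to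
  normalisation, the signed number of lifts of \<open>s\<close> not above \<open>t\<close>,
  excluding \<open>t\<close> itself.\<close>

definition cnt :: "symseq \<Rightarrow> symseq \<Rightarrow> int" where
  "cnt s t = (SOME M. \<forall>m. t \<le> translate (int k * m) (lift s) \<longleftrightarrow> M \<le> m)"

lemma cnt_iff:
  assumes "s \<in> Z" "t \<in> Wof k Z"
  shows "t \<le> translate (int k * m) (lift s) \<longleftrightarrow> cnt s t \<le> m"
proof -
  define v where "v = lift s"
  have v: "v \<in> Wof k Z" using lift_Z(1)[OF assms(1)] by (simp add: v_def)
  have "\<exists>M. \<forall>m. t \<le> translate (int k * m) v \<longleftrightarrow> M \<le> m"
  proof (rule int_threshold)
    fix i j :: int assume "t \<le> translate (int k * i) v" "i \<le> j"
    moreover have "int k * i \<le> int k * j" using \<open>i \<le> j\<close> by (simp add: mult_left_mono)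
    ultimately show "t \<le> translate (int k * j) v"
      unfolding le_fun_def translate_apply by (meson add_left_mono order_trans)
  next
    define a where "a = \<bar>t 0\<bar> + \<bar>v 0\<bar> + 1"
    have a: "a \<le> int k * a" using k_pos mult_right_mono[of 1 "int k" a] by (simp add: a_def)
    have b: "t 0 < v 0 + a" "v 0 - a < t 0" by (simp_all add: a_def)
    have "t 0 < translate (int k * a) v 0" unfolding translate_apply using a b by linarith
    then show "t \<le> translate (int k * a) v" by (rule le_chain_less_at[OF chain assms(2) Wof_trans[OF v]])
    have "translate (int k * (- a)) v 0 < t 0" unfolding translate_apply mult_minus_right using a b by linarith
    then show "\<not> t \<le> translate (int k * (- a)) v" by (auto simp: le_fun_def not_le)
  qed
  from someI_ex[OF this] show ?thesis unfolding cnt_def v_def by blast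
qed

lemma cnt_eqI: "s \<in> Z \<Longrightarrow> t \<in> Wof k Z \<Longrightarrow> (\<And>m. t \<le> translate (int k * m) (lift s) \<longleftrightarrow> M \<le> m) \<Longrightarrow> cnt s t = M"
  using cnt_iff[of s t "cnt s t"] cnt_iff[of s t M] by force

lemma cnt_trans:
  assumes "s \<in> Z" "t \<in> Wof k Z"
  shows "cnt s (translate (int k * i) t) = cnt s t + i"
proof (rule cnt_eqI[OF assms(1) Wof_trans[OF assms(2)]])
  fix m
  have "translate (int k * i) t \<le> translate (int k * m) (lift s) \<longleftrightarrow> t \<le> translate (int k * (m - i)) (lift s)"
    by (simp add: le_fun_def translate_apply algebra_simps)
  then show "translate (int k * i) t \<le> translate (int k * m) (lift s) \<longleftrightarrow> cnt s t + i \<le> m"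
    unfolding cnt_iff[OF assms] by linarith
qed

lemma cnt_mono:
  assumes "s \<in> Z" "t \<in> Wof k Z" "t' \<in> Wof k Z" "t \<le> t'"
  shows "cnt s t \<le> cnt s t'"
  using cnt_iff[OF assms(1,2), of "cnt s t'"] cnt_iff[OF assms(1,3), of "cnt s t'"] assms(4) order_trans by auto

text \<open>\<open>t\<close> is itself a lift of \<open>symb k t\<close>, and it is passed in moving
  from \<open>t\<close> to \<open>t'\<close>.\<close>

lemma cnt_strict:
  assumes "t \<in> Wof k Z" "t' \<in> Wof k Z" "t \<le> t'" "t \<noteq> t'"
  shows "cnt (symb k t) t + 1 \<le> cnt (symb k t) t'"
proof -
  have s: "symb k t \<in> Z" "stair t" using assms(1) by (simp_all add: Wof_def)
  obtain i where i: "t = translate (int k * i) (lift (symb k t))"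
    using symb_eq_iff[OF k_pos stair_lift_sym[OF k_pos s(2)] s(2)] symb_lift_sym[OF k_pos s(2)] by blast
  have "cnt (symb k t) t = i"
  proof (rule cnt_eqI[OF s(1) assms(1)])
    fix m
    have "t \<le> translate (int k * m) (lift (symb k t)) \<longleftrightarrow> int k * i \<le> int k * m"
      by (subst i) (simp add: le_fun_def translate_apply)
    then show "t \<le> translate (int k * m) (lift (symb k t)) \<longleftrightarrow> i \<le> m" using k_pos by simp
  qed
  moreover have "\<not> cnt (symb k t) t' \<le> i"
    unfolding cnt_iff[OF s(1) assms(2), symmetric] i[symmetric] using assms(3,4) by force
  ultimately show ?thesis by linarith
qed

text \<open>The shift carries the lifts of \<open>s\<close> to those of \<open>shift s\<close> in
  order. The two families are numbered from different normalised lifts, which accounts for an offset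
  that does not depend on \<open>t\<close>.\<close>

lemma cnt_shift:
  assumes "s \<in> Z"
  shows "\<exists>d. \<forall>t\<in>Wof k Z. cnt (shift s) (shift t) = cnt s t + d"
proof -
  have ss: "shift s \<in> Z" using inv assms by blast
  obtain i where i: "lift (shift s) = translate (int k * i) (shift (lift s))"
    using lift_shift[OF k_pos sub assms ss] by blast
  have "cnt (shift s) (shift t) = cnt s t + (- i)" if t: "t \<in> Wof k Z" for t
  proof (rule cnt_eqI[OF ss shift_W[OF t]])
    fix m
    have "translate (int k * m) (lift (shift s)) = shift (translate (int k * (m + i)) (lift s))"
      unfolding i shift_trans by (simp add: algebra_simps)
    then have "shift t \<le> translate (int k * m) (lift (shift s)) \<longleftrightarrow> t \<le> translate (int k * (m + i)) (lift s)"
      using shift_le_iff[OF t Wof_trans[OF lift_Z(1)[OF assms]]] by simp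
    then show "shift t \<le> translate (int k * m) (lift (shift s)) \<longleftrightarrow> cnt s t + - i \<le> m"
      unfolding cnt_iff[OF assms t] by linarith
  qed
  then show ?thesis by blast
qed

definition F :: "symseq \<Rightarrow> real" where
  "F t = (\<Sum>s\<in>Z. wt s * of_int (cnt s t))"

lemma F_trans: "t \<in> Wof k Z \<Longrightarrow> F (translate (int k * i) t) = F t + real k * of_int i"
  unfolding wt_sum[symmetric] F_def by (simp add: cnt_trans distrib_left sum.distrib sum_distrib_right)

lemma F_mono: "t \<in> Wof k Z \<Longrightarrow> t' \<in> Wof k Z \<Longrightarrow> t \<le> t' \<Longrightarrow> F t \<le> F t'"
  unfolding F_def using wt_pos by (intro sum_mono mult_left_mono) (auto simp: cnt_mono less_imp_le)

text \<open>Passing \<open>t\<close> increases its own count by at least 1, so the height jumps by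
  at least the weight of \<open>t\<close>. This jump is the length reserved for its
  interval.\<close>

lemma F_strict:
  assumes "t \<in> Wof k Z" "t' \<in> Wof k Z" "t \<le> t'" "t \<noteq> t'"
  shows "F t + wt (symb k t) \<le> F t'"
proof -
  have s: "symb k t \<in> Z" using assms(1) by (simp add: Wof_def)
  have "F t + wt (symb k t) = (\<Sum>r\<in>Z. wt r * of_int (cnt r t) + (if r = symb k t then wt r else 0))"
    unfolding F_def using s fin by (simp add: sum.distrib)
  also have "\<dots> \<le> F t'" unfolding F_def
  proof (rule sum_mono)
    fix r assume r: "r \<in> Z"
    show "wt r * of_int (cnt r t) + (if r = symb k t then wt r else 0) \<le> wt r * of_int (cnt r t')"
    proof (cases "r = symb k t")
      case True
      then have "real_of_int (cnt r t) + 1 \<le> real_of_int (cnt r t')"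
        using cnt_strict[OF assms] by simp
      then have "wt r * (real_of_int (cnt r t) + 1) \<le> wt r * of_int (cnt r t')"
        using wt_pos[OF r] by (intro mult_left_mono) simp_all
      then show ?thesis using True by (simp add: distrib_left)
    next
      case False
      then show ?thesis
        using cnt_mono[OF r assms(1-3)] wt_pos[OF r] by (simp add: mult_left_mono)
    qed
  qed
  finally show ?thesis .
qed

text \<open>Reindexing the finite sum along the shift collects all offsets into one constant. Its
  value is identified after \<open>n0\<close> steps, where the shift has become a known
  translation.\<close>

lemma F_shift: "t \<in> Wof k Z \<Longrightarrow> F (shift t) = F t + w"
proof -
  obtain d where d: "\<And>s t. s \<in> Z \<Longrightarrow> t \<in> Wof k Z \<Longrightarrow> cnt (shift s) (shift t) = cnt s t + d s"
    using cnt_shift by metis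
  have bij: "bij_betw shift Z Z"
    using fin inv by (simp add: bij_betw_def eq_card_imp_inj_on)
  define \<kappa> where "\<kappa> = (\<Sum>s\<in>Z. wt s * of_int (d s))"
  have step: "F (shift t) = F t + \<kappa>" if t: "t \<in> Wof k Z" for t
  proof -
    have "F (shift t) = (\<Sum>s\<in>Z. wt (shift s) * of_int (cnt (shift s) (shift t)))"
      unfolding F_def by (rule sum.reindex_bij_betw[OF bij, symmetric])
    also have "\<dots> = F t + \<kappa>"
      unfolding F_def \<kappa>_def sum.distrib[symmetric]
      by (rule sum.cong) (simp_all add: wt_inv d t distrib_left)
    finally show ?thesis .
  qed
  assume t: "t \<in> Wof k Z"
  have Fn: "F ((shift ^^ n) t) = F t + real n * \<kappa>" for n
  proof (induction n)
    case (Suc n)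
    have "(shift ^^ n) t \<in> Wof k Z" using Wof_funpow_shift inv t by blast
    then show ?case using step Suc by (simp add: algebra_simps)
  qed simp
  have "real n0 * \<kappa> = real n0 * w" using Fn[of n0] unfolding per[OF t] F_trans[OF t] n0_w by simp
  then have "\<kappa> = w" using n0_pos by simp
  then show "F (shift t) = F t + w" using step[OF t] by simp
qed

sublocale height_system k w "Wof k Z" F
proof
  show "Wof k Z \<noteq> {}" using lift_Z(1) ne by blast
  show "\<exists>v\<in>Wof k Z. shift v = u" if "u \<in> Wof k Z" for u
    using Wof_shift_onto[OF k_pos sub _ that] inv by blast
qed (use k_pos w_nonneg chain Wof_trans shift_W F_shift F_trans F_mono in \<open>auto simp: Wof_def\<close>)

text \<open>Everything starting above level \<open>u n\<close> at time \<open>n\<close> is higher by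
  at least a jump, so no cut interrupts the interval. Invariance of the weights keeps its length
  along the orbit.\<close>

lemma itin_cut:
  assumes u: "u \<in> Wof k Z" and x: "F u \<le> x" "x < F u + wt (symb k u)"
  shows "itin cut w x = u"
proof
  fix n
  define t where "t = (shift ^^ n) u"
  have t: "t \<in> Wof k Z" unfolding t_def by (rule W_funpow_shift[OF u])
  have Ft: "F t = F u + real n * w" unfolding t_def by (rule \<phi>_funpow_shift[OF u])
  have t0: "t 0 = u n" by (simp add: t_def funpow_shift)
  have sZ: "(shift ^^ n) (symb k u) \<in> Z" for n
    using W_funpow_shift[OF u, of n] by (simp add: Wof_def symb_funpow_shift)
  have wt_t: "wt (symb k t) = wt (symb k u)" unfolding t_def symb_funpow_shift
  proof (induction n)
    case (Suc n) then show ?case using wt_inv[OF sZ[of n]] by simp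
  qed simp
  have "cut_index cut (x + real n * w) = u n"
  proof (rule cuts.cut_index_eqI)
    have "cut (u n) \<le> F t" using t t0 by (intro cut_le) simp_all
    then show "cut (u n) \<le> x + real n * w" using Ft x(1) by simp
    have "F t + wt (symb k t) \<le> cut (u n + 1)"
    proof (rule cut_greatest)
      fix v assume v: "v \<in> Wof k Z" "u n + 1 \<le> v 0"
      then have "t 0 < v 0" using t0 by simp
      then have "t \<le> v" "t \<noteq> v" using le_chain_less_at[OF chain t v(1)] by auto
      then show "F t + wt (symb k t) \<le> F v" by (rule F_strict[OF t v(1)])
    qed
    then show "x + real n * w < cut (u n + 1)" using Ft x(2) wt_t by simp
  qed
  then show "itin cut w x n = u n" by (simp add: itin_def)
qed

lemma wt_le: "s \<in> Z \<Longrightarrow> wt s \<le> real k"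
  unfolding wt_sum[symmetric] using fin wt_pos by (intro member_le_sum) (auto simp: less_imp_le)

sublocale rational: rational_cut_system k w cut n0 m0
  by unfold_locales (rule n0_pos n0_w)+

text \<open>Each \<open>s\<close> owns an interval of length \<open>wt s\<close>, and these lengths
  already add up to \<open>k\<close>. A further point of \<open>B\<close> would have positive mass
  on top of total mass 1, and for the same reason none of the lower bounds can be strict.\<close>

lemma B_eq: "cuts.B = Z" and L_singleton: "s \<in> Z \<Longrightarrow> measure cuts.L {s} = wt s / real k"
proof -
  interpret Lp: prob_space cuts.L by (rule cuts.prob_space_L)
  have ge: "wt s / real k \<le> measure cuts.L {s}" if s: "s \<in> Z" for s
  proof (rule cuts.L_singleton_ge)
    show "symb k (itin cut w x) = s" if "F (lift s) \<le> x" "x < F (lift s) + wt s" for x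
      using itin_cut[OF lift_Z(1)[OF s]] lift_Z(2)[OF s] that by simp
  qed (use wt_pos[OF s] wt_le[OF s] in auto)
  have sub_B: "Z \<subseteq> cuts.B"
  proof
    fix s assume s: "s \<in> Z"
    have "symb k (itin cut w (F (lift s))) = s"
      using itin_cut[OF lift_Z(1)[OF s], of "F (lift s)"] lift_Z(2)[OF s] wt_pos[OF s] by simp
    then show "s \<in> cuts.B" using cuts.itin_in_B[of "F (lift s)"] by simp
  qed
  have sum1: "(\<Sum>s\<in>Z. wt s / real k) = 1"
    using wt_sum k_pos by (simp add: sum_divide_distrib[symmetric])
  have sums: "(\<Sum>s\<in>S. measure cuts.L {s}) = measure cuts.L S" if "finite S" for S
    using Lp.finite_measure_eq_sum_singleton[of S] that singleton_symseq_borel by simp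
  have le1: "(\<Sum>s\<in>S. measure cuts.L {s}) \<le> 1" if "finite S" for S
    unfolding sums[OF that] by (rule Lp.prob_le_1)
  show "cuts.B = Z"
  proof (rule ccontr)
    assume "cuts.B \<noteq> Z"
    then obtain s where s: "s \<in> cuts.B" "s \<notin> Z" using sub_B by blast
    have "1 \<le> (\<Sum>s\<in>Z. measure cuts.L {s})" unfolding sum1[symmetric] by (rule sum_mono[OF ge])
    then have "1 < (\<Sum>s\<in>insert s Z. measure cuts.L {s})"
      using rational.measure_L_pos[OF s(1)] s(2) fin by simp
    then show False using le1[of "insert s Z"] fin by simp
  qed
  show "measure cuts.L {s} = wt s / real k" if s: "s \<in> Z"
  proof (rule antisym[OF _ ge[OF s]])
    have "measure cuts.L {s} + (\<Sum>r\<in>Z - {s}. wt r / real k) \<le> measure cuts.L {s} + (\<Sum>r\<in>Z - {s}. measure cuts.L {r})"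
      using ge by (intro add_left_mono sum_mono) simp
    also have "\<dots> \<le> 1" using le1[OF fin] sum.remove[OF fin s, of "\<lambda>r. measure cuts.L {r}"] by simp
    finally show "measure cuts.L {s} \<le> wt s / real k"
      using sum.remove[OF fin s, of "\<lambda>r. wt r / real k"] sum1 by simp
  qed
qed

end

section \<open>Semi-Denjoy minimality\<close>

lemma minimal_set_conjugate:
  assumes min: "minimal_set f X" and hom: "homeomorphism X Y \<phi> \<psi>"
    and eq: "\<And>x. x \<in> X \<Longrightarrow> \<phi> (f x) = g (\<phi> x)"
  shows "minimal_set g Y"
proof -
  have X: "compact X" "X \<noteq> {}" "f ` X = X"
    "\<And>N. N \<subseteq> X \<Longrightarrow> compact N \<Longrightarrow> N \<noteq> {} \<Longrightarrow> f ` N = N \<Longrightarrow> N = X"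
    using min unfolding minimal_set_def invariant_set_def by auto
  have h: "continuous_on X \<phi>" "continuous_on Y \<psi>" "\<phi> ` X = Y" "\<psi> ` Y = X"
    "\<And>x. x \<in> X \<Longrightarrow> \<psi> (\<phi> x) = x" "\<And>y. y \<in> Y \<Longrightarrow> \<phi> (\<psi> y) = y"
    using hom unfolding homeomorphism_def by auto
  have "compact Y" unfolding h(3)[symmetric] by (rule compact_continuous_image[OF h(1) X(1)])
  moreover have "Y \<noteq> {}" using X(2) h(3) by blast
  moreover have "g ` Y = Y"
  proof -
    have "g ` Y = (\<lambda>x. g (\<phi> x)) ` X" unfolding h(3)[symmetric] image_image ..
    also have "\<dots> = (\<lambda>x. \<phi> (f x)) ` X" by (rule image_cong) (simp_all add: eq)
    also have "\<dots> = \<phi> ` f ` X" unfolding image_image ..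
    finally show ?thesis by (simp add: X(3) h(3))
  qed
  moreover have "N = Y" if N: "N \<subseteq> Y" "compact N" "N \<noteq> {}" "g ` N = N" for N
  proof -
    have "\<psi> ` N = X"
    proof (rule X(4))
      show "\<psi> ` N \<subseteq> X" using N(1) h(4) by blast
      show "compact (\<psi> ` N)" by (rule compact_continuous_image[OF continuous_on_subset[OF h(2) N(1)] N(2)])
      show "\<psi> ` N \<noteq> {}" using N(3) by simp
      have "f (\<psi> y) = \<psi> (g y)" if y: "y \<in> N" for y
      proof -
        have px: "\<psi> y \<in> X" using y N(1) h(4) by blast
        then have "f (\<psi> y) \<in> X" using X(3) by blast
        then have "f (\<psi> y) = \<psi> (\<phi> (f (\<psi> y)))" using h(5) by simp
        also have "\<dots> = \<psi> (g y)" using eq[OF px] h(6) y N(1) by auto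
        finally show ?thesis .
      qed
      then have "f ` \<psi> ` N = \<psi> ` g ` N" unfolding image_image by (rule image_cong[OF refl])
      then show "f ` \<psi> ` N = \<psi> ` N" using N(4) by simp
    qed
    then have "\<phi> ` \<psi> ` N = Y" using h(3) by simp
    moreover have "\<phi> ` \<psi> ` N = N"
      unfolding image_image using h(6) N(1) by (auto simp: subset_iff image_iff) 
    ultimately show ?thesis by simp
  qed
  ultimately show ?thesis unfolding minimal_set_def invariant_set_def by blast
qed

lemma circle_image: "(\<lambda>x. cis (2 * pi * x)) ` {0..1} = sphere 0 1"
proof (intro subset_antisym subsetI)
  fix z :: complex assume z: "z \<in> sphere 0 1"
  define x where "x = Arg z / (2 * pi)"
  have cx: "cis (2 * pi * x) = z"
  proof -
    have "z \<noteq> 0" "sgn z = z" using z by (auto simp: sgn_eq)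
    then show ?thesis using cis_Arg[of z] by (simp add: x_def)
  qed
  have "cis (2 * pi * (x - of_int \<lfloor>x\<rfloor>)) = cis (2 * pi * x)"
    unfolding cis_eq_iff rcong_altdef by (rule exI[of _ "\<lfloor>x\<rfloor>"]) (simp add: algebra_simps)
  moreover have "0 \<le> x - of_int \<lfloor>x\<rfloor>" "x - of_int \<lfloor>x\<rfloor> \<le> 1" by linarith+
  ultimately show "z \<in> (\<lambda>x. cis (2 * pi * x)) ` {0..1}"
    using cx by (intro rev_image_eqI[of "x - of_int \<lfloor>x\<rfloor>"]) auto
qed auto

text \<open>\<open>Arg\<close> jumps on the circle, so continuity of \<open>h\<close> is not
  inherited from its formula. Periodicity hides the jump in the first claim.\<close>

lemma circle_map_of_lift:
  assumes cont: "continuous_on UNIV H" and per: "\<And>x. H (x + 1) = H x + (1 :: real)"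
  defines "h \<equiv> \<lambda>z. cis (2 * pi * H (Arg z / (2 * pi)))"
  shows "h (cis (2 * pi * x)) = cis (2 * pi * H x)" and "continuous_on (sphere 0 1) h"
proof -
  have perm: "H (x + of_int m) = H x + of_int m" for x m
    using quasi_periodic_int[of H, OF per] by simp
  show eq: "h (cis (2 * pi * x)) = cis (2 * pi * H x)" for x
  proof -
    define z where "z = cis (2 * pi * x)"
    have "z \<noteq> 0" "sgn z = z" by (simp_all add: z_def sgn_eq)
    then have "cis (Arg z) = cis (2 * pi * x)" using cis_Arg[of z] by (simp add: z_def)
    then obtain m :: int where m: "2 * pi * x = Arg z + of_int m * (2 * pi)"
      unfolding cis_eq_iff rcong_altdef by blast
    then have "x = Arg z / (2 * pi) + of_int m" by (simp add: field_simps)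
    then have Hx: "H x = H (Arg z / (2 * pi)) + of_int m" by (simp add: perm)
    have "cis (2 * pi * H (Arg z / (2 * pi))) = cis (2 * pi * H x)"
      unfolding cis_eq_iff rcong_altdef Hx by (rule exI[of _ m]) (simp add: algebra_simps)
    then show ?thesis by (simp add: h_def z_def)
  qed
  define q where "q = (\<lambda>x::real. cis (2 * pi * x))"
  have q: "continuous_on {0..1} q" unfolding q_def by (intro continuous_intros)
  have hq: "continuous_on {0..1} (\<lambda>x. h (q x))"
    unfolding q_def eq by (intro continuous_intros continuous_on_subset[OF cont]) simp
  show "continuous_on (sphere 0 1) h"
    \<comment> \<open>Continuity descends through the quotient map \<open>q\<close>: preimages of
      closed sets are images under \<open>q\<close> of compact subsets of
      \<open>[0, 1]\<close>.\<close>
    unfolding continuous_on_closed_vimage[OF closed_sphere]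
  proof (intro allI impI)
    fix C :: "complex set" assume "closed C"
    then have "closed ((\<lambda>x. h (q x)) -` C \<inter> {0..1})"
      using hq continuous_on_closed_vimage[of "{0..1::real}" "\<lambda>x. h (q x)"] by simp
    then have "compact ((\<lambda>x. h (q x)) -` C \<inter> {0..1})"
      using compact_Int_closed[of "{0..1::real}" "(\<lambda>x. h (q x)) -` C \<inter> {0..1}"]
      by (simp add: Int_commute Int_left_commute)
    then have "compact (q ` ((\<lambda>x. h (q x)) -` C \<inter> {0..1}))"
      by (rule compact_continuous_image[rotated]) (rule continuous_on_subset[OF q], blast)
    moreover have "q ` ((\<lambda>x. h (q x)) -` C \<inter> {0..1}) = h -` C \<inter> sphere 0 1"
      unfolding circle_image[symmetric] q_def by blast
    ultimately show "closed (h -` C \<inter> sphere 0 1)" by (simp add: compact_imp_closed)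
  qed
qed

text \<open>An order embedding of staircases into the line. Its key feature is that the shift expands by at
  most the factor 4, so that it extends to a monotone Lipschitz map.\<close>

definition emb :: "nat \<Rightarrow> symseq \<Rightarrow> real" where
  "emb k u = 3 / (4 * real k) * (\<Sum>n. (1 / 4) ^ n * of_int (u n))"

text \<open>A crude bound is enough: against the weights \<open>(1 / 4) ^ n\<close> it leaves a
  geometric series of ratio 1/2.\<close>

lemma stair_growth:
  assumes "stair u"
  shows "\<bar>real_of_int (u n)\<bar> \<le> (\<bar>of_int (u 0)\<bar> + 1) * 2 ^ n"
proof (induction n)
  case (Suc n)
  have "\<bar>real_of_int (u (Suc n))\<bar> \<le> \<bar>real_of_int (u n)\<bar> + 1"
    using assms by (auto simp: stair_def dest!: spec[of _ n])
  moreover have "1 \<le> (\<bar>real_of_int (u 0)\<bar> + 1) * 2 ^ n"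
    using mult_mono[of 1 "\<bar>real_of_int (u 0)\<bar> + 1" 1 "2 ^ n :: real"] by simp
  ultimately show ?case using Suc by simp
qed simp

lemma term_bound:
  assumes "\<bar>real_of_int (u n)\<bar> \<le> C * 2 ^ n"
  shows "norm ((1 / 4) ^ n * real_of_int (u n)) \<le> C * (1 / 2) ^ n"
proof -
  have "norm ((1 / 4) ^ n * real_of_int (u n)) = (1 / 4) ^ n * \<bar>real_of_int (u n)\<bar>"
    by (simp add: abs_mult)
  also have "\<dots> \<le> (1 / 4) ^ n * (C * 2 ^ n)" by (rule mult_left_mono[OF assms]) simp
  also have "\<dots> = C * ((1 / 4) ^ n * 2 ^ n)" by simp
  also have "(1 / 4 :: real) ^ n * 2 ^ n = (1 / 2) ^ n" by (simp flip: power_mult_distrib)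
  finally show ?thesis .
qed

lemma emb_summable:
  assumes "stair u"
  shows "summable (\<lambda>n. (1 / 4) ^ n * real_of_int (u n))"
proof (rule summable_comparison_test)
  show "\<exists>N. \<forall>n\<ge>N. norm ((1 / 4) ^ n * real_of_int (u n)) \<le> (\<bar>of_int (u 0)\<bar> + 1) * (1 / 2) ^ n"
    by (intro exI[of _ 0] allI impI term_bound stair_growth assms)
  show "summable (\<lambda>n. (\<bar>real_of_int (u 0)\<bar> + 1) * (1 / 2) ^ n)"
    by (intro summable_mult summable_geometric) simp
qed

lemma emb_shift:
  assumes "stair u"
  shows "emb k (shift u) = 4 * emb k u - 3 / real k * of_int (u 0)"
proof -
  have "(\<Sum>n. (1 / 4) ^ n * real_of_int (u n))
      = (\<Sum>n. (1 / 4) ^ Suc n * real_of_int (u (Suc n))) + (1 / 4) ^ 0 * real_of_int (u 0)"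
    using suminf_split_head[OF emb_summable[OF assms]] by simp
  also have "(\<Sum>n. (1 / 4) ^ Suc n * real_of_int (u (Suc n)))
      = (\<Sum>n. 1 / 4 * ((1 / 4) ^ n * real_of_int (shift u n)))"
    by (simp add: shift_apply mult.assoc)
  also have "\<dots> = 1 / 4 * (\<Sum>n. (1 / 4) ^ n * real_of_int (shift u n))"
    by (rule suminf_mult[OF emb_summable[OF stair_shift[OF assms]]])
  finally have "(\<Sum>n. (1 / 4) ^ n * real_of_int (shift u n))
      = 4 * (\<Sum>n. (1 / 4) ^ n * real_of_int (u n)) - 4 * of_int (u 0)"
    by simp
  then show ?thesis unfolding emb_def by (cases "k = 0") (simp_all add: field_simps)
qed

text \<open>The weights sum to 4/3, so the prefactor \<open>3 / (4 * k)\<close> turns translation by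
  \<open>k\<close> into translation by 1, the period of a circle lift.\<close>

lemma emb_trans:
  assumes "k \<ge> 1" "stair u"
  shows "emb k (translate (int k * m) u) = emb k u + of_int m"
proof -
  have g: "(\<lambda>n. (1 / 4 :: real) ^ n * real_of_int (int k * m)) sums (4 / 3 * real_of_int (int k * m))"
    using sums_mult2[OF geometric_sums[of "1 / 4 :: real"], of "real_of_int (int k * m)"] by simp
  have "(\<lambda>n. (1 / 4) ^ n * real_of_int (translate (int k * m) u n)) sums
      ((\<Sum>n. (1 / 4) ^ n * real_of_int (u n)) + 4 / 3 * real_of_int (int k * m))"
    using sums_add[OF summable_sums[OF emb_summable[OF assms(2)]] g]
    by (simp add: translate_apply distrib_left)
  then have "(\<Sum>n. (1 / 4) ^ n * real_of_int (translate (int k * m) u n))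
      = (\<Sum>n. (1 / 4) ^ n * real_of_int (u n)) + 4 / 3 * real_of_int (int k * m)"
    by (rule sums_unique[symmetric])
  then show ?thesis unfolding emb_def using assms(1) by (simp add: field_simps)
qed

lemma emb_mono:
  assumes "stair u" "stair v" "u \<le> v"
  shows "emb k u \<le> emb k v"
  unfolding emb_def using assms(3)
  by (intro mult_left_mono suminf_le emb_summable assms(1,2)) (auto simp: le_fun_def)

lemma emb_strict_mono:
  assumes "k \<ge> 1" "stair u" "stair v" "u \<le> v" "u \<noteq> v"
  shows "emb k u < emb k v"
proof -
  obtain i where i: "u i < v i" using assms(4,5) by (metis antisym le_funI linorder_not_less)
  have sm: "summable (\<lambda>n. (1 / 4) ^ n * real_of_int (v n) - (1 / 4) ^ n * real_of_int (u n))"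
    by (intro summable_diff emb_summable assms(2,3))
  have "0 < (\<Sum>n. (1 / 4) ^ n * real_of_int (v n) - (1 / 4) ^ n * real_of_int (u n))"
    by (rule suminf_pos2[OF sm, of i]) (use i assms(4) in \<open>auto simp: le_fun_def\<close>)
  also have "\<dots> = (\<Sum>n. (1 / 4) ^ n * real_of_int (v n)) - (\<Sum>n. (1 / 4) ^ n * real_of_int (u n))"
    by (rule suminf_diff[symmetric]) (rule emb_summable assms(2,3))+
  finally show ?thesis unfolding emb_def using assms(1) by (intro mult_strict_left_mono) simp_all
qed

section \<open>A monotone circle map extending the shift\<close>

context cut_system
begin

abbreviation "W \<equiv> Wof k B"

lemma W_stair: "u \<in> W \<Longrightarrow> stair u"
  by (simp add: Wof_def)

lemma W_ne: "W \<noteq> {}"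
  using itin_in_B stair_itin by (auto simp: Wof_def)

text \<open>Dropping the first coordinate multiplies by 4 and subtracts a term increasing in
  \<open>u 0\<close>; since \<open>u 0 \<le> v 0\<close>, that term only helps.\<close>

lemma emb_shift_le:
  assumes "u \<in> W" "v \<in> W" "u \<le> v"
  shows "emb k (shift v) \<le> emb k (shift u) + 4 * (emb k v - emb k u)"
proof -
  have "3 / real k * of_int (u 0) \<le> 3 / real k * real_of_int (v 0)"
    using assms(3) by (intro mult_left_mono) (auto simp: le_fun_def)
  then show ?thesis using assms(1,2) by (simp add: emb_shift W_stair)
qed

lemma emb_shift_mono: "u \<in> W \<Longrightarrow> v \<in> W \<Longrightarrow> u \<le> v \<Longrightarrow> emb k (shift u) \<le> emb k (shift v)"
  by (intro emb_mono stair_shift W_stair) (auto simp: le_fun_def shift_apply)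

lemma emb_below: "\<exists>u\<in>W. emb k u \<le> y"
proof -
  obtain u where u: "u \<in> W" using W_ne by blast
  have "emb k (translate (int k * \<lfloor>y - emb k u\<rfloor>) u) \<le> y"
    unfolding emb_trans[OF k_pos W_stair[OF u]] by linarith
  then show ?thesis using Wof_trans[OF u] by blast
qed

text \<open>The McShane extension of \<open>emb u \<mapsto> emb (shift u)\<close>, one-sided to keep it monotone.\<close>

definition ext_term :: "symseq \<Rightarrow> real \<Rightarrow> real" where
  "ext_term u y = emb k (shift u) + 4 * max 0 (y - emb k u)"

definition ext :: "real \<Rightarrow> real" where
  "ext y = (INF u\<in>W. ext_term u y)"

text \<open>Terms from staircases above \<open>s\<close> are large by monotonicity, those from
  staircases below by the expansion bound. Hence the infimum is finite and attained at
  \<open>u = s\<close> when \<open>y = emb k s\<close>.\<close>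

lemma ext_term_ge:
  assumes "u \<in> W" "s \<in> W" "emb k s \<le> y"
  shows "emb k (shift s) \<le> ext_term u y"
proof (cases "s \<le> u")
  case True
  then have "emb k (shift s) \<le> emb k (shift u)" using assms by (intro emb_shift_mono)
  moreover have "0 \<le> 4 * max 0 (y - emb k u)" by simp
  ultimately show ?thesis unfolding ext_term_def by linarith
next
  case False
  then have "u \<le> s" using le_chainD[OF B_chain assms(1,2)] by blast
  then have "emb k (shift s) \<le> emb k (shift u) + 4 * (emb k s - emb k u)"
    using assms by (intro emb_shift_le)
  also have "\<dots> \<le> ext_term u y" using assms(3) by (auto simp: ext_term_def max_def)
  finally show ?thesis .
qed

lemma ext_bdd: "bdd_below ((\<lambda>u. ext_term u y) ` W)"
proof -
  obtain s where "s \<in> W" "emb k s \<le> y" using emb_below by blast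
  then show ?thesis using ext_term_ge by (intro bdd_belowI2[of _ "emb k (shift s)"]) blast
qed

lemma ext_emb: "s \<in> W \<Longrightarrow> ext (emb k s) = emb k (shift s)"
proof (rule antisym)
  assume s: "s \<in> W"
  have "ext (emb k s) \<le> ext_term s (emb k s)" unfolding ext_def by (rule cINF_lower[OF ext_bdd s])
  then show "ext (emb k s) \<le> emb k (shift s)" by (simp add: ext_term_def)
  show "emb k (shift s) \<le> ext (emb k s)"
    unfolding ext_def by (rule cINF_greatest[OF W_ne]) (rule ext_term_ge[OF _ s order_refl])
qed

lemma ext_mono: "mono ext"
proof (rule monoI)
  fix x y :: real assume "x \<le> y"
  then show "ext x \<le> ext y" unfolding ext_def
    by (intro cINF_mono[OF W_ne ext_bdd]) (auto simp: ext_term_def intro!: bexI)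
qed

lemma ext_lipschitz: "ext y \<le> ext x + 4 * \<bar>y - x\<bar>"
proof -
  have "ext y - 4 * \<bar>y - x\<bar> \<le> ext x"
    unfolding ext_def[of x]
  proof (rule cINF_greatest[OF W_ne])
    fix u assume u: "u \<in> W"
    have "ext y \<le> ext_term u y" unfolding ext_def by (rule cINF_lower[OF ext_bdd u])
    also have "\<dots> \<le> ext_term u x + 4 * \<bar>y - x\<bar>"
      unfolding ext_term_def by (auto simp: max_def abs_if)
    finally show "ext y - 4 * \<bar>y - x\<bar> \<le> ext_term u x" by simp
  qed
  then show ?thesis by simp
qed

lemma ext_continuous: "continuous_on UNIV ext"
  unfolding continuous_on_iff
proof (intro ballI allI impI)
  fix x e :: real assume "e > 0"
  show "\<exists>d>0. \<forall>y\<in>UNIV. dist y x < d \<longrightarrow> dist (ext y) (ext x) < e"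
  proof (intro exI[of _ "e / 4"] conjI ballI impI)
    fix y assume "dist y x < e / 4"
    then have "4 * \<bar>y - x\<bar> < e" "4 * \<bar>x - y\<bar> < e" by (simp_all add: dist_real_def abs_minus_commute)
    then show "dist (ext y) (ext x) < e"
      using ext_lipschitz[of y x] ext_lipschitz[of x y] by (simp add: dist_real_def)
  qed (use \<open>e > 0\<close> in simp)
qed

lemma ext_period: "ext (x + 1) = ext x + 1"
proof -
  have t: "ext_term (translate (int k * m) u) (x + of_int m) = ext_term u x + of_int m" if u: "u \<in> W" for u x m
    using W_stair[OF u] by (simp add: ext_term_def shift_trans emb_trans[OF k_pos] stair_shift)
  have le: "ext (x + of_int m) \<le> ext x + of_int m" for x m
  proof -
    have "ext (x + of_int m) - of_int m \<le> ext x" unfolding ext_def[of x]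
    proof (rule cINF_greatest[OF W_ne])
      fix u assume u: "u \<in> W"
      have "ext (x + of_int m) \<le> ext_term (translate (int k * m) u) (x + of_int m)"
        unfolding ext_def by (rule cINF_lower[OF ext_bdd Wof_trans[OF u]])
      then show "ext (x + of_int m) - of_int m \<le> ext_term u x" by (simp add: t[OF u])
    qed
    then show ?thesis by simp
  qed
  show ?thesis using le[of x 1] le[of "x + 1" "-1"] by simp
qed

lemma funpow_ext_emb: "s \<in> W \<Longrightarrow> (ext ^^ n) (emb k s) = emb k ((shift ^^ n) s)"
proof (induction n)
  case (Suc n)
  have "(shift ^^ n) s \<in> W" using Wof_funpow_shift B_shift Suc.prems by blast
  then show ?case using Suc by (simp add: ext_emb)
qed simp

text \<open>The deviation bound traps \<open>(shift ^^ n) s\<close> pointwise between whole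
  translates of \<open>s\<close>, which \<open>emb\<close> turns into integer translations. Here
  \<open>C / k \<le> 4\<close> because \<open>k \<ge> 1\<close>, rounding costs 1, and the remaining
  2 is slack.\<close>

lemma emb_displacement:
  assumes s: "s \<in> W"
  shows "\<bar>emb k ((shift ^^ n) s) - emb k s - real n * (w / real k)\<bar> \<le> 4 + 1 + 2"
proof -
  define C where "C = 2 * real k + 2"
  have d: "\<bar>real_of_int (s (i + n) - s i) - real n * w\<bar> \<le> C" for i
    using B_displacement[OF Wof_funpow_shift[OF _ s], of i n] B_shift by (simp add: funpow_shift C_def)
  have st: "stair ((shift ^^ n) s)" using W_stair[OF s] by (rule stair_funpow_shift)
  define a where "a = \<lceil>(real n * w + C) / real k\<rceil>"
  have a: "(real n * w + C) / real k \<le> of_int a" "of_int a \<le> (real n * w + C) / real k + 1"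
    unfolding a_def by linarith+
  define b where "b = \<lfloor>(real n * w - C) / real k\<rfloor>"
  have b: "of_int b \<le> (real n * w - C) / real k" "(real n * w - C) / real k \<le> of_int b + 1"
    unfolding b_def by linarith+
  have ka: "real n * w + C \<le> real k * of_int a" using a(1) k_pos by (simp add: field_simps)
  have kb: "real k * of_int b \<le> real n * w - C" using b(1) k_pos by (simp add: field_simps)
  have "(shift ^^ n) s \<le> translate (int k * a) s"
  proof (rule le_funI)
    fix i
    have "real_of_int (s (i + n)) \<le> real_of_int (s i + int k * a)" using d[of i] ka by simp
    then have "s (i + n) \<le> s i + int k * a" by (simp only: of_int_le_iff)
    then show "(shift ^^ n) s i \<le> translate (int k * a) s i" by (simp add: seq_apply add.commute)
  qed
  then have 1: "emb k ((shift ^^ n) s) \<le> emb k s + of_int a"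
    using emb_mono[OF st] W_stair[OF s] by (simp flip: emb_trans[OF k_pos W_stair[OF s]])
  have "translate (int k * b) s \<le> (shift ^^ n) s"
  proof (rule le_funI)
    fix i
    have "real_of_int (s i + int k * b) \<le> real_of_int (s (i + n))" using d[of i] kb by simp
    then have "s i + int k * b \<le> s (i + n)" by (simp only: of_int_le_iff)
    then show "translate (int k * b) s i \<le> (shift ^^ n) s i" by (simp add: seq_apply add.commute)
  qed
  then have 2: "emb k s + of_int b \<le> emb k ((shift ^^ n) s)"
    using emb_mono[OF _ st] W_stair[OF s] by (simp flip: emb_trans[OF k_pos W_stair[OF s]])
  have "C / real k \<le> 4" using k_pos by (simp add: C_def field_simps)
  then show ?thesis using 1 2 a(2) b(2) by (simp add: add_divide_distrib diff_divide_distrib)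
qed

lemma ext_rotation_number: "has_rotation_number ext (w / real k)"
  unfolding has_rotation_number_def
proof
  fix x
  obtain s where s: "s \<in> W" using W_ne by blast
  define a where "a = \<lfloor>x - emb k s\<rfloor>"
  define t where "t = translate (int k * a) s"
  have t: "t \<in> W" unfolding t_def by (rule Wof_trans[OF s])
  have et: "emb k t = emb k s + of_int a" unfolding t_def by (rule emb_trans[OF k_pos W_stair[OF s]])
  have x: "emb k t \<le> x" "x \<le> emb k t + 1" unfolding et a_def by linarith+
  have mono: "mono (ext ^^ n)" for n by (induction n) (use ext_mono in \<open>auto simp: mono_def\<close>)
  have per: "(ext ^^ n) (y + 1) = (ext ^^ n) y + 1" for n y
    by (induction n) (simp_all add: ext_period)
  \<comment> \<open>The bound 7 from \<open>emb_displacement\<close>, plus 1 each for the distance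
    of \<open>x\<close> and of its image from the orbit of \<open>emb k t\<close>.\<close>
  have bd: "\<bar>(ext ^^ n) x - x - real n * (w / real k)\<bar> \<le> 9" for n
  proof -
    have "(ext ^^ n) (emb k t) \<le> (ext ^^ n) x" "(ext ^^ n) x \<le> (ext ^^ n) (emb k t) + 1"
      using monoD[OF mono x(1), of n] monoD[OF mono x(2), of n] per by simp_all
    then show ?thesis using emb_displacement[OF t, of n] x unfolding funpow_ext_emb[OF t] by linarith
  qed
  then show "(\<lambda>n. ((ext ^^ n) x - x) / real n) \<longlonglongrightarrow> w / real k"
    by (rule tendsto_of_bounded_displacement)
qed

text \<open>Normalised lifts start in a bounded range, so the series converges uniformly on
  \<open>B\<close>, and each term depends on finitely many symbols.\<close>

lemma continuous_emb_lift: "continuous_on B (\<lambda>s. emb k (lift s))"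
proof -
  have b: "\<bar>real_of_int (lift s n)\<bar> \<le> (real k + 1) * 2 ^ n" if s: "s \<in> B" for s n
  proof -
    obtain u where u: "stair u" "s = symb k u" using B_subset_stair s by blast
    have "s 0 \<in> {0..<2 * int k}" unfolding u by (rule symb_range[OF k_pos])
    then have "0 \<le> lift s 0" "lift s 0 \<le> int k" by (auto simp: lift_def)
    then have "\<bar>real_of_int (lift s 0)\<bar> + 1 \<le> real k + 1" by linarith
    then have "(\<bar>real_of_int (lift s 0)\<bar> + 1) * 2 ^ n \<le> (real k + 1) * 2 ^ n" by (rule mult_right_mono) simp
    moreover have "stair (lift s)" using lift_in_Wof(1)[OF k_pos B_subset_stair s] by (simp add: Wof_def)
    ultimately show ?thesis using stair_growth[of "lift s" n] by linarith
  qed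
  have "uniform_limit B (\<lambda>N s. \<Sum>n<N. (1 / 4) ^ n * real_of_int (lift s n))
      (\<lambda>s. \<Sum>n. (1 / 4) ^ n * real_of_int (lift s n)) sequentially"
  proof (rule Weierstrass_m_test)
    show "norm ((1 / 4) ^ n * real_of_int (lift s n)) \<le> (real k + 1) * (1 / 2) ^ n" if "s \<in> B" for n s
      by (rule term_bound[OF b[OF that]])
    show "summable (\<lambda>n. (real k + 1) * (1 / 2) ^ n)"
      by (intro summable_mult summable_geometric) simp
  qed
  then have "continuous_on B (\<lambda>s. \<Sum>n. (1 / 4) ^ n * real_of_int (lift s n))"
  proof (rule uniform_limit_theorem[rotated])
    show "eventually (\<lambda>N. continuous_on B (\<lambda>s. \<Sum>n<N. (1 / 4) ^ n * real_of_int (lift s n))) sequentially"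
      by (intro always_eventually allI continuous_intros continuous_lift_coord)
  qed simp
  then show ?thesis unfolding emb_def by (intro continuous_intros)
qed

text \<open>The embedding, read modulo 1, conjugates the shift to the circle map of
  \<open>ext\<close>. Injectivity and compactness of \<open>B\<close> make it a homeomorphism onto
  its image.\<close>

lemma semi_denjoy_minimal_B:
  assumes irr: "w / real k \<notin> \<rat>"
  shows "semi_denjoy_minimal shift B"
proof -
  define h where "h = (\<lambda>z. cis (2 * pi * ext (Arg z / (2 * pi))))"
  have hh1: "h (cis (2 * pi * x)) = cis (2 * pi * ext x)" for x
    unfolding h_def by (rule circle_map_of_lift(1)[OF ext_continuous ext_period])
  have hh2: "continuous_on (sphere 0 1) h"
    unfolding h_def by (rule circle_map_of_lift(2)[OF ext_continuous ext_period])
  define \<Theta> where "\<Theta> s = cis (2 * pi * emb k (lift s))" for s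
  have lift: "lift s \<in> W" "symb k (lift s) = s" if "s \<in> B" for s
    using lift_in_Wof[OF k_pos B_subset_stair that] by auto
  have "continuous_on B \<Theta>" unfolding \<Theta>_def by (intro continuous_intros continuous_emb_lift)
  moreover have "inj_on \<Theta> B"
  proof (rule inj_onI)
    fix s t assume st: "s \<in> B" "t \<in> B" "\<Theta> s = \<Theta> t"
    \<comment> \<open>Equal points on the circle have embeddings differing by an integer, which a
      translation absorbs; strict monotonicity on the chain then identifies the lifts.\<close>
    then obtain m where m: "2 * pi * emb k (lift t) = 2 * pi * emb k (lift s) + of_int m * (2 * pi)"
      unfolding \<Theta>_def cis_eq_iff rcong_altdef by blast
    define v where "v = translate (int k * m) (lift s)"
    have v: "v \<in> W" unfolding v_def by (rule Wof_trans[OF lift(1)[OF st(1)]])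
    have "2 * pi * emb k (lift t) = 2 * pi * (emb k (lift s) + of_int m)" using m by (simp add: algebra_simps)
    then have "emb k (lift t) = emb k v"
      using W_stair[OF lift(1)[OF st(1)]] by (simp add: v_def emb_trans[OF k_pos])
    moreover have "lift t \<le> v \<or> v \<le> lift t" by (rule le_chainD[OF B_chain lift(1)[OF st(2)] v])
    ultimately have "lift t = v"
      using emb_strict_mono[OF k_pos] W_stair[OF v] W_stair[OF lift(1)[OF st(2)]] by force
    then have "symb k (lift t) = symb k (lift s)" by (simp add: v_def)
    then show "s = t" using lift(2) st(1,2) by simp
  qed
  ultimately obtain \<psi> where hom: "homeomorphism B (\<Theta> ` B) \<Theta> \<psi>"
    using homeomorphism_compact[OF B_compact] by blast
  have conj: "\<Theta> (shift s) = h (\<Theta> s)" if s: "s \<in> B" for s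
  proof -
    have ss: "shift s \<in> B" using B_shift s by blast
    obtain i where i: "lift (shift s) = translate (int k * i) (shift (lift s))"
      using lift_shift[OF k_pos B_subset_stair s ss] by blast
    have "emb k (lift (shift s)) = ext (emb k (lift s)) + of_int i"
      unfolding i emb_trans[OF k_pos stair_shift[OF W_stair[OF lift(1)[OF s]]]] ext_emb[OF lift(1)[OF s]] ..
    then have "\<Theta> (shift s) = cis (2 * pi * ext (emb k (lift s)))"
      unfolding \<Theta>_def cis_eq_iff rcong_altdef by (intro exI[of _ "- i"]) (simp add: algebra_simps)
    then show ?thesis by (simp only: \<Theta>_def hh1)
  qed
  have "minimal_set h (\<Theta> ` B)"
    by (rule minimal_set_conjugate[of shift B _ \<Theta> \<psi>]) (fact B_minimal_set[OF irr] hom conj)+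
  moreover have "top_conjugate shift B h (\<Theta> ` B)"
    unfolding top_conjugate_def using hom conj by blast
  moreover have "\<Theta> ` B \<subseteq> sphere 0 1" "h ` sphere 0 1 \<subseteq> sphere 0 1"
    by (auto simp: \<Theta>_def h_def)
  moreover have "monotone_degree_one_lift h ext"
    unfolding monotone_degree_one_lift_def using ext_continuous ext_mono ext_period hh1 by simp
  ultimately show ?thesis
    unfolding semi_denjoy_minimal_def
    using B_minimal_set[OF irr] hh2 ext_rotation_number irr
    by (intro conjI exI[of _ h] exI[of _ ext] exI[of _ "w / real k"] exI[of _ "\<Theta> ` B"]) simp_all
qed

end

section \<open>Recurrent kfsm sets and their invariant measures\<close>

lemma irrational_divide_nat:
  assumes "w \<notin> \<rat>" "k \<ge> 1"
  shows "w / real k \<notin> \<rat>"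
proof
  assume "w / real k \<in> \<rat>"
  then have "real k * (w / real k) \<in> \<rat>" by (intro Rats_mult) simp_all
  then show False using assms by simp
qed

lemma rational_least_return:
  assumes "w \<in> \<rat>" "k \<ge> 1"
  shows "\<exists>n0 m0. n0 \<ge> 1 \<and> real n0 * w = real k * of_int m0 \<and>
    (\<forall>m i. 0 < m \<longrightarrow> m < n0 \<longrightarrow> real m * w \<noteq> real k * of_int i)"
proof -
  define P where "P n \<longleftrightarrow> 0 < n \<and> (\<exists>m0::int. real n * w = real k * of_int m0)" for n
  obtain a b where ab: "w = of_int a / of_int b" "b > 0"
    using assms(1) by (metis Rats_cases')
  have "real (k * nat b) * w = real k * of_int a" using ab by simp
  then have "P (k * nat b)" unfolding P_def using assms(2) ab(2) by auto
  then have least: "P (LEAST n. P n)" by (rule LeastI)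
  have "\<not> P m" if "m < (LEAST n. P n)" for m using that by (rule not_less_Least)
  then have "real m * w \<noteq> real k * of_int i" if "0 < m" "m < (LEAST n. P n)" for m and i :: int
    using that unfolding P_def by blast
  then show ?thesis using least unfolding P_def[of "LEAST n. P n"] by (metis One_nat_def Suc_leI)
qed

lemma (in hm_system) HM_B_recurrent: "recurrent_set shift B"
proof (cases "w \<in> \<rat>")
  case True
  then obtain n0 m0 where "n0 \<ge> 1" "real n0 * w = real k * of_int m0"
    using rational_least_return[OF True k_ge_1] by blast
  then interpret r: rational_cut_system k w cc n0 m0 by unfold_locales
  show ?thesis by (rule r.B_recurrent)
next
  case False
  then show ?thesis by (intro B_recurrent_irrational irrational_divide_nat k_ge_1)
qed

lemma rational_recurrent_periodic:
  assumes k: "k \<ge> 1" and Z: "symbolic_kfsm k Z" "recurrent_set shift Z" "rho_set_eq Z w" and w: "w \<in> \<rat>"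
  shows "\<exists>n0 m0. n0 \<ge> 1 \<and> real n0 * w = real k * of_int m0 \<and>
    (\<forall>u\<in>Wof k Z. (shift ^^ n0) u = translate (int k * m0) u) \<and>
    (\<forall>s\<in>Z. (shift ^^ n0) s = s) \<and> finite Z"
proof -
  have Z': "Z \<noteq> {}" "Z \<subseteq> symb k ` Collect stair" "shift ` Z = Z" "le_chain (Wof k Z)"
    using Z(1) unfolding symbolic_kfsm_iff[OF k] by auto
  obtain n0 m0 where n0: "n0 \<ge> 1" "real n0 * w = real k * of_int m0"
    "\<And>m i. 0 < m \<Longrightarrow> m < n0 \<Longrightarrow> real m * w \<noteq> real k * of_int i"
    using rational_least_return[OF w k] by blast
  interpret h: height_system k w "Wof k Z" "\<lambda>u. height w u - 0"
    by (rule height_system_Wof[OF k Z' Z(3)])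
  have per: "(shift ^^ n0) u = translate (int k * m0) u" if u: "u \<in> Wof k Z" for u
  proof (rule h.recurrent_imp_periodic[OF n0 u])
    have "symb k u \<in> Z" using u by (simp add: Wof_def)
    then show "\<exists>n\<ge>1. agree N (symb k u) ((shift ^^ n) (symb k u))" for N
      by (rule recurrent_setD[OF Z(2)])
  qed
  have perZ: "(shift ^^ n0) s = s" if s: "s \<in> Z" for s
  proof -
    note l = lift_in_Wof[OF k Z'(2) s]
    have "symb k ((shift ^^ n0) (lift s)) = symb k (lift s)" unfolding per[OF l(1)] by simp
    then show ?thesis by (simp add: symb_funpow_shift l(2))
  qed
  have "Z \<subseteq> {s. (\<forall>n. s n \<in> {0..<2 * int k}) \<and> (shift ^^ n0) s = s}"
    using Z'(2) symb_range[OF k] perZ by blast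
  then have "finite Z" using finite_periodic_symseqs[OF n0(1)] finite_subset by blast
  then show ?thesis using n0(1,2) per perZ by blast
qed

lemma rational_kfsm_eq_HM_B:
  assumes k: "k \<ge> 1" and Z: "symbolic_kfsm k Z" "recurrent_set shift Z" "rho_set_eq Z w" and w: "w \<in> \<rat>"
  shows "\<exists>\<nu>. allowable k w \<nu> \<and> Z = HM_B k w \<nu>"
proof -
  have Z': "Z \<noteq> {}" "Z \<subseteq> symb k ` Collect stair" "shift ` Z = Z" "le_chain (Wof k Z)"
    using Z(1) unfolding symbolic_kfsm_iff[OF k] by auto
  obtain n0 m0 where n0: "n0 \<ge> 1" "real n0 * w = real k * of_int m0"
    "\<forall>u\<in>Wof k Z. (shift ^^ n0) u = translate (int k * m0) u" "finite Z"
    using rational_recurrent_periodic[OF assms] by blast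
  have "card Z > 0" using Z'(1) n0(4) by (simp add: card_gt_0_iff)
  \<comment> \<open>Any positive invariant weights of total \<open>k\<close> reproduce
    \<open>Z\<close>; equal ones are the simplest choice.\<close>
  interpret p: periodic_chain k Z n0 m0 w "\<lambda>_. real k / real (card Z)"
    by unfold_locales (use k Z' n0 rho_set_eq_range(1)[OF Z(3)] \<open>card Z > 0\<close> in auto)
  show ?thesis using p.cuts.exists_hm_vector unfolding p.B_eq by auto
qed

lemma finitely_supported_measure_eqI:
  fixes M N :: "symseq measure"
  assumes M: "prob_space M" "sets M = sets borel" "measure M S = 1"
    and N: "prob_space N" "sets N = sets borel" "measure N S = 1"
    and S: "finite S" "\<And>s. s \<in> S \<Longrightarrow> measure M {s} = measure N {s}"
  shows "M = N"
proof (rule measure_eqI)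
  have *: "emeasure K A = ennreal (\<Sum>s\<in>A \<inter> S. measure K {s})"
    if K: "prob_space K" "sets K = sets borel" "measure K S = 1" and A: "A \<in> sets borel" for K A
  proof -
    interpret K: prob_space K by (rule K(1))
    have "AE s in K. s \<in> S"
      using K(3) finite_symseq_borel[OF S(1)] by (subst K.AE_in_set_eq_1) (simp_all add: K(2))
    then have "measure K A = measure K (A \<inter> S)"
      using A finite_symseq_borel[OF S(1)]
      by (intro K.finite_measure_eq_AE) (auto elim!: eventually_mono simp: K(2))
    also have "\<dots> = (\<Sum>s\<in>A \<inter> S. measure K {s})"
      using S(1) singleton_symseq_borel by (intro K.finite_measure_eq_sum_singleton) (simp_all add: K(2))
    finally show ?thesis by (simp add: K.emeasure_eq_measure)
  qed
  fix A assume "A \<in> sets M"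
  then show "emeasure M A = emeasure N A"
    using *[OF M, of A] *[OF N, of A] S(2) M(2) by simp
qed (simp add: M(2) N(2))

text \<open>The weights are \<open>k\<close> times the point masses. The resulting vector depends on
  \<mu> and may realise only the part of \<open>Z\<close> that \<mu> charges.\<close>

lemma rational_invariant_measure:
  assumes k: "k \<ge> 1" and Z: "symbolic_kfsm k Z" "recurrent_set shift Z" "rho_set_eq Z w" and w: "w \<in> \<rat>"
    and \<mu>: "\<mu> \<in> inv_prob_measures shift Z"
  shows "\<exists>\<nu>. allowable k w \<nu> \<and> \<mu> = HM_lambda k w \<nu>"
proof -
  have Z': "Z \<noteq> {}" "Z \<subseteq> symb k ` Collect stair" "shift ` Z = Z" "le_chain (Wof k Z)"
    using Z(1) unfolding symbolic_kfsm_iff[OF k] by auto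
  obtain n0 m0 where n0: "n0 \<ge> 1" "real n0 * w = real k * of_int m0"
    "\<forall>u\<in>Wof k Z. (shift ^^ n0) u = translate (int k * m0) u" "\<forall>s\<in>Z. (shift ^^ n0) s = s" "finite Z"
    using rational_recurrent_periodic[OF k Z w] by blast
  have m: "sets \<mu> = sets borel" "prob_space \<mu>" "distr \<mu> borel shift = \<mu>" "measure \<mu> Z = 1"
    using \<mu> by (auto simp: inv_prob_measures_def)
  interpret \<mu>: prob_space \<mu> by (rule m(2))
  have sp: "space \<mu> = UNIV" using sets_eq_imp_space_eq[OF m(1)] by simp
  have sh [measurable]: "shift \<in> borel_measurable borel"
    by (intro borel_measurable_continuous_onI continuous_shift)
  have shm: "shift \<in> measurable \<mu> borel" unfolding measurable_cong_sets[OF m(1) refl] by (rule sh)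
  have AEZ: "AE s in \<mu>. s \<in> Z"
    using m(4) finite_symseq_borel[OF n0(5)] by (subst \<mu>.AE_in_set_eq_1) (simp_all add: m(1))
  \<comment> \<open>Periodicity makes the shift injective on \<open>Z\<close>, so that invariance of
    \<mu> passes to single points.\<close>
  have inj: "s = t" if "s \<in> Z" "t \<in> Z" "shift s = shift t" for s t
  proof -
    obtain j where j: "n0 = Suc j" using n0(1) by (cases n0) auto
    have "(shift ^^ n0) s = (shift ^^ n0) t"
      unfolding j funpow_Suc_right o_apply that(3) ..
    then show ?thesis using n0(4) that by simp
  qed
  define mass where "mass s = measure \<mu> {s}" for s
  have mass_shift: "mass (shift s) = mass s" if s: "s \<in> Z" for s
  proof -
    have sA: "shift -` {shift s} \<in> sets borel"
      using measurable_sets_borel[OF sh singleton_symseq_borel] .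
    have "mass (shift s) = measure (distr \<mu> borel shift) {shift s}" by (simp add: mass_def m(3))
    also have "\<dots> = measure \<mu> (shift -` {shift s})"
      using shm singleton_symseq_borel by (subst measure_distr) (simp_all add: sp)
    also have "\<dots> = mass s" unfolding mass_def
    proof (rule \<mu>.finite_measure_eq_AE)
      show "AE t in \<mu>. (t \<in> shift -` {shift s}) = (t \<in> {s})"
        using AEZ by eventually_elim (use inj s in auto)
    qed (use sA singleton_symseq_borel in \<open>simp_all add: m(1)\<close>)
    finally show ?thesis .
  qed
  have sumZ: "(\<Sum>s\<in>Z. mass s) = 1"
    using \<mu>.finite_measure_eq_sum_singleton[OF n0(5)] singleton_symseq_borel m(1,4) by (simp add: mass_def)
  \<comment> \<open>Points of mass zero are discarded because every weight must be positive.\<close>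
  define Z0 where "Z0 = {s \<in> Z. 0 < mass s}"
  have Z0: "Z0 \<subseteq> Z" "finite Z0" using n0(5) by (auto simp: Z0_def)
  have sumZ0: "(\<Sum>s\<in>Z0. mass s) = 1"
    unfolding sumZ[symmetric]
    by (rule sum.mono_neutral_left) (use n0(5) in \<open>auto simp: Z0_def mass_def zero_less_measure_iff\<close>)
  have W0: "Wof k Z0 \<subseteq> Wof k Z" using Z0(1) by (auto simp: Wof_def)
  have shZ0: "shift ` Z0 = Z0"
  proof
    show "shift ` Z0 \<subseteq> Z0" using Z'(3) mass_shift by (auto simp: Z0_def)
    show "Z0 \<subseteq> shift ` Z0"
    proof
      fix s assume s: "s \<in> Z0"
      then obtain t where "t \<in> Z" "s = shift t" using Z'(3) Z0(1) by blast
      then show "s \<in> shift ` Z0" using s mass_shift[of t] by (auto simp: Z0_def)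
    qed
  qed
  interpret p: periodic_chain k Z0 n0 m0 w "\<lambda>s. real k * mass s"
  proof
    show "Z0 \<noteq> {}" using sumZ0 by auto
    show "Z0 \<subseteq> symb k ` Collect stair" using Z0(1) Z'(2) by blast
    show "le_chain (Wof k Z0)" using Z'(4) W0 unfolding le_chain_def by blast
    show "0 \<le> w" using rho_set_eq_range(1)[OF Z(3)] .
    show "(shift ^^ n0) u = translate (int k * m0) u" if "u \<in> Wof k Z0" for u using n0(3) W0 that by blast
    show "0 < real k * mass s" if "s \<in> Z0" for s using that k by (simp add: Z0_def)
    show "real k * mass (shift s) = real k * mass s" if "s \<in> Z0" for s
      using mass_shift Z0(1) that by auto
    show "(\<Sum>s\<in>Z0. real k * mass s) = real k" by (simp add: sum_distrib_left[symmetric] sumZ0)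
  qed (fact k Z0(2) shZ0 n0(1) n0(2))+
  have "\<mu> = p.cuts.L"
  proof (rule finitely_supported_measure_eqI[OF m(2,1) _ p.cuts.prob_space_L p.cuts.sets_L _ Z0(2)])
    show "measure \<mu> Z0 = 1"
      using \<mu>.finite_measure_eq_sum_singleton[OF Z0(2)] singleton_symseq_borel m(1) sumZ0 by (simp add: mass_def)
    show "measure p.cuts.L Z0 = 1"
      using p.cuts.L_invariant unfolding p.B_eq by (simp add: inv_prob_measures_def)
    show "measure \<mu> {s} = measure p.cuts.L {s}" if "s \<in> Z0" for s
      using p.L_singleton[OF that] k by (simp add: mass_def)
  qed
  then show ?thesis using p.cuts.exists_hm_vector by metis
qed

text \<open>A return means that \<open>k * q\<close> divides \<open>m * p\<close>. After cancelling
  \<open>gcd p k\<close>, what remains of \<open>k * q\<close> is coprime to what remains of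
  \<open>p\<close>, hence divides \<open>m\<close>.\<close>

lemma least_return_time:
  fixes p q k m :: nat
  assumes "coprime p q" "q > 0" "k \<ge> 1" "0 < m" "m < q * k div gcd p k"
  shows "real m * (real p / real q) \<noteq> real k * of_int i"
proof
  assume eq: "real m * (real p / real q) = real k * of_int i"
  then have "real (m * p) = real_of_int (int k * int q * i)" using assms(2) by (simp add: field_simps)
  then have "int (m * p) = int k * int q * i" by linarith
  then have "int (k * q) dvd int (m * p)" by simp
  then have d: "k * q dvd m * p" by (simp only: int_dvd_int_iff)
  define g where "g = gcd p k"
  have g: "g > 0" "g dvd p" "g dvd k" using assms(3) by (auto simp: g_def)
  obtain k' p' where k': "k = g * k'" and p': "p = g * p'" using g by (auto elim!: dvdE)
  have cop: "coprime k' p'"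
    using gcd_coprime_exists[of p k] g(1) k' p' unfolding g_def[symmetric]
    by (metis coprime_commute g_def gcd_eq_0_iff div_gcd_coprime nonzero_mult_div_cancel_left not_gr_zero)
  have "coprime (k' * q) p'"
    using cop assms(1) p' by (simp add: coprime_commute)
  moreover have "k' * q dvd m * p'"
  proof -
    have "g * (k' * q) dvd g * (m * p')" using d k' p' by (simp add: ac_simps)
    then show ?thesis using g(1) by simp
  qed
  ultimately have "k' * q dvd m" by (simp add: coprime_dvd_mult_left_iff)
  moreover have "q * k div gcd p k = k' * q"
  proof -
    have qk: "q * k = g * (k' * q)" by (subst k') (simp only: mult_ac)
    show ?thesis unfolding g_def[symmetric] qk using g(1) by simp
  qed
  ultimately show False using assms(4,5) by (auto dest: dvd_imp_le)
qed

lemma HM_irrational: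
  assumes "k \<ge> 1" "\<alpha> \<notin> \<rat>" "allowable k \<alpha> \<nu>"
  shows "semi_denjoy_minimal shift (HM_B k \<alpha> \<nu>)"
    and "inv_prob_measures shift (HM_B k \<alpha> \<nu>) = {HM_lambda k \<alpha> \<nu>}"
proof -
  interpret hm_system k \<alpha> \<nu> by (rule hm_system.intro) (fact assms)+
  have irr: "\<alpha> / real k \<notin> \<rat>" by (rule irrational_divide_nat[OF assms(2,1)])
  show "semi_denjoy_minimal shift (HM_B k \<alpha> \<nu>)"
    unfolding HM_B_eq by (rule semi_denjoy_minimal_B[OF irr])
  show "inv_prob_measures shift (HM_B k \<alpha> \<nu>) = {HM_lambda k \<alpha> \<nu>}"
    unfolding HM_B_eq HM_lambda_eq using invariant_measure_eq_L[OF irr] L_invariant by blast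
qed

lemma HM_rational:
  fixes p q k :: nat
  assumes "k \<ge> 1" "q > 0" "coprime p q" "allowable k (real p / real q) \<nu>"
  shows "\<exists>\<O>. finite \<O> \<and> HM_B k (real p / real q) \<nu> = \<Union>\<O> \<and>
      (\<forall>P\<in>\<O>. periodic_orbit shift (q * k div gcd p k) P \<and> rho_set_eq P (real p / real q)) \<and>
      (\<exists>c \<mu>. (\<forall>P\<in>\<O>. 0 \<le> c P \<and> \<mu> P \<in> inv_prob_measures shift P) \<and> (\<Sum>P\<in>\<O>. c P) = (1::real) \<and>
         prob_space (HM_lambda k (real p / real q) \<nu>) \<and>
         (\<forall>A\<in>sets borel. measure (HM_lambda k (real p / real q) \<nu>) A
            = (\<Sum>P\<in>\<O>. c P * measure (\<mu> P) A)))"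
proof -
  define w where "w = real p / real q"
  define n0 where "n0 = q * k div gcd p k"
  \<comment> \<open>The number of turns completed after \<open>n0\<close> steps, from
    \<open>n0 * (p / q) = k * (p / gcd p k)\<close>.\<close>
  define m0 where "m0 = int (p div gcd p k)"
  interpret hm_system k w \<nu> unfolding w_def by (rule hm_system.intro) (fact assms)+
  define g where "g = gcd p k"
  have g: "g > 0" "g dvd p" "g dvd k" using assms(1) by (auto simp: g_def)
  obtain p' where p': "p = g * p'" using g(2) by (elim dvdE)
  have "p div g = p'" using arg_cong[OF p', of "\<lambda>x. x div g"] g(1) by simp
  then have m0: "m0 = int p'" unfolding m0_def g_def by simp
  have "g dvd q * k" using g(3) by (rule dvd_mult)
  then have kq: "g * n0 = q * k" unfolding n0_def g_def[symmetric] by (rule dvd_mult_div_cancel)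
  have "0 < g * n0" unfolding kq using assms(1,2) by simp
  then have n0: "n0 \<ge> 1" by (cases n0) simp_all
  have "real n0 * w = real k * of_int m0"
  proof -
    have "g * (n0 * p) = (q * k) * p" unfolding kq[symmetric] by (simp only: mult.assoc)
    also have "\<dots> = (q * k) * (g * p')" unfolding p' ..
    finally have "n0 * p = q * k * p'" using g(1) by simp
    then have "real n0 * real p = real q * real k * real p'" by (simp flip: of_nat_mult)
    then show ?thesis unfolding m0 w_def using assms(2) by (simp add: field_simps)
  qed
  then interpret r: rational_cut_system k w cc n0 m0 by unfold_locales (use n0 in auto)
  define \<O> where "\<O> = r.orbit ` B"
  have "finite \<O>" by (simp add: \<O>_def r.finite_B)
  moreover have "B = \<Union>\<O>" unfolding \<O>_def using r.orbit_subset_B r.self_in_orbit by blast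
  moreover have "periodic_orbit shift n0 P \<and> rho_set_eq P w" if PO: "P \<in> \<O>" for P
  proof -
    obtain s where s: "s \<in> B" "P = r.orbit s" using PO by (auto simp: \<O>_def)
    have "P \<noteq> {}" using r.self_in_orbit s(2) by blast
    then have "rho_set_eq P w"
      using B_rho r.orbit_subset_B[OF s(1)] s(2) unfolding rho_set_eq_def by blast
    moreover have "periodic_orbit shift n0 P"
      unfolding s(2) by (rule r.orbit_periodic[OF s(1)])
        (use least_return_time[OF assms(3,2,1)] in \<open>simp add: n0_def w_def\<close>)
    ultimately show ?thesis by blast
  qed
  moreover have "\<exists>c \<mu>. (\<forall>P\<in>\<O>. 0 \<le> c P \<and> \<mu> P \<in> inv_prob_measures shift P) \<and> (\<Sum>P\<in>\<O>. c P) = (1::real) \<and>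
      prob_space L \<and> (\<forall>A\<in>sets borel. measure L A = (\<Sum>P\<in>\<O>. c P * measure (\<mu> P) A))"
  proof (intro exI conjI ballI)
    fix P assume P: "P \<in> \<O>"
    show "0 \<le> measure L P" by simp
    show inv: "uniform_measure L P \<in> inv_prob_measures shift P"
      using P r.uniform_orbit_measure by (auto simp: \<O>_def)
  next
    have pU: "measure (uniform_measure L P) UNIV = 1" if "P \<in> \<O>" for P
    proof -
      have "uniform_measure L P \<in> inv_prob_measures shift P"
        using that r.uniform_orbit_measure by (auto simp: \<O>_def)
      then have "prob_space (uniform_measure L P)" by (simp add: inv_prob_measures_def)
      moreover have "space (uniform_measure L P) = UNIV" by (simp add: L_def)
      ultimately show ?thesis using prob_space.prob_space by metis
    qed
    have "measure L UNIV = 1" using prob_space.prob_space[OF prob_space_L] by (simp add: L_def)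
    then have "1 = (\<Sum>P\<in>\<O>. measure L P * measure (uniform_measure L P) UNIV)"
      using r.L_orbit_decomposition[of UNIV] by (simp add: \<O>_def)
    also have "\<dots> = (\<Sum>P\<in>\<O>. measure L P)" by (rule sum.cong) (simp_all add: pU)
    finally show "(\<Sum>P\<in>\<O>. measure L P) = 1" by simp
    show "prob_space L" by (rule prob_space_L)
    fix A :: "symseq set" assume "A \<in> sets borel"
    then show "measure L A = (\<Sum>P\<in>\<O>. measure L P * measure (uniform_measure L P) A)"
      unfolding \<O>_def by (rule r.L_orbit_decomposition)
  qed
  ultimately show ?thesis
    unfolding w_def[symmetric] n0_def[symmetric] HM_B_eq HM_lambda_eq by (intro exI[of _ \<O>] conjI) blast+
qed

lemma HM_B_kfsm:
  assumes "k \<ge> 1" "allowable k w \<nu>"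
  shows "symbolic_kfsm k (HM_B k w \<nu>)" "recurrent_set shift (HM_B k w \<nu>)" "rho_set_eq (HM_B k w \<nu>) w"
    "HM_lambda k w \<nu> \<in> inv_prob_measures shift (HM_B k w \<nu>)"
proof -
  interpret hm_system k w \<nu> by (rule hm_system.intro) (fact assms)+
  show "symbolic_kfsm k (HM_B k w \<nu>)" "recurrent_set shift (HM_B k w \<nu>)" "rho_set_eq (HM_B k w \<nu>) w"
    "HM_lambda k w \<nu> \<in> inv_prob_measures shift (HM_B k w \<nu>)"
    unfolding HM_B_eq HM_lambda_eq by (rule B_kfsm HM_B_recurrent B_rho L_invariant)+
qed

lemma recurrent_kfsm_eq_HM_B:
  assumes "k \<ge> 1" "symbolic_kfsm k Z" "recurrent_set shift Z" "rho_set_eq Z w"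
  shows "\<exists>\<nu>. allowable k w \<nu> \<and> Z = HM_B k w \<nu>"
  using rational_kfsm_eq_HM_B[OF assms] irrational_kfsm_eq_HM_B[OF assms irrational_divide_nat[OF _ assms(1)]]
  by (cases "w \<in> \<rat>") auto

text \<open>No rotation number is prescribed here; the chain property supplies one, and its
  rationality decides whether the measure is unique or has to be matched by a vector of its
  own.\<close>

lemma recurrent_kfsm_measure:
  assumes k: "k \<ge> 1" and Z: "symbolic_kfsm k Z" "recurrent_set shift Z" and \<mu>: "\<mu> \<in> inv_prob_measures shift Z"
  shows "\<exists>w \<nu>. allowable k w \<nu> \<and> \<mu> = HM_lambda k w \<nu>"
proof -
  have Z': "Z \<noteq> {}" "Z \<subseteq> symb k ` Collect stair" "shift ` Z \<subseteq> Z" "le_chain (Wof k Z)"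
    using Z(1) unfolding symbolic_kfsm_iff[OF k] by auto
  obtain w where w: "rho_set_eq Z w" using rotation_number_exists[OF k Z'] by blast
  show ?thesis
  proof (cases "w \<in> \<rat>")
    case True
    then show ?thesis using rational_invariant_measure[OF k Z w True \<mu>] by blast
  next
    case False
    obtain \<nu> where \<nu>: "allowable k w \<nu>" "Z = HM_B k w \<nu>" using recurrent_kfsm_eq_HM_B[OF k Z w] by blast
    then have "\<mu> = HM_lambda k w \<nu>" using HM_irrational(2)[OF k False \<nu>(1)] \<mu> by simp
    then show ?thesis using \<nu>(1) by blast
  qed
qed

theorem theorem8p5:
  fixes k :: nat
  assumes "k \<ge> 1"
  shows
    "(\<forall>\<alpha> \<nu>. \<alpha> \<notin> \<rat> \<longrightarrow> allowable k \<alpha> \<nu> \<longrightarrow>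
        semi_denjoy_minimal shift (HM_B k \<alpha> \<nu>) \<and>
        inv_prob_measures shift (HM_B k \<alpha> \<nu>) = {HM_lambda k \<alpha> \<nu>})
   \<and> (\<forall>(p::nat) (q::nat) \<nu>. q > 0 \<longrightarrow> coprime p q \<longrightarrow> allowable k (real p / real q) \<nu> \<longrightarrow>
        (\<exists>\<O>. finite \<O> \<and> HM_B k (real p / real q) \<nu> = \<Union>\<O> \<and>
          (\<forall>P\<in>\<O>. periodic_orbit shift (q * k div gcd p k) P \<and> rho_set_eq P (real p / real q)) \<and>
          (\<exists>c \<mu>. (\<forall>P\<in>\<O>. 0 \<le> c P \<and> \<mu> P \<in> inv_prob_measures shift P) \<and> (\<Sum>P\<in>\<O>. c P) = (1::real) \<and>
             prob_space (HM_lambda k (real p / real q) \<nu>) \<and>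
             (\<forall>A\<in>sets borel. measure (HM_lambda k (real p / real q) \<nu>) A
                = (\<Sum>P\<in>\<O>. c P * measure (\<mu> P) A)))))
   \<and> (\<forall>Z \<omega>. (symbolic_kfsm k Z \<and> recurrent_set shift Z \<and> rho_set_eq Z \<omega>) \<longleftrightarrow>
        (\<exists>\<nu>. allowable k \<omega> \<nu> \<and> Z = HM_B k \<omega> \<nu>))
   \<and> {\<mu>. \<exists>Z. symbolic_kfsm k Z \<and> recurrent_set shift Z \<and> \<mu> \<in> inv_prob_measures shift Z}
        = {HM_lambda k \<omega> \<nu> |\<omega> \<nu>. allowable k \<omega> \<nu>}"
proof (intro conjI allI impI, goal_cases)
  case (1 \<alpha> \<nu>) then show ?case by (rule HM_irrational(1)[OF assms])
next
  case (2 \<alpha> \<nu>) then show ?case by (rule HM_irrational(2)[OF assms])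
next
  case (3 p q \<nu>) then show ?case by (rule HM_rational[OF assms])
next
  case (4 Z \<omega>)
  show ?case using recurrent_kfsm_eq_HM_B[OF assms] HM_B_kfsm[OF assms] by auto
next
  case 5
  show ?case
  proof (intro subset_antisym subsetI)
    fix \<mu> assume "\<mu> \<in> {\<mu>. \<exists>Z. symbolic_kfsm k Z \<and> recurrent_set shift Z \<and> \<mu> \<in> inv_prob_measures shift Z}"
    then show "\<mu> \<in> {HM_lambda k \<omega> \<nu> |\<omega> \<nu>. allowable k \<omega> \<nu>}"
      using recurrent_kfsm_measure[OF assms] by blast
  next
    fix \<mu> assume "\<mu> \<in> {HM_lambda k \<omega> \<nu> |\<omega> \<nu>. allowable k \<omega> \<nu>}"
    then obtain \<omega> \<nu> where "allowable k \<omega> \<nu>" "\<mu> = HM_lambda k \<omega> \<nu>" by blast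
    then show "\<mu> \<in> {\<mu>. \<exists>Z. symbolic_kfsm k Z \<and> recurrent_set shift Z \<and> \<mu> \<in> inv_prob_measures shift Z}"
      using HM_B_kfsm[OF assms] by blast
  qed
qed

end
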